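(* Let $\beta>1$. Let $T\colon M\to M$ be a mixing transformation (with respect to $\mu$) modelled by a two-sided Young tower whose return time $\phi$ has tails $\mu_Y(\phi\ge n)=O(n^{-\beta})$. Then $T$ satisfies the Functional Correlation Bound with rate $n^{-(\beta-1)}$; that is, there exists a constant $C>0$ such that for all integers $1\le p<q$ and all integers $0\le n_0\le\cdots\le n_{q-1}$ with $n_{p-1}<n_p$, $$\Big|\int_M G(T^{n_0}x,\dots,T^{n_{q-1}}x)\,d\mu(x)-\int_{M^2}G(T^{n_0}x_0,\dots,T^{n_{p-1}}x_0,T^{n_p}x_1,\dots,T^{n_{q-1}}x_1)\,d\mu(x_0)\,d\mu(x_1)\Big|\le C(n_p-n_{p-1})^{-(\beta-1)}\Big(|G|_\infty+\sum_{i=0}^{q-1}[G]_{\mathcal H,i}\Big)$$ for all separately dynamically Hölder $G\in\mathcal{SH}_q(M)$.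
   Context: **Full-branch Gibbs–Markov maps.** Let $(\bar Y,\bar\mu_Y)$ be a probability space, $\bar F\colon\bar Y\to\bar Y$ ergodic and measure-preserving, and $\alpha$ an at most countable measurable partition of $\bar Y$. $\bar F$ is a full-branch Gibbs–Markov map if there are constants $K>0$, $\theta_0\in(0,1)$ such that for all $a\in\alpha$: (1) $\bar F|_a\colon a\to\bar Y$ is a measurable bijection; (2) for all distinct $y,y'\in\bar Y$ the separation time $s(y,y')=\inf\{n\ge0:\bar F^ny,\bar F^ny'\text{ lie in distinct elements of }\alpha\}$ is finite; (3) with $\zeta\colon a\to\mathbb R^+$, $\zeta=d\bar\mu_Y/d\big((\bar F|_a^{-1})_*\bar\mu_Y\big)$, one has $|\log\zeta(y)-\log\zeta(y')|\le K\theta_0^{s(y,y')}$ for all $y,y'\in a$. **Two-sided Gibbs–Markov maps.** Let $(Y,d)$ be a bounded metric space with Borel probability measure $\mu_Y$ and $F\colon Y\to Y$ ergodic and measure-preserving. $F$ is a two-sided Gibbs–Markov map if there is a full-branch Gibbs–Markov map $\bar F\colon\bar Y\to\bar Y$ and a measure-preserving semiconjugacy $\bar\pi\colon Y\to\bar Y$ ($\bar\pi\circ F=\bar F\circ\bar\pi$, $\bar\pi_*\mu_Y=\bar\mu_Y$) such that, setting $s(y,y')=s(\bar\pi y,\bar\pi y')$ (equal to $\infty$ if $\bar\pi y=\bar\pi y'$, with $\theta^\infty=0$), $d(F^ny,F^ny')\le K(\theta_0^n+\theta_0^{s(y,y')-n})$ for all $y,y'\in Y$, $n\ge0$. **Young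 towers.** Let $\phi\colon Y\to\mathbb Z^+$ be integrable and constant on $\bar\pi^{-1}a$ for each $a\in\alpha$. The two-sided tower is $\Delta=\{(y,\ell)\in Y\times\mathbb Z:0\le\ell<\phi(y)\}$ with $f(y,\ell)=(y,\ell+1)$ if $\ell<\phi(y)-1$, $f(y,\ell)=(Fy,0)$ if $\ell=\phi(y)-1$, and $f$-invariant probability measure $\mu_\Delta=(\mu_Y\times\text{counting})/\int_Y\phi\,d\mu_Y$. **Modelled by a Young tower.** $(M,\mu)$ is a bounded metric space with Borel probability measure $\mu$, and $T\colon M\to M$ is ergodic and measure-preserving. $T$ is modelled by a (two-sided) Young tower if there is a measurable $Y\subset M$ with $\mu(Y)>0$ and an integrable function $\phi\colon Y\to\mathbb Z^+$ such that $F=T^\phi\colon Y\to Y$ is a two-sided Gibbs–Markov map with respect to some probability measure $\mu_Y$ (and some bounded metric $d$ on $Y$), $\phi$ is constant on $\bar\pi^{-1}a$ for each $a\in\alpha$ (with $\bar\pi$ and $\alpha$ the semiconjugacy and partition associated with $F$), and $\pi_M\colon\Delta\to M$, $\pi_M(y,\ell)=T^\ell y$, is a measure-preserving semiconjugacy ($\pi_M\circ f=T\circ\pi_M$, $(\pi_M)_*\mu_\Delta=\mu$). $\phi$ is called the return time. **Dynamically Hölder observables.** Fix $\theta\in(0,1)$. For $v\colon M\to\mathbb R$ set $$[v]_{\mathcal H}=\sup_{y,y'\in Y,\,y\ne y'}\ \sup_{0\le\ell<\phi(y)}\frac{|v(T^\ell y)-v(T^\ell y')|}{d(y,y')+\theta^{s(y,y')}},\qquad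 |v|_\infty=\sup_M|v|.$$ For $G\colon M^q\to\mathbb R$ and $0\le i<q$ set $[G]_{\mathcal H,i}=\sup_{x_0,\dots,x_{q-1}\in M}[G(x_0,\dots,x_{i-1},\cdot,x_{i+1},\dots,x_{q-1})]_{\mathcal H}$. $G$ is separately dynamically Hölder, $G\in\mathcal{SH}_q(M)$, if $|G|_\infty+\sum_{i=0}^{q-1}[G]_{\mathcal H,i}<\infty$. Functions are assumed measurable so that all integrals make sense. *)

theory Defs
  imports "HOL-Probability.Probability" "HOL-Library.Landau_Symbols"
begin

definition mp_semiconjugacy ::
    "'a measure \<Rightarrow> ('a \<Rightarrow> 'a) \<Rightarrow> 'b measure \<Rightarrow> ('b \<Rightarrow> 'b) \<Rightarrow> ('a \<Rightarrow> 'b) \<Rightarrow> bool" where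
  "mp_semiconjugacy M f N g h \<longleftrightarrow>
     h \<in> measurable M N \<and> distr M N h = N \<and> (\<forall>x\<in>space M. h (f x) = g (h x))"

locale ergodic_system = prob_space M for M :: "'a measure" +
  fixes T :: "'a \<Rightarrow> 'a"
  assumes T_measurable: "T \<in> measurable M M"
    and T_preserving: "distr M M T = M"
    and T_ergodic: "\<And>A. A \<in> sets M \<Longrightarrow> T -` A \<inter> space M = A \<Longrightarrow> prob A = 0 \<or> prob A = 1"

definition mixing :: "'a measure \<Rightarrow> ('a \<Rightarrow> 'a) \<Rightarrow> bool" where
  "mixing M T \<longleftrightarrow>
     (\<forall>A\<in>sets M. \<forall>B\<in>sets M.
        (\<lambda>n. measure M (A \<inter> ((T ^^ n) -` B \<inter> space M))) \<longlonglongrightarrow> measure M A * measure M B)"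

text \<open>In \<^typ>\<open>enat\<close> the infimum of the empty set is \<open>\<infinity>\<close>; in particular, for the cells of a
  partition, the separation time of a point from itself is \<open>\<infinity>\<close>.\<close>

definition separation_time :: "('b \<Rightarrow> 'b) \<Rightarrow> 'b set set \<Rightarrow> 'b \<Rightarrow> 'b \<Rightarrow> enat" where
  "separation_time F \<alpha> y y' =
     (INF n\<in>{n. \<exists>a\<in>\<alpha>. \<exists>b\<in>\<alpha>. a \<noteq> b \<and> (F ^^ n) y \<in> a \<and> (F ^^ n) y' \<in> b}. enat n)"

text \<open>\<open>epow_shift \<theta> s n\<close> is \<open>\<theta>\<close> to the power \<open>s - n\<close>, where \<open>s - n\<close> may be negative
  and \<open>\<theta>\<close> to the power \<open>\<infinity>\<close> is \<open>0\<close>.\<close>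

definition epow_shift :: "real \<Rightarrow> enat \<Rightarrow> nat \<Rightarrow> real" where
  "epow_shift \<theta> s n = (case s of enat m \<Rightarrow> \<theta> powi (int m - int n) | \<infinity> \<Rightarrow> 0)"

abbreviation epow :: "real \<Rightarrow> enat \<Rightarrow> real" where
  "epow \<theta> s \<equiv> epow_shift \<theta> s 0"

text \<open>The function \<open>\<zeta>\<close> below is a version, defined and positive at every point of \<open>a\<close>, of the
  Radon--Nikodym derivative of the measure restricted to \<open>a\<close> with respect to its push-forward
  under the inverse branch.  Measurability of that inverse branch is what makes the push-forward
  meaningful (\<^const>\<open>distr\<close> is a junk value otherwise).\<close>

locale full_branch_Gibbs_Markov = ergodic_system M F for M :: "'b measure" and F +
  fixes \<alpha> :: "'b set set" and K \<theta>\<^sub>0 :: real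
  assumes partition: "partition_on (space M) \<alpha>" "countable \<alpha>" "\<alpha> \<subseteq> sets M"
    and K_pos: "0 < K"
    and \<theta>\<^sub>0: "0 < \<theta>\<^sub>0" "\<theta>\<^sub>0 < 1"
    and full_branch: "\<And>a. a \<in> \<alpha> \<Longrightarrow> bij_betw F a (space M)"
    and inverse_branch_measurable:
      "\<And>a. a \<in> \<alpha> \<Longrightarrow> the_inv_into a F \<in> measurable M (restrict_space M a)"
    and separation_finite:
      "\<And>y y'. y \<in> space M \<Longrightarrow> y' \<in> space M \<Longrightarrow> y \<noteq> y' \<Longrightarrow> separation_time F \<alpha> y y' < \<infinity>"
    and distortion: "\<And>a. a \<in> \<alpha> \<Longrightarrow>
      \<exists>\<zeta> :: 'b \<Rightarrow> real. \<zeta> \<in> borel_measurable (restrict_space M a) \<and> (\<forall>y\<in>a. 0 < \<zeta> y) \<and>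
        restrict_space M a =
          density (distr M (restrict_space M a) (the_inv_into a F)) (\<lambda>y. ennreal (\<zeta> y)) \<and>
        (\<forall>y\<in>a. \<forall>y'\<in>a. \<bar>ln (\<zeta> y) - ln (\<zeta> y')\<bar> \<le> K * epow \<theta>\<^sub>0 (separation_time F \<alpha> y y'))"

text \<open>The measure on \<open>Y\<close> is Borel for the metric \<open>d\<close>, which need not be related to an ambient
  metric.  The contraction estimate uses the constants \<open>K\<close> and \<open>\<theta>\<^sub>0\<close> of the quotient map.\<close>

locale two_sided_Gibbs_Markov =
  Metric_space Y d + ergodic_system \<mu>\<^sub>Y F + bar: full_branch_Gibbs_Markov \<mu>b Fb \<alpha> K \<theta>\<^sub>0
  for Y :: "'y set" and d :: "'y \<Rightarrow> 'y \<Rightarrow> real" and \<mu>\<^sub>Y :: "'y measure" and F :: "'y \<Rightarrow> 'y"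
    and \<mu>b :: "'b measure" and Fb :: "'b \<Rightarrow> 'b" and \<alpha> :: "'b set set" and K \<theta>\<^sub>0 :: real +
  fixes \<pi>b :: "'y \<Rightarrow> 'b"
  assumes Y_bounded: "mbounded Y"
    and Y_borel: "space \<mu>\<^sub>Y = Y" "sets \<mu>\<^sub>Y = sets (sigma Y {U. openin mtopology U})"
    and \<pi>b: "mp_semiconjugacy \<mu>\<^sub>Y F \<mu>b Fb \<pi>b"
    and contraction: "\<And>y y' n. y \<in> Y \<Longrightarrow> y' \<in> Y \<Longrightarrow>
      d ((F ^^ n) y) ((F ^^ n) y')
        \<le> K * (\<theta>\<^sub>0 ^ n + epow_shift \<theta>\<^sub>0 (separation_time Fb \<alpha> (\<pi>b y) (\<pi>b y')) n)"

text \<open>As levels are nonnegative, they are taken in \<^typ>\<open>nat\<close> rather than \<^typ>\<open>int\<close>.\<close>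

definition tower :: "'y set \<Rightarrow> ('y \<Rightarrow> nat) \<Rightarrow> ('y \<times> nat) set" where
  "tower Y \<phi> = {(y, l). y \<in> Y \<and> l < \<phi> y}"

definition tower_map :: "('y \<Rightarrow> 'y) \<Rightarrow> ('y \<Rightarrow> nat) \<Rightarrow> 'y \<times> nat \<Rightarrow> 'y \<times> nat" where
  "tower_map F \<phi> = (\<lambda>(y, l). if Suc l < \<phi> y then (y, Suc l) else (F y, 0))"

definition tower_measure :: "'y measure \<Rightarrow> ('y \<Rightarrow> nat) \<Rightarrow> ('y \<times> nat) measure" where
  "tower_measure \<mu>\<^sub>Y \<phi> =
     scale_measure (ennreal (1 / (LINT y|\<mu>\<^sub>Y. real (\<phi> y))))
       (restrict_space (\<mu>\<^sub>Y \<Otimes>\<^sub>M count_space UNIV) (tower (space \<mu>\<^sub>Y) \<phi>))"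

locale modelled_by_Young_tower =
  ergodic_system \<mu> T +
  base: two_sided_Gibbs_Markov Y d \<mu>\<^sub>Y "\<lambda>y. (T ^^ \<phi> y) y" \<mu>b Fb \<alpha> K \<theta>\<^sub>0 \<pi>b
  for \<mu> :: "'m::metric_space measure" and T :: "'m \<Rightarrow> 'm"
    and Y :: "'m set" and \<phi> :: "'m \<Rightarrow> nat" and d :: "'m \<Rightarrow> 'm \<Rightarrow> real" and \<mu>\<^sub>Y :: "'m measure"
    and \<mu>b :: "'b measure" and Fb :: "'b \<Rightarrow> 'b" and \<alpha> :: "'b set set" and \<pi>b :: "'m \<Rightarrow> 'b"
    and K \<theta>\<^sub>0 :: real +
  assumes M_bounded: "bounded (UNIV :: 'm set)"
    and M_borel: "sets \<mu> = sets borel"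
    and Y_positive: "Y \<in> sets \<mu>" "0 < measure \<mu> Y"
    and \<phi>_positive: "\<And>y. y \<in> Y \<Longrightarrow> 0 < \<phi> y"
    and \<phi>_integrable: "integrable \<mu>\<^sub>Y (\<lambda>y. real (\<phi> y))"
    and \<phi>_constant: "\<And>a. a \<in> \<alpha> \<Longrightarrow> \<phi> constant_on (\<pi>b -` a \<inter> Y)"
    and \<pi>\<^sub>M: "mp_semiconjugacy (tower_measure \<mu>\<^sub>Y \<phi>) (tower_map (\<lambda>y. (T ^^ \<phi> y) y) \<phi>) \<mu> T
      (\<lambda>(y, l). (T ^^ l) y)"

text \<open>Suprema are taken in \<^typ>\<open>ennreal\<close>, where they always exist and where the supremum of the
  empty set is \<open>0\<close>.  The argument \<open>s\<close> is the separation time on \<open>Y\<close>.\<close>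

definition sup_norm_on :: "'x set \<Rightarrow> ('x \<Rightarrow> real) \<Rightarrow> ennreal" where
  "sup_norm_on X v = (SUP x\<in>X. ennreal \<bar>v x\<bar>)"

definition dyn_Holder_seminorm ::
    "('m \<Rightarrow> 'm) \<Rightarrow> 'm set \<Rightarrow> ('m \<Rightarrow> nat) \<Rightarrow> ('m \<Rightarrow> 'm \<Rightarrow> real) \<Rightarrow> ('m \<Rightarrow> 'm \<Rightarrow> enat) \<Rightarrow> real \<Rightarrow>
     ('m \<Rightarrow> real) \<Rightarrow> ennreal" where
  "dyn_Holder_seminorm T Y \<phi> d s \<theta> v =
     (SUP y\<in>Y. SUP y'\<in>Y - {y}. SUP l\<in>{..<\<phi> y}.
        ennreal (\<bar>v ((T ^^ l) y) - v ((T ^^ l) y')\<bar> / (d y y' + epow \<theta> (s y y'))))"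

text \<open>The space \<open>M\<^sup>q\<close> is represented by the functions on \<open>{..<q}\<close> that are extended by
  \<^const>\<open>undefined\<close>.\<close>

definition sep_dyn_Holder_seminorm ::
    "('m \<Rightarrow> 'm) \<Rightarrow> 'm set \<Rightarrow> ('m \<Rightarrow> nat) \<Rightarrow> ('m \<Rightarrow> 'm \<Rightarrow> real) \<Rightarrow> ('m \<Rightarrow> 'm \<Rightarrow> enat) \<Rightarrow> real \<Rightarrow>
     nat \<Rightarrow> nat \<Rightarrow> ((nat \<Rightarrow> 'm) \<Rightarrow> real) \<Rightarrow> ennreal" where
  "sep_dyn_Holder_seminorm T Y \<phi> d s \<theta> q i G =
     (SUP x\<in>{..<q} \<rightarrow>\<^sub>E UNIV. dyn_Holder_seminorm T Y \<phi> d s \<theta> (\<lambda>t. G (x(i := t))))"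

definition sep_dyn_Holder_norm ::
    "('m \<Rightarrow> 'm) \<Rightarrow> 'm set \<Rightarrow> ('m \<Rightarrow> nat) \<Rightarrow> ('m \<Rightarrow> 'm \<Rightarrow> real) \<Rightarrow> ('m \<Rightarrow> 'm \<Rightarrow> enat) \<Rightarrow> real \<Rightarrow>
     nat \<Rightarrow> ((nat \<Rightarrow> 'm) \<Rightarrow> real) \<Rightarrow> ennreal" where
  "sep_dyn_Holder_norm T Y \<phi> d s \<theta> q G =
     sup_norm_on ({..<q} \<rightarrow>\<^sub>E UNIV) G + (\<Sum>i<q. sep_dyn_Holder_seminorm T Y \<phi> d s \<theta> q i G)"

definition sep_dyn_Holder ::
    "'m measure \<Rightarrow> ('m \<Rightarrow> 'm) \<Rightarrow> 'm set \<Rightarrow> ('m \<Rightarrow> nat) \<Rightarrow> ('m \<Rightarrow> 'm \<Rightarrow> real) \<Rightarrow>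
     ('m \<Rightarrow> 'm \<Rightarrow> enat) \<Rightarrow> real \<Rightarrow> nat \<Rightarrow> ((nat \<Rightarrow> 'm) \<Rightarrow> real) set" where
  "sep_dyn_Holder \<mu> T Y \<phi> d s \<theta> q =
     {G \<in> borel_measurable (\<Pi>\<^sub>M i\<in>{..<q}. \<mu>). sep_dyn_Holder_norm T Y \<phi> d s \<theta> q G < \<infinity>}"

text \<open>The constant \<open>C\<close> is uniform in \<open>p\<close>, \<open>q\<close>, the times \<open>n\<close> and the observable \<open>G\<close>.  The
  bound is a real inequality: \<^const>\<open>enn2real\<close> is applied to a finite value.\<close>

definition functional_correlation_bound ::
    "'m measure \<Rightarrow> ('m \<Rightarrow> 'm) \<Rightarrow> 'm set \<Rightarrow> ('m \<Rightarrow> nat) \<Rightarrow> ('m \<Rightarrow> 'm \<Rightarrow> real) \<Rightarrow>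
     ('m \<Rightarrow> 'm \<Rightarrow> enat) \<Rightarrow> real \<Rightarrow> (nat \<Rightarrow> real) \<Rightarrow> bool" where
  "functional_correlation_bound \<mu> T Y \<phi> d s \<theta> rate \<longleftrightarrow>
     (\<exists>C>0. \<forall>p q. \<forall>n :: nat \<Rightarrow> nat.
        1 \<le> p \<longrightarrow> p < q \<longrightarrow> mono_on {..<q} n \<longrightarrow> n (p - 1) < n p \<longrightarrow>
        (\<forall>G\<in>sep_dyn_Holder \<mu> T Y \<phi> d s \<theta> q.
          \<bar>(LINT x|\<mu>. G (\<lambda>i\<in>{..<q}. (T ^^ n i) x)) -
           (LINT (x\<^sub>0, x\<^sub>1)|(\<mu> \<Otimes>\<^sub>M \<mu>). G (\<lambda>i\<in>{..<q}. if i < p then (T ^^ n i) x\<^sub>0 else (T ^^ n i) x\<^sub>1))\<bar>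
          \<le> C * rate (n p - n (p - 1)) * enn2real (sep_dyn_Holder_norm T Y \<phi> d s \<theta> q G)))"

end

theory Submission
  imports Defs "HOL-Complex_Analysis.Complex_Analysis" "HOL-Number_Theory.Cong"
begin

text \<open>
  Since \<open>\<mu>\<^sub>Y\<close> is absolutely continuous with respect to \<open>\<mu>\<close>, mixing expresses \<open>\<integral> \<psi> d\<mu>\<close> as the limit of
  \<open>\<integral> \<psi> \<circ> T\<^sup>N d\<mu>\<^sub>Y\<close>; it therefore suffices to compare orbits that start on the base, where the two
  arguments of \<open>G\<close> start at times that are congruent modulo the greatest common divisor of the return
  times.  Contraction replaces \<open>G\<close> by a function of the word of cells visited before the gap and of the
  position in the quotient tower after the gap.  The error is governed by time windows of length
  comparable to \<open>n = n\<^sub>p - n\<^bsub>p-1\<^esub>\<close> that contain few returns to the base; these have measure \<open>O(n\<^bsup>-(\<beta>-1)\<^esup>)\<close>.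

  What remains is to equidistribute, uniformly over the words before the gap, the law of the
  position after the gap.  Conditioning on a word produces a density with bounded logarithmic
  oscillation, and at each return such a density splits off a fixed fraction of its mass as the
  constant density while the rest keeps the same regularity.  This regeneration leads to a renewal
  equation whose inter-arrival law has tails \<open>O(n\<^bsup>-\<beta>\<^esup>)\<close>.  By a weighted Wiener lemma the increments
  of its solutions are \<open>O(n\<^bsup>-\<beta>\<^esup>)\<close>, hence the solutions converge at rate \<open>n\<^bsup>-(\<beta>-1)\<^esup>\<close>.
\<close>

text \<open>Mixing comes without a rate, so it is used only in limits; every rate is produced on the
  quotient. The function observed after the gap depends on the word before it, and there are
  infinitely many words. This is why every estimate for a density is linear in its integral: summing
  over words then costs nothing, and the constant depends neither on \<open>p\<close>,
  \<open>q\<close>, the times nor on the observable. The return times may have a common divisor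
  larger than 1, so laws at two congruent times are compared with each other and a limiting law is
  never named. The exponent drops from \<beta> to \<beta> - 1 in two places: a window of time placed
  anywhere on an orbit may begin inside a long excursion (\<open>window_decay\<close>), and a
  renewal solution is recovered by summing its increments (\<open>renewal_convergence\<close>).
  These losses sit in separate error terms that are added, so only one power is lost in
  total.\<close>

section \<open>Polynomial weights and convolution estimates\<close>

definition decay :: "real \<Rightarrow> nat \<Rightarrow> real" where
  "decay \<beta> n = real (Suc n) powr (- \<beta>)"

lemma decay_pos [simp]: "0 < decay \<beta> n"
  by (simp add: decay_def)

lemma decay_nonneg [simp]: "0 \<le> decay \<beta> n"
  by (simp add: decay_def)

lemma decay_0 [simp]: "decay \<beta> 0 = 1"
  by (simp add: decay_def)

lemma decay_antimono: "0 \<le> \<beta> \<Longrightarrow> m \<le> n \<Longrightarrow> decay \<beta> n \<le> decay \<beta> m"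
  unfolding decay_def by (rule powr_mono2') auto

lemma decay_mono_exponent: "\<gamma> \<le> \<beta> \<Longrightarrow> decay \<beta> n \<le> decay \<gamma> n"
  unfolding decay_def by (intro powr_mono) auto

text \<open>Weights at comparable indices are comparable. Later estimates use this to replace a time
  \<open>n\<close> by a fixed fraction of it at the cost of a constant.\<close>

lemma decay_scale:
  assumes "0 \<le> \<beta>" "0 < c" "real (Suc n) \<le> c * real (Suc m)"
  shows "decay \<beta> m \<le> c powr \<beta> * decay \<beta> n"
proof -
  have "(c * real (Suc m)) powr (-\<beta>) \<le> real (Suc n) powr (-\<beta>)"
    using assms by (intro powr_mono2') auto
  then have "c powr (-\<beta>) * decay \<beta> m \<le> decay \<beta> n"
    unfolding decay_def using assms by (subst (asm) powr_mult) auto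
  then have "c powr \<beta> * (c powr (-\<beta>) * decay \<beta> m) \<le> c powr \<beta> * decay \<beta> n"
    by (intro mult_left_mono) auto
  moreover have "c powr \<beta> * c powr (-\<beta>) = 1"
    using assms by (simp flip: powr_add)
  ultimately show ?thesis by (simp add: mult.assoc[symmetric])
qed

lemma summable_decay: "1 < \<beta> \<Longrightarrow> summable (decay \<beta>)"
  unfolding decay_def using summable_real_powr_iff[of "-\<beta>"]
  by (subst summable_Suc_iff[of "\<lambda>n. real n powr (-\<beta>)"]) auto

lemma sum_decay_le:
  assumes "1 < \<beta>" "finite I" shows "sum (decay \<beta>) I \<le> suminf (decay \<beta>)"
  by (rule sum_le_suminf) (use assms summable_decay in auto)

text \<open>Integral test: by the mean value theorem the weight is dominated by the increments of
  its antiderivative, a multiple of \<open>x powr (1 - \<beta>)\<close>, and these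
  telescope.\<close>

lemma sum_decay_tail:
  assumes "1 < \<beta>"
  shows "\<exists>C>0. \<forall>N L. (\<Sum>n\<in>{N..<L}. decay \<beta> n) \<le> C * decay (\<beta> - 1) N"
proof -
  define C where "C = 2 powr \<beta> / (\<beta> - 1)"
  have C: "0 < C" using assms by (simp add: C_def)
  have step: "decay \<beta> n \<le> C * (decay (\<beta> - 1) n - decay (\<beta> - 1) (Suc n))" for n
  proof -
    have "\<exists>\<xi>. real (Suc n) < \<xi> \<and> \<xi> < real (Suc (Suc n)) \<and>
       real (Suc (Suc n)) powr (1 - \<beta>) - real (Suc n) powr (1 - \<beta>) =
         (real (Suc (Suc n)) - real (Suc n)) * ((1 - \<beta>) * \<xi> powr (1 - \<beta> - 1))"
      by (rule MVT2) (auto intro!: derivative_eq_intros)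
    then obtain \<xi> where \<xi>: "real (Suc n) < \<xi>" "\<xi> < real (Suc (Suc n))"
      and eq: "real (Suc (Suc n)) powr (1 - \<beta>) - real (Suc n) powr (1 - \<beta>) = (1 - \<beta>) * \<xi> powr (- \<beta>)"
      by auto
    \<comment> \<open>The intermediate point lies to the right of \<open>Suc n\<close>, where the
      weight is smaller; moving one index to the right costs at most
      \<open>2 powr \<beta>\<close>.\<close>
    have "decay \<beta> n \<le> 2 powr \<beta> * decay \<beta> (Suc n)"
      using assms by (intro decay_scale) auto
    also have "decay \<beta> (Suc n) \<le> \<xi> powr (-\<beta>)"
      unfolding decay_def using \<xi> assms by (intro powr_mono2') auto
    also have "\<xi> powr (-\<beta>) = (decay (\<beta> - 1) n - decay (\<beta> - 1) (Suc n)) / (\<beta> - 1)"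
      using eq assms by (simp add: decay_def field_simps)
    finally show ?thesis by (simp add: C_def mult_left_mono)
  qed
  have "(\<Sum>n\<in>{N..<L}. decay \<beta> n) \<le> C * decay (\<beta> - 1) N" for N L
  proof (cases "N \<le> L")
    case True
    have "(\<Sum>n\<in>{N..<L}. decay \<beta> n) \<le> (\<Sum>n\<in>{N..<L}. C * (decay (\<beta> - 1) n - decay (\<beta> - 1) (Suc n)))"
      by (intro sum_mono step)
    also have "\<dots> = C * (decay (\<beta> - 1) N - decay (\<beta> - 1) L)"
      using True by (simp add: sum_distrib_left[symmetric] sum_Suc_diff'[where f="\<lambda>n. - decay (\<beta> - 1) n", simplified])
    also have "\<dots> \<le> C * decay (\<beta> - 1) N"
      using C by (intro mult_left_mono) auto
    finally show ?thesis .
  qed (use C in auto)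
  then show ?thesis using C by blast
qed

text \<open>A kernel of mass \<kappa> < 1 leaves room to stretch time by a factor \<open>c\<close>
  slightly above 1 and still contract. The choice of \<open>c\<close> makes
  \<open>\<kappa> * c powr \<beta>\<close> the square root of \<kappa>.\<close>

lemma exists_scale_less_1:
  fixes \<kappa> \<beta> :: real
  assumes "0 \<le> \<kappa>" "\<kappa> < 1" "0 < \<beta>"
  obtains c where "1 < c" "\<kappa> * c powr \<beta> < 1"
proof (cases "\<kappa> = 0")
  case True
  then show ?thesis using that[of 2] by auto
next
  case False
  define c where "c = \<kappa> powr (- 1 / (2 * \<beta>))"
  have "1 < c"
    using powr_less_mono2_neg[of "- 1 / (2 * \<beta>)" \<kappa> 1] assms False by (simp add: c_def field_simps)
  moreover have "\<kappa> * c powr \<beta> = \<kappa> powr (1/2)"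
  proof -
    have "\<kappa> * c powr \<beta> = \<kappa> powr 1 * \<kappa> powr (- 1 / 2)"
      unfolding c_def using assms False by (simp add: powr_powr)
    also have "\<dots> = \<kappa> powr (1/2)" by (simp only: powr_add[symmetric]) simp
    finally show ?thesis .
  qed
  moreover have "\<kappa> powr (1/2) < 1"
    using powr_less_mono2[of "1/2" \<kappa> 1] assms by simp
  ultimately show ?thesis using that by simp
qed

text \<open>One of \<open>n - i\<close> and \<open>i\<close> is a definite fraction of
  \<open>n\<close>. For \<open>c\<close> close to 1 the constant of the first alternative is close
  to 1, while that of the second is large; the latter may only meet quantities that are
  summed.\<close>

lemma decay_split:
  assumes "0 \<le> \<beta>" "1 < c" "i \<le> n"
  shows "decay \<beta> (n - i) \<le> c powr \<beta> * decay \<beta> n \<or>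
         decay \<beta> i \<le> (c / (c - 1)) powr \<beta> * decay \<beta> n"
proof (cases "real (Suc n) \<le> c * real (Suc (n - i))")
  case True
  then show ?thesis using assms by (intro disjI1 decay_scale) auto
next
  case False
  then have "c * (real n - real i + 1) < real n + 1" using assms by (simp add: of_nat_diff algebra_simps)
  then have "(c - 1) * (real n + 1) \<le> c * (real i + 1)" using assms by (simp add: algebra_simps)
  then have "real (Suc n) \<le> c / (c - 1) * real (Suc i)" using assms by (simp add: field_simps)
  then show ?thesis using assms by (intro disjI2 decay_scale) auto
qed

text \<open>Sequences with this weight form a convolution algebra: in each product one factor
  carries the decay at \<open>n\<close> and the other factor is summed. Keeping the sums
  \<open>c\<close> and \<open>d\<close> apart from the weighted bounds gives a bound linear in each
  sequence.\<close>

lemma conv_decay: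
  fixes f g :: "nat \<Rightarrow> real"
  assumes \<beta>: "0 \<le> \<beta>" and f: "\<And>n. 0 \<le> f n" "\<And>n. f n \<le> C * decay \<beta> n" "\<And>n. (\<Sum>k\<le>n. f k) \<le> c"
    and g: "\<And>n. 0 \<le> g n" "\<And>n. g n \<le> D * decay \<beta> n" "\<And>n. (\<Sum>k\<le>n. g k) \<le> d"
  shows "(\<Sum>i\<le>n. f i * g (n - i)) \<le> 2 powr \<beta> * (C * d + c * D) * decay \<beta> n"
proof -
  let ?t = "2 powr \<beta> * decay \<beta> n"
  have C: "0 \<le> C" "0 \<le> D" using f(1)[of 0] f(2)[of 0] g(1)[of 0] g(2)[of 0] by auto
  have "f i * g (n - i) \<le> C * ?t * g (n - i) + f i * (D * ?t)" if "i \<le> n" for i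
  proof -
    have "decay \<beta> (n - i) \<le> ?t \<or> decay \<beta> i \<le> ?t" using decay_split[OF \<beta>, of 2 i n] that by simp
    then show ?thesis
  proof
    assume "decay \<beta> (n - i) \<le> ?t"
    then have "f i * g (n - i) \<le> f i * (D * ?t)"
      using C g(2)[of "n-i"] by (intro mult_left_mono f order_trans[OF g(2)] mult_left_mono) auto
    moreover have "0 \<le> C * ?t * g (n - i)" using C g by auto
    ultimately show ?thesis by linarith
  next
    assume "decay \<beta> i \<le> ?t"
    then have "f i * g (n - i) \<le> C * ?t * g (n - i)"
      using C by (intro mult_right_mono g order_trans[OF f(2)] mult_left_mono) auto
    moreover have "0 \<le> f i * (D * ?t)" using C f by auto
    ultimately show ?thesis by linarith
  qed
  qed
  then have "(\<Sum>i\<le>n. f i * g (n - i)) \<le> (\<Sum>i\<le>n. C * ?t * g (n - i) + f i * (D * ?t))"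
    by (intro sum_mono) auto
  also have "\<dots> = C * ?t * (\<Sum>i\<le>n. g (n - i)) + (\<Sum>i\<le>n. f i) * (D * ?t)"
    by (simp add: sum.distrib sum_distrib_left sum_distrib_right)
  also have "(\<Sum>i\<le>n. g (n - i)) = (\<Sum>i\<le>n. g i)"
    by (rule sum.reindex_bij_witness[of _ "\<lambda>i. n - i" "\<lambda>i. n - i"]) auto
  also have "C * ?t * (\<Sum>i\<le>n. g i) + (\<Sum>i\<le>n. f i) * (D * ?t) \<le> C * ?t * d + c * (D * ?t)"
    using C by (intro add_mono mult_left_mono mult_right_mono f g) auto
  finally show ?thesis by (simp add: algebra_simps)
qed

lemma sum_conv_le:
  fixes f g :: "nat \<Rightarrow> real"
  assumes "\<And>n. 0 \<le> f n" "\<And>n. 0 \<le> g n"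
  shows "(\<Sum>k\<le>n. \<Sum>i\<le>k. f i * g (k - i)) \<le> (\<Sum>i\<le>n. f i) * (\<Sum>j\<le>n. g j)"
proof -
  have "(\<Sum>k\<le>n. \<Sum>i\<le>k. f i * g (k - i)) = (\<Sum>(i,j)\<in>{(i,j). i + j \<le> n}. f i * g j)"
    by (rule sum.triangle_reindex_eq[symmetric])
  also have "\<dots> \<le> (\<Sum>(i,j)\<in>{..n} \<times> {..n}. f i * g j)"
    by (rule sum_mono2) (use assms in auto)
  also have "\<dots> = (\<Sum>i\<le>n. f i) * (\<Sum>j\<le>n. g j)"
    by (simp add: sum_product sum.cartesian_product)
  finally show ?thesis .
qed

text \<open>Two passes. Summing the recursion bounds the total of \<open>b\<close>, because the
  kernel has mass below 1. In the induction that follows, terms with \<open>n - i\<close> close to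
  \<open>n\<close> are covered by the induction hypothesis, with \<open>c\<close> so close to 1 that
  the kernel still contracts; in the remaining terms the kernel itself decays and \<open>b\<close>
  is summed.\<close>

lemma defective_renewal_decay:
  fixes b d :: "nat \<Rightarrow> real"
  assumes \<beta>: "1 < \<beta>" and b: "\<And>n. 0 \<le> b n" and G: "0 \<le> G"
    and rec: "\<And>n. b n \<le> G * decay \<beta> n + (\<Sum>i=1..n. d i * b (n - i))"
    and d: "\<And>i. 0 \<le> d i" "\<And>i. d i \<le> D * decay \<beta> i" "\<And>n. (\<Sum>i\<le>n. d i) \<le> \<kappa>" "\<kappa> < 1"
  shows "\<exists>C. \<forall>n. b n \<le> C * decay \<beta> n"
proof -
  have \<kappa>: "0 \<le> \<kappa>" using d(1)[of 0] d(3)[of 0] by simp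
  have D: "0 \<le> D" using d(1)[of 0] d(2)[of 0] by simp
  have rec': "b n \<le> G * decay \<beta> n + (\<Sum>i\<le>n. d i * b (n - i))" for n
  proof -
    have "(\<Sum>i=1..n. d i * b (n - i)) \<le> (\<Sum>i\<le>n. d i * b (n - i))"
      by (rule sum_mono2) (auto simp: b d)
    then show ?thesis using rec[of n] by linarith
  qed
  define L where "L = G * suminf (decay \<beta>) / (1 - \<kappa>)"
  have L: "(\<Sum>k\<le>n. b k) \<le> L" for n
  proof -
    have "(\<Sum>k\<le>n. b k) \<le> (\<Sum>k\<le>n. G * decay \<beta> k + (\<Sum>i\<le>k. d i * b (k - i)))"
      by (intro sum_mono rec')
    also have "\<dots> = G * (\<Sum>k\<le>n. decay \<beta> k) + (\<Sum>k\<le>n. \<Sum>i\<le>k. d i * b (k - i))"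
      by (simp add: sum.distrib sum_distrib_left)
    also have "\<dots> \<le> G * suminf (decay \<beta>) + (\<Sum>i\<le>n. d i) * (\<Sum>k\<le>n. b k)"
      by (intro add_mono mult_left_mono sum_decay_le sum_conv_le \<beta> G b d) auto
    also have "\<dots> \<le> G * suminf (decay \<beta>) + \<kappa> * (\<Sum>k\<le>n. b k)"
      by (intro add_left_mono mult_right_mono d sum_nonneg b)
    finally have "(1 - \<kappa>) * (\<Sum>k\<le>n. b k) \<le> G * suminf (decay \<beta>)" by (simp add: algebra_simps)
    then show ?thesis using d(4) by (simp add: L_def field_simps)
  qed
  have L0: "0 \<le> L" using L[of 0] b[of 0] by simp
  obtain c where c: "1 < c" "\<kappa> * c powr \<beta> < 1" 
    using exists_scale_less_1[OF \<kappa> d(4), of \<beta>] \<beta> by (metis less_trans zero_less_one)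
  define E where "E = D * (c / (c - 1)) powr \<beta>"
  have E: "0 \<le> E" using D by (simp add: E_def)
  \<comment> \<open>The fixed point of \<open>C = G + E * L + \<kappa> * c powr \<beta> * C\<close>,
    the map by which one induction step changes the constant.\<close>
  define C where "C = (G + E * L) / (1 - \<kappa> * c powr \<beta>)"
  have C: "0 \<le> C" using G E L0 c by (simp add: C_def)
  have "b n \<le> C * decay \<beta> n" for n
  proof (induction n rule: less_induct)
    case (less n)
    have "d i * b (n - i) \<le> d i * (C * (c powr \<beta> * decay \<beta> n)) + E * decay \<beta> n * b (n - i)"
      if i: "i \<in> {1..n}" for i
    proof -
      have "decay \<beta> (n - i) \<le> c powr \<beta> * decay \<beta> n \<or> decay \<beta> i \<le> (c / (c - 1)) powr \<beta> * decay \<beta> n"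
        using \<beta> c i by (intro decay_split) auto
      then show ?thesis
    proof
      assume *: "decay \<beta> (n - i) \<le> c powr \<beta> * decay \<beta> n"
      have "b (n - i) \<le> C * decay \<beta> (n - i)" using i by (intro less) auto
      also have "\<dots> \<le> C * (c powr \<beta> * decay \<beta> n)" using C * by (intro mult_left_mono) auto
      finally have "d i * b (n - i) \<le> d i * (C * (c powr \<beta> * decay \<beta> n))"
        using d by (intro mult_left_mono) auto
      moreover have "0 \<le> E * decay \<beta> n * b (n - i)" using E b by auto
      ultimately show ?thesis by linarith
    next
      assume *: "decay \<beta> i \<le> (c / (c - 1)) powr \<beta> * decay \<beta> n"
      have "d i \<le> D * decay \<beta> i" by (rule d)
      also have "\<dots> \<le> E * decay \<beta> n" unfolding E_def mult.assoc using D * by (intro mult_left_mono) auto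
      finally have "d i * b (n - i) \<le> E * decay \<beta> n * b (n - i)" using b by (intro mult_right_mono) auto
      moreover have "0 \<le> d i * (C * (c powr \<beta> * decay \<beta> n))" using C d by auto
      ultimately show ?thesis by linarith
    qed
    qed
    then have "(\<Sum>i=1..n. d i * b (n - i)) \<le>
        (\<Sum>i=1..n. d i * (C * (c powr \<beta> * decay \<beta> n)) + E * decay \<beta> n * b (n - i))"
      by (rule sum_mono)
    also have "\<dots> = (\<Sum>i=1..n. d i) * (C * (c powr \<beta> * decay \<beta> n)) + E * decay \<beta> n * (\<Sum>i=1..n. b (n - i))"
      by (simp add: sum.distrib sum_distrib_left sum_distrib_right)
    also have "\<dots> \<le> \<kappa> * (C * (c powr \<beta> * decay \<beta> n)) + E * decay \<beta> n * L"
    proof (intro add_mono mult_left_mono mult_right_mono)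
      have "(\<Sum>i=1..n. d i) \<le> (\<Sum>i\<le>n. d i)" by (rule sum_mono2) (auto simp: d)
      then show "(\<Sum>i=1..n. d i) \<le> \<kappa>" using d(3)[of n] by linarith
      have "(\<Sum>i=1..n. b (n - i)) \<le> (\<Sum>i\<le>n. b (n - i))" by (rule sum_mono2) (auto simp: b)
      also have "\<dots> = (\<Sum>i\<le>n. b i)"
        by (rule sum.reindex_bij_witness[of _ "\<lambda>i. n - i" "\<lambda>i. n - i"]) auto
      finally show "(\<Sum>i=1..n. b (n - i)) \<le> L" using L[of n] by linarith
    qed (use C E in auto)
    finally have "b n \<le> (G + E * L + \<kappa> * c powr \<beta> * C) * decay \<beta> n"
      using rec[of n] by (simp add: algebra_simps)
    also have "G + E * L + \<kappa> * c powr \<beta> * C = C"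
      using c by (simp add: C_def field_simps)
    finally show ?case .
  qed
  then show ?thesis by blast
qed

text \<open>A geometric sequence solves a defective renewal equation whose kernel is the point mass
  \<open>x\<close> at time 1.\<close>

lemma power_le_decay:
  assumes "1 < \<beta>" "0 \<le> x" "x < 1"
  obtains C where "0 < C" "\<And>n. x ^ n \<le> C * decay \<beta> n"
proof -
  have "\<exists>C. \<forall>n. x ^ n \<le> C * decay \<beta> n"
  proof (rule defective_renewal_decay[where G=1 and d="\<lambda>i. if i = 1 then x else 0" and \<kappa>=x and D="2 powr \<beta>"])
    show "x ^ n \<le> 1 * decay \<beta> n + (\<Sum>i = 1..n. (if i = 1 then x else 0) * x ^ (n - i))" for n
    proof (cases n)
      case (Suc m)
      have "(\<Sum>i = 1..n. (if i = 1 then x else 0) * x ^ (n - i)) = (\<Sum>i = 1..n. if i = 1 then x ^ n else 0)"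
        by (intro sum.cong) (auto simp: Suc)
      then show ?thesis by (simp add: Suc)
    qed auto
    have "x \<le> 2 powr \<beta> * decay \<beta> 1"
      using assms decay_scale[of \<beta> 2 1 0] by simp
    then show "(if i = 1 then x else 0) \<le> 2 powr \<beta> * decay \<beta> i" for i using assms by auto
    show "(\<Sum>i\<le>n. if i = 1 then x else 0) \<le> x" for n :: nat using assms by (simp add: sum.delta)
  qed (use assms in auto)
  then obtain C where C: "\<And>n. x ^ n \<le> C * decay \<beta> n" by blast
  have "0 < C" using C[of 0] by simp
  then show ?thesis using C by (rule that)
qed

subsection \<open>Renewal sequences and a weighted Wiener lemma\<close>

text \<open>The bound is an explicit argument, since its exact behaviour under products decides
  whether the kernel in \<open>fps_decay_inverse\<close> is defective; for \<open>fps_decay\<close>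
  only finiteness matters.\<close>

definition fps_l1 :: "complex fps \<Rightarrow> real \<Rightarrow> bool" where
  "fps_l1 f c \<longleftrightarrow> (\<forall>n. (\<Sum>k\<le>n. norm (fps_nth f k)) \<le> c)"

definition fps_decay :: "real \<Rightarrow> complex fps \<Rightarrow> bool" where
  "fps_decay \<beta> f \<longleftrightarrow> (\<exists>C. \<forall>n. norm (fps_nth f n) \<le> C * decay \<beta> n)"

lemma norm_fps_mult_nth_le:
  "norm (fps_nth (f * g :: complex fps) n) \<le> (\<Sum>i\<le>n. norm (fps_nth f i) * norm (fps_nth g (n - i)))"
  unfolding fps_mult_nth atLeast0AtMost
  by (rule order_trans[OF norm_sum]) (simp add: norm_mult)

lemma fps_l1_mult:
  assumes "fps_l1 f c" "fps_l1 g d" shows "fps_l1 (f * g) (c * d)"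
  unfolding fps_l1_def
proof
  fix n
  have "(\<Sum>k\<le>n. norm (fps_nth (f * g) k)) \<le> (\<Sum>k\<le>n. \<Sum>i\<le>k. norm (fps_nth f i) * norm (fps_nth g (k - i)))"
    by (intro sum_mono norm_fps_mult_nth_le)
  also have "\<dots> \<le> (\<Sum>i\<le>n. norm (fps_nth f i)) * (\<Sum>i\<le>n. norm (fps_nth g i))"
    by (rule sum_conv_le) auto
  also have "\<dots> \<le> c * d"
    using assms order_trans[OF _ assms(1)[unfolded fps_l1_def, rule_format], of 0 n]
    by (intro mult_mono) (auto simp: fps_l1_def sum_nonneg)
  finally show "(\<Sum>k\<le>n. norm (fps_nth (f * g) k)) \<le> c * d" .
qed

lemma fps_l1_1: "fps_l1 1 1"
  unfolding fps_l1_def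
proof
  fix n
  have "(\<Sum>k\<le>n. norm (fps_nth (1 :: complex fps) k)) = (\<Sum>k\<le>n. if k = 0 then 1 else 0)"
    by (intro sum.cong) auto
  then show "(\<Sum>k\<le>n. norm (fps_nth (1 :: complex fps) k)) \<le> 1" by simp
qed

lemma fps_l1_power: "fps_l1 f c \<Longrightarrow> fps_l1 (f ^ k) (c ^ k)"
  by (induction k) (auto intro: fps_l1_1 fps_l1_mult)

lemma fps_decay_imp_l1:
  assumes "1 < \<beta>" "fps_decay \<beta> f" obtains c where "fps_l1 f c"
proof -
  from assms obtain C where C: "\<And>n. norm (fps_nth f n) \<le> C * decay \<beta> n" by (auto simp: fps_decay_def)
  have C0: "0 \<le> C" using order_trans[OF norm_ge_zero C[of 0]] by simp
  have "(\<Sum>k\<le>n. norm (fps_nth f k)) \<le> C * suminf (decay \<beta>)" for n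
  proof -
    have "(\<Sum>k\<le>n. norm (fps_nth f k)) \<le> (\<Sum>k\<le>n. C * decay \<beta> k)" by (intro sum_mono C)
    also have "\<dots> = C * (\<Sum>k\<le>n. decay \<beta> k)" by (simp add: sum_distrib_left)
    also have "\<dots> \<le> C * suminf (decay \<beta>)" by (intro mult_left_mono sum_decay_le C0 assms) auto
    finally show ?thesis .
  qed
  then show ?thesis using that by (auto simp: fps_l1_def)
qed

lemma fps_decay_mult:
  assumes "1 < \<beta>" "fps_decay \<beta> f" "fps_decay \<beta> g" shows "fps_decay \<beta> (f * g)"
proof -
  obtain c d where "fps_l1 f c" "fps_l1 g d" using assms fps_decay_imp_l1 by metis
  moreover obtain C D where "\<And>n. norm (fps_nth f n) \<le> C * decay \<beta> n" "\<And>n. norm (fps_nth g n) \<le> D * decay \<beta> n"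
    using assms by (auto simp: fps_decay_def)
  ultimately have "norm (fps_nth (f * g) n) \<le> 2 powr \<beta> * (C * d + c * D) * decay \<beta> n" for n
    using assms by (intro order_trans[OF norm_fps_mult_nth_le] conv_decay) (auto simp: fps_l1_def)
  then show ?thesis unfolding fps_decay_def by blast
qed

lemma fps_decay_add:
  assumes "fps_decay \<beta> f" "fps_decay \<beta> g" shows "fps_decay \<beta> (f + g)"
proof -
  obtain C D where *: "\<And>n. norm (fps_nth f n) \<le> C * decay \<beta> n" "\<And>n. norm (fps_nth g n) \<le> D * decay \<beta> n"
    using assms by (auto simp: fps_decay_def)
  have "norm (fps_nth (f + g) n) \<le> (C + D) * decay \<beta> n" for n
    using norm_triangle_ineq[of "fps_nth f n" "fps_nth g n"] *(1)[of n] *(2)[of n]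
    by (simp add: algebra_simps)
  then show ?thesis unfolding fps_decay_def by blast
qed

lemma fps_decay_uminus: "fps_decay \<beta> f \<Longrightarrow> fps_decay \<beta> (- f)"
  by (simp add: fps_decay_def)

lemma fps_decay_1: "fps_decay \<beta> 1"
  unfolding fps_decay_def by (intro exI[of _ 1]) (auto simp: fps_one_def)

lemma fps_decay_0: "fps_decay \<beta> 0"
  unfolding fps_decay_def by (intro exI[of _ 0]) auto

lemma fps_decay_power: "1 < \<beta> \<Longrightarrow> fps_decay \<beta> f \<Longrightarrow> fps_decay \<beta> (f ^ k)"
  by (induction k) (auto intro: fps_decay_1 fps_decay_mult)

lemma fps_decay_sum: "(\<And>i. i \<in> I \<Longrightarrow> fps_decay \<beta> (f i)) \<Longrightarrow> fps_decay \<beta> (sum f I)"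
  by (induction I rule: infinite_finite_induct) (auto intro: fps_decay_0 fps_decay_add)

lemma has_fps_expansion_poly_sum:
  "(\<lambda>z::complex. \<Sum>k<N. c k * z ^ k) has_fps_expansion (\<Sum>k<N. fps_const (c k) * fps_X ^ k)"
  by (induction N) (auto intro!: fps_expansion_intros)

text \<open>A polynomial truncation \<open>P\<close> of \<open>A\<close> stays away from \<open>0\<close> on a disc of radius larger than \<open>1\<close>, so
  Cauchy's inequality gives exponential decay of the coefficients of \<open>1 / P ^ k\<close> with a rate
  independent of \<open>k\<close>.  Hence a power of \<open>(A - P) / P\<close> has norm less than \<open>1\<close>, and \<open>1 / A\<close> solves
  a defective renewal equation.\<close>

lemma fps_decay_inverse:
  assumes \<beta>: "1 < \<beta>" and A: "fps_decay \<beta> A"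
    and nz: "\<And>z. norm z \<le> 1 \<Longrightarrow> (\<Sum>n. fps_nth A n * z ^ n) \<noteq> 0"
  shows "fps_decay \<beta> (inverse A)"
proof -
  let ?a = "fps_nth A"
  define f where "f z = (\<Sum>n. ?a n * z ^ n)" for z
  from A obtain C where C: "\<And>n. norm (?a n) \<le> C * decay \<beta> n" by (auto simp: fps_decay_def)
  have sm: "summable (\<lambda>n. norm (?a n))"
    by (rule summable_comparison_test'[of "\<lambda>n. C * decay \<beta> n" 0])
      (auto intro: summable_mult summable_decay \<beta> C)
  have bd: "norm (?a n * z ^ n) \<le> norm (?a n)" if "norm z \<le> 1" for n z
    using that by (simp add: norm_mult norm_power mult_left_le power_le_one)
  have ul: "uniform_limit (cball 0 1) (\<lambda>n z. \<Sum>k<n. ?a k * z ^ k) f sequentially"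
    unfolding f_def by (rule Weierstrass_m_test[OF _ sm]) (auto intro: bd)
  have contf: "continuous_on (cball 0 1) f"
    by (rule uniform_limit_theorem[OF _ ul]) (auto intro!: always_eventually continuous_intros)
  obtain z0 where z0: "z0 \<in> cball 0 1" "\<And>z. z \<in> cball 0 1 \<Longrightarrow> norm (f z0) \<le> norm (f z)"
    using continuous_attains_inf[OF _ _ continuous_on_norm[OF contf]] by force
  \<comment> \<open>The minimum of \<open>norm (f z)\<close> on the disc is
    \<open>3 * \<delta>\<close>: truncation uses up \<delta>, enlarging the disc half of \<delta>,
    and what remains still exceeds the norm \<delta> of the remainder by the factor 3/2.\<close>
  define \<delta> where "\<delta> = norm (f z0) / 3"
  have \<delta>: "0 < \<delta>" "\<And>z. norm z \<le> 1 \<Longrightarrow> 3 * \<delta> \<le> norm (f z)"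
    using nz[of z0] z0 by (auto simp: \<delta>_def f_def[symmetric])
  obtain N0 where N0: "\<And>n. n \<ge> N0 \<Longrightarrow> norm (\<Sum>i. norm (?a (i + n))) < \<delta>"
    using suminf_exist_split[OF \<delta>(1) sm] by blast
  \<comment> \<open>As \<open>N\<close> is at least 1, the remainder has no constant term and the
    renewal sum at the end starts at 1.\<close>
  define N where "N = Suc N0"
  have tail: "(\<Sum>i. norm (?a (i + N))) < \<delta>" using N0[of N] by (simp add: N_def)
  define P where "P z = (\<Sum>k<N. ?a k * z ^ k)" for z
  define pf where "pf = (\<Sum>k<N. fps_const (?a k) * fps_X ^ k)"
  have P_exp: "P has_fps_expansion pf"
    unfolding P_def pf_def by (rule has_fps_expansion_poly_sum)
  have pf_nth: "fps_nth pf n = (if n < N then ?a n else 0)" for n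
    unfolding pf_def by (simp add: fps_sum_nth fps_X_power_nth if_distrib cong: if_cong)
  have P_lower: "2 * \<delta> \<le> norm (P z)" if z: "norm z \<le> 1" for z
  proof -
    have s1: "summable (\<lambda>n. ?a n * z ^ n)"
      by (rule summable_comparison_test'[OF sm, of 0]) (use bd z in auto)
    have fz: "f z = (\<Sum>i. ?a (i + N) * z ^ (i + N)) + P z"
      unfolding f_def P_def by (rule suminf_split_initial_segment[OF s1])
    have "norm (\<Sum>i. ?a (i + N) * z ^ (i + N)) \<le> (\<Sum>i. norm (?a (i + N)))"
    proof (rule norm_suminf_le)
      show "summable (\<lambda>i. norm (?a (i + N)))" by (rule summable_ignore_initial_segment[OF sm])
    qed (use bd z in auto)
    moreover have "norm (f z) \<le> norm (\<Sum>i. ?a (i + N) * z ^ (i + N)) + norm (P z)"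
      unfolding fz by (rule norm_triangle_ineq)
    ultimately show ?thesis using \<delta>(2)[OF z] tail by linarith
  qed
  have contP: "continuous_on S P" for S
    unfolding P_def by (intro continuous_intros)
  obtain \<rho> where \<rho>: "1 < \<rho>" "\<And>z. norm z \<le> \<rho> \<Longrightarrow> 3/2 * \<delta> \<le> norm (P z)"
  proof -
    have "uniformly_continuous_on (cball 0 2) P"
      by (rule compact_uniformly_continuous[OF contP]) auto
    then obtain e where e: "0 < e"
      "\<And>z z'. z \<in> cball 0 2 \<Longrightarrow> z' \<in> cball 0 2 \<Longrightarrow> dist z' z < e \<Longrightarrow> dist (P z') (P z) < \<delta> / 2"
      unfolding uniformly_continuous_on_def using \<delta>(1) by (metis half_gt_zero)
    define \<rho> where "\<rho> = 1 + min (e / 2) 1"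
    have "3/2 * \<delta> \<le> norm (P z)" if z: "norm z \<le> \<rho>" for z
    proof (cases "norm z \<le> 1")
      case True then show ?thesis using P_lower[OF True] \<delta>(1) by linarith
    next
      case False
      then have z0: "0 < norm z" by linarith
      define w where "w = z /\<^sub>R norm z"
      have w: "norm w = 1" using z0 by (simp add: w_def)
      have "z - w = (1 - inverse (norm z)) *\<^sub>R z" by (simp add: w_def algebra_simps)
      then have "norm (z - w) = \<bar>1 - inverse (norm z)\<bar> * norm z" by simp
      also have "\<dots> = norm z - 1"
        using False z0 by (subst abs_of_nonneg) (auto simp: field_simps)
      also have "\<dots> < e" using z e by (auto simp: \<rho>_def)
      finally have "dist (P z) (P w) < \<delta> / 2"
        using z w e(1) by (intro e(2)) (auto simp: \<rho>_def dist_norm)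
      moreover have "norm (P w) \<le> norm (P z) + dist (P z) (P w)"
        using norm_triangle_ineq2[of "P w" "P z"] by (simp add: dist_norm norm_minus_commute)
      ultimately show ?thesis using P_lower[of w] w by linarith
    qed
    moreover have "1 < \<rho>" using e by (auto simp: \<rho>_def)
    ultimately show ?thesis using that by blast
  qed
  define \<eta> where "\<eta> = 3/2 * \<delta>"
  have \<eta>: "0 < \<eta>" "\<delta> / \<eta> = 2 / 3" using \<delta> by (auto simp: \<eta>_def)
  have P_nz: "P z \<noteq> 0" if "norm z \<le> \<rho>" for z using \<rho>(2)[OF that] \<delta>(1) by auto
  have pf0: "fps_nth pf 0 \<noteq> 0" 
  proof -
    have "P 0 = fps_nth pf 0" using has_fps_expansion_imp_0_eq_fps_nth_0[OF P_exp] .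
    then show ?thesis using P_nz[of 0] \<rho>(1) by auto
  qed
  have coeff: "norm (fps_nth (inverse pf ^ k) n) \<le> (1 / \<eta>) ^ k * (1 / \<rho>) ^ n" for k n
  proof -
    let ?g = "\<lambda>z. inverse (P z) ^ k"
    have "?g has_fps_expansion inverse pf ^ k"
      using P_exp pf0 by (intro fps_expansion_intros)
    then have nth: "fps_nth (inverse pf ^ k) n = (deriv ^^ n) ?g 0 / fact n"
      by (rule fps_nth_fps_expansion)
    have "norm ((deriv ^^ n) ?g 0) \<le> fact n * ((1 / \<eta>) ^ k) / \<rho> ^ n"
    proof (rule Cauchy_inequality)
      show "?g holomorphic_on ball 0 \<rho>"
        using P_nz unfolding P_def by (intro holomorphic_intros) (auto simp: dist_norm)
      show "continuous_on (cball 0 \<rho>) ?g"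
        using P_nz by (intro continuous_intros contP) auto
      show "0 < \<rho>" using \<rho>(1) by simp
      fix z :: complex assume "norm (0 - z) = \<rho>"
      then have le: "\<eta> \<le> norm (P z)" using \<rho>(2)[of z] by (simp add: \<eta>_def)
      then have "0 < norm (P z) * \<eta>" using \<eta>(1) by (intro mult_pos_pos) linarith+
      then have "1 / norm (P z) \<le> 1 / \<eta>" using \<eta> le by (intro divide_left_mono) auto
      then show "norm (?g z) \<le> (1 / \<eta>) ^ k"
        unfolding norm_power by (intro power_mono) (auto simp: norm_divide inverse_eq_divide)
    qed
    then show ?thesis unfolding nth by (simp add: norm_divide field_simps power_divide)
  qed
  have r: "0 \<le> 1 / \<rho>" "1 / \<rho> < 1" using \<rho>(1) by auto
  obtain Cr where Cr: "0 < Cr" "\<And>n. (1 / \<rho>) ^ n \<le> Cr * decay \<beta> n"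
    using power_le_decay[OF \<beta> r] by blast
  define S where "S = 1 / (1 - 1 / \<rho>)"
  \<comment> \<open>Treating \<open>inverse pf ^ k\<close> as a single function costs the factor
    \<open>S\<close> once; multiplying \<open>k\<close> norms would cost its \<open>k\<close>-th
    power and destroy the contraction.\<close>
  have l1P: "fps_l1 (inverse pf ^ k) ((1 / \<eta>) ^ k * S)" for k
    unfolding fps_l1_def
  proof
    fix n
    have "(\<Sum>i\<le>n. norm (fps_nth (inverse pf ^ k) i)) \<le> (\<Sum>i\<le>n. (1 / \<eta>) ^ k * (1 / \<rho>) ^ i)"
      by (intro sum_mono coeff)
    also have "\<dots> = (1 / \<eta>) ^ k * (\<Sum>i\<le>n. (1 / \<rho>) ^ i)" by (simp add: sum_distrib_left)
    also have "\<dots> \<le> (1 / \<eta>) ^ k * (\<Sum>i. (1 / \<rho>) ^ i)"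
      using r \<eta> by (intro mult_left_mono sum_le_suminf summable_geometric) auto
    also have "(\<Sum>i. (1 / \<rho>) ^ i) = S"
      unfolding S_def using r by (intro suminf_geometric) auto
    finally show "(\<Sum>i\<le>n. norm (fps_nth (inverse pf ^ k) i)) \<le> (1 / \<eta>) ^ k * S" .
  qed
  have decP: "fps_decay \<beta> (inverse pf)"
    unfolding fps_decay_def
  proof (intro exI allI)
    fix n
    have "norm (fps_nth (inverse pf) n) \<le> (1 / \<eta>) * (1 / \<rho>) ^ n" using coeff[of 1 n] by simp
    also have "\<dots> \<le> (1 / \<eta>) * (Cr * decay \<beta> n)" using \<eta> by (intro mult_left_mono Cr) auto
    finally show "norm (fps_nth (inverse pf) n) \<le> (1 / \<eta> * Cr) * decay \<beta> n" by simp
  qed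
  define R where "R = A - pf"
  have R_nth: "fps_nth R n = (if n < N then 0 else ?a n)" for n by (simp add: R_def pf_nth)
  have C0: "0 \<le> C" using order_trans[OF norm_ge_zero C[of 0]] by simp
  have decR: "fps_decay \<beta> R" unfolding fps_decay_def
    using C C0 by (intro exI[of _ C]) (auto simp: R_nth)
  have l1R: "fps_l1 R \<delta>" unfolding fps_l1_def
  proof
    fix n
    have "(\<Sum>k\<le>n. norm (fps_nth R k)) \<le> (\<Sum>k\<in>{N..<N + Suc n}. norm (?a k))"
      by (rule order_trans[OF sum_mono2[of "{..<N + Suc n}"]])
         (auto simp: R_nth sum.If_cases if_distrib[of norm] intro!: sum_mono2)
    also have "\<dots> = (\<Sum>i<Suc n. norm (?a (i + N)))"
      by (rule sum.reindex_bij_witness[of _ "\<lambda>i. i + N" "\<lambda>i. i - N"]) auto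
    also have "\<dots> \<le> (\<Sum>i. norm (?a (i + N)))"
      by (intro sum_le_suminf) (use summable_ignore_initial_segment[OF sm, of N] in auto)
    finally show "(\<Sum>k\<le>n. norm (fps_nth R k)) \<le> \<delta>" using tail by linarith
  qed
  have S1: "0 < S" using r by (simp add: S_def)
  obtain k where k: "(2 / 3 :: real) ^ k < 1 / S"
    using real_arch_pow_inv[of "1 / S" "2/3"] S1 by auto
  have kS: "(2 / 3) ^ Suc k * S < 1"
  proof -
    have "(2 / 3) ^ Suc k * S \<le> (2 / 3 :: real) ^ k * S" using S1 by (intro mult_right_mono) auto
    also have "\<dots> < 1" using k S1 by (simp add: field_simps)
    finally show ?thesis .
  qed
  \<comment> \<open>The inverse of \<open>A\<close> is \<open>inverse pf / (1 + c)\<close>. The norm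
    of \<open>c\<close> itself may exceed 1, so a finite geometric sum is used to replace the factor
    \<open>1 + c\<close> by \<open>1 - d\<close>, where \<open>d\<close> is a high power of
    \<open>- c\<close> and has norm below 1.\<close>
  define c where "c = R * inverse pf"
  define d where "d = (- c) ^ Suc k"
  define B where "B = inverse A"
  define g where "g = inverse pf * (\<Sum>i<Suc k. (- c) ^ i)"
  have A0: "?a 0 \<noteq> 0" using pf0 by (simp add: pf_nth N_def)
  have "pf * inverse pf = 1" "A * B = 1" 
    using pf0 A0 by (auto simp: B_def inverse_mult_eq_1')
  have "(1 + c) * B = (pf * inverse pf + R * inverse pf) * B" 
    using \<open>pf * inverse pf = 1\<close> by (simp add: c_def)
  also have "\<dots> = inverse pf * (A * B)" by (simp add: R_def algebra_simps)
  finally have cB: "(1 + c) * B = inverse pf" using \<open>A * B = 1\<close> by simp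
  have "(1 - d) * B = (1 - (- c)) * (\<Sum>i<Suc k. (- c) ^ i) * B"
    unfolding d_def one_diff_power_eq ..
  also have "\<dots> = ((1 + c) * B) * (\<Sum>i<Suc k. (- c) ^ i)" by simp
  finally have B_eq: "B = g + d * B" unfolding cB g_def by (simp add: algebra_simps)
  have dec_c: "fps_decay \<beta> (- c)"
    unfolding c_def by (intro fps_decay_uminus fps_decay_mult \<beta> decR decP)
  have dec_g: "fps_decay \<beta> g"
    unfolding g_def by (intro fps_decay_mult \<beta> decP fps_decay_sum fps_decay_power dec_c)
  have dec_d: "fps_decay \<beta> d" unfolding d_def by (intro fps_decay_power \<beta> dec_c)
  have d_l1: "fps_l1 d ((2 / 3) ^ Suc k * S)"
  proof -
    have "d = (- 1) ^ Suc k * (R ^ Suc k * inverse pf ^ Suc k)"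
      unfolding d_def c_def by (simp only: power_minus[of "R * inverse pf"] power_mult_distrib)
    then have "norm (fps_nth d n) = norm (fps_nth (R ^ Suc k * inverse pf ^ Suc k) n)" for n
      by (cases "even (Suc k)") (simp_all add: uminus_power_if)
    moreover have "fps_l1 (R ^ Suc k * inverse pf ^ Suc k) (\<delta> ^ Suc k * ((1 / \<eta>) ^ Suc k * S))"
      by (intro fps_l1_mult fps_l1_power l1R l1P)
    moreover have "\<delta> ^ Suc k * ((1 / \<eta>) ^ Suc k * S) = (\<delta> * (1 / \<eta>)) ^ Suc k * S"
      by (simp only: power_mult_distrib mult.assoc)
    moreover have "\<delta> * (1 / \<eta>) = 2 / 3" using \<eta>(2) by simp
    ultimately show ?thesis by (simp only: fps_l1_def simp_thms)
  qed
  have d0: "fps_nth d 0 = 0"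
    by (simp add: d_def c_def R_nth N_def)
  obtain G where G: "\<And>n. norm (fps_nth g n) \<le> G * decay \<beta> n" using dec_g by (auto simp: fps_decay_def)
  obtain D where D: "\<And>n. norm (fps_nth d n) \<le> D * decay \<beta> n" using dec_d by (auto simp: fps_decay_def)
  have "\<exists>C. \<forall>n. norm (fps_nth B n) \<le> C * decay \<beta> n"
  proof (rule defective_renewal_decay[where d="\<lambda>n. norm (fps_nth d n)" and D=D and G=G
      and \<kappa>="(2 / 3) ^ Suc k * S"])
    show "0 \<le> G" using order_trans[OF norm_ge_zero G[of 0]] by simp
    fix n
    have "fps_nth B n = fps_nth g n + fps_nth (d * B) n" by (subst B_eq) simp
    then have "norm (fps_nth B n) \<le> norm (fps_nth g n) + norm (fps_nth (d * B) n)"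
      by (simp add: norm_triangle_ineq)
    also have "norm (fps_nth (d * B) n) \<le> (\<Sum>i\<le>n. norm (fps_nth d i) * norm (fps_nth B (n - i)))"
      by (rule norm_fps_mult_nth_le)
    also have "\<dots> = (\<Sum>i=1..n. norm (fps_nth d i) * norm (fps_nth B (n - i)))"
      by (rule sum.mono_neutral_right) (auto simp: d0 not_le)
    finally show "norm (fps_nth B n) \<le> G * decay \<beta> n + (\<Sum>i=1..n. norm (fps_nth d i) * norm (fps_nth B (n - i)))"
      using G[of n] by linarith
  qed (use \<beta> D d_l1 kS in \<open>auto simp: fps_l1_def simp del: power_Suc\<close>)
  then show ?thesis by (simp add: fps_decay_def B_def)
qed

text \<open>Multiplied by \<open>1 - z\<close>, the series becomes \<open>1 - q(z)\<close>. A zero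
  in the closed disc gives \<open>q(z) = 1\<close>, which is equality in the triangle inequality and
  forces \<open>z ^ k = 1\<close> whenever \<open>0 < q k\<close>. The gcd condition then leaves
  only \<open>z = 1\<close>, where the series has nonnegative terms and first term 1.\<close>

lemma aperiodic_nonvanishing:
  fixes q a :: "nat \<Rightarrow> real"
  assumes q: "\<And>k. 0 \<le> q k" "q 0 = 0" "q sums 1" and gcd: "Gcd {k. 0 < q k} = 1"
    and a: "\<And>n. a n = 1 - (\<Sum>k\<le>n. q k)" "summable a" and z: "norm z \<le> 1"
  shows "(\<Sum>n. complex_of_real (a n) * z ^ n) \<noteq> 0"
proof
  assume eq0: "(\<Sum>n. complex_of_real (a n) * z ^ n) = 0"
  have "(\<Sum>k\<le>n. q k) \<le> 1" for n
    using sum_le_suminf[OF sums_summable[OF q(3)], of "{..n}"] q sums_unique[OF q(3)] by auto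
  then have a0: "0 \<le> a n" for n unfolding a(1) by (simp add: algebra_simps)
  have zn: "norm (z ^ n) \<le> 1" for n using z by (simp add: norm_power power_le_one)
  have bd: "norm (complex_of_real (x n) * z ^ n) \<le> x n" if "0 \<le> x n" for x :: "nat \<Rightarrow> real" and n
    using that zn[of n] by (simp add: norm_mult mult_left_le)
  have sa: "summable (\<lambda>n. complex_of_real (a n) * z ^ n)"
    by (rule summable_comparison_test'[OF a(2), of 0]) (use bd a0 in auto)
  have sq: "summable (\<lambda>n. complex_of_real (q n) * z ^ n)"
    by (rule summable_comparison_test'[OF sums_summable[OF q(3)], of 0]) (use bd q in auto)
  have rec: "a (Suc n) = a n - q (Suc n)" for n unfolding a(1) by simp
  have "(\<lambda>n. complex_of_real (a (Suc n)) * z ^ Suc n) sums (0 - complex_of_real (a 0) * z ^ 0)"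
    using summable_sums[OF sa] unfolding eq0 by (subst sums_Suc_iff) simp
  moreover have "(\<lambda>n. complex_of_real (a n) * z ^ n * z) sums (0 * z)"
    using summable_sums[OF sa] unfolding eq0 by (rule sums_mult2)
  ultimately have "(\<lambda>n. complex_of_real (a (Suc n)) * z ^ Suc n - complex_of_real (a n) * z ^ n * z) sums
      (0 - complex_of_real (a 0) * z ^ 0 - 0 * z)"
    by (rule sums_diff)
  then have "(\<lambda>n. - (complex_of_real (q (Suc n)) * z ^ Suc n)) sums (- complex_of_real (a 0))"
    by (simp add: rec algebra_simps)
  then have "(\<lambda>n. complex_of_real (q (Suc n)) * z ^ Suc n) sums (complex_of_real (a 0))"
    using sums_minus by fastforce
  then have "(\<lambda>n. complex_of_real (q n) * z ^ n) sums 1"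
    by (subst (asm) sums_Suc_iff) (simp add: a(1) q(2))
  then have "(\<lambda>n. Re (complex_of_real (q n) * z ^ n)) sums 1"
    using sums_Re by fastforce
  from sums_diff[OF q(3) this] have s0: "(\<lambda>n. q n * (1 - Re (z ^ n))) sums 0"
    by (simp add: algebra_simps)
  have nn: "0 \<le> q n * (1 - Re (z ^ n))" for n
    using q zn[of n] complex_Re_le_cmod[of "z ^ n"] by (intro mult_nonneg_nonneg) auto
  have "q n * (1 - Re (z ^ n)) = 0" for n
    using suminf_eq_zero_iff[OF sums_summable[OF s0]] nn sums_unique[OF s0] by auto
  then have zq: "z ^ n = 1" if "0 < q n" for n
  proof -
    have "Re (z ^ n) = 1" using that \<open>q n * (1 - Re (z ^ n)) = 0\<close> by auto
    moreover have "(Re (z ^ n))\<^sup>2 + (Im (z ^ n))\<^sup>2 \<le> 1"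
      using zn[of n] by (simp add: cmod_def)
    ultimately show ?thesis by (auto simp: complex_eq_iff)
  qed
  have "\<exists>k. 0 < q k"
  proof (rule ccontr)
    assume "\<nexists>k. 0 < q k"
    then have "{k. 0 < q k} = {}" by blast
    then show False using gcd by (simp only: Gcd_empty)
  qed
  then obtain k where k: "0 < q k" by blast
  then have "0 < k" using q(2) by (auto intro: gr0I)
  \<comment> \<open>The multiplicative order of \<open>z\<close>.\<close>
  define m where "m = (LEAST n. 0 < n \<and> z ^ n = 1)"
  have m: "0 < m" "z ^ m = 1" 
    using LeastI[of "\<lambda>n. 0 < n \<and> z ^ n = 1" k] zq[OF k] \<open>0 < k\<close> by (auto simp: m_def)
  have "m dvd n" if "0 < q n" for n
  proof (rule ccontr)
    assume "\<not> m dvd n"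
    then have pos: "0 < n mod m" by (simp add: mod_greater_zero_iff_not_dvd)
    have "z ^ n = (z ^ m) ^ (n div m) * z ^ (n mod m)"
      by (simp flip: power_mult power_add)
    then have "z ^ (n mod m) = 1" using zq[OF that] m by simp
    then have "m \<le> n mod m" using pos unfolding m_def by (intro Least_le) auto
    moreover have "n mod m < m" using m by simp
    ultimately show False by simp
  qed
  then have "m dvd Gcd {k. 0 < q k}" by (intro Gcd_greatest) auto
  then have "z = 1" using m gcd by simp
  then have "(\<Sum>n. complex_of_real (a n)) = 0" using eq0 by simp
  then have "suminf a = 0" using suminf_of_real[OF a(2), where 'a=complex] by simp
  then have "a 0 = 0" using suminf_eq_zero_iff[OF a(2) a0] by blast
  then show False by (simp add: a(1) q(2))
qed

definition renewal_solution :: "(nat \<Rightarrow> real) \<Rightarrow> (nat \<Rightarrow> real) \<Rightarrow> (nat \<Rightarrow> real) \<Rightarrow> bool" where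
  "renewal_solution q y e \<longleftrightarrow> (\<forall>j. y j = (\<Sum>i=1..j. q i * y (j - i)) + e j)"

text \<open>The series \<open>1 - Qf\<close> vanishes at 1 and cannot be inverted in the weighted
  algebra, but it equals \<open>(1 - fps_X) * Af\<close> with \<open>Af\<close> the invertible
  series of tails. Cancelling \<open>Af\<close> leaves
  \<open>(1 - fps_X) * Yf = inverse Af * Ef\<close>: the increments are a convolution of two
  sequences that decay at rate \<beta>.\<close>

lemma renewal_increments:
  fixes q :: "nat \<Rightarrow> real"
  assumes \<beta>: "1 < \<beta>" and q: "\<And>k. 0 \<le> q k" "q 0 = 0" "q sums 1"
    and tail: "\<And>n. 1 - (\<Sum>k\<le>n. q k) \<le> A * decay \<beta> n" and gcd: "Gcd {k. 0 < q k} = 1"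
  shows "\<exists>C>0. \<forall>(y :: nat \<Rightarrow> real) e E.
      renewal_solution q y e \<longrightarrow> (\<forall>j. \<bar>e j\<bar> \<le> E * decay \<beta> j) \<longrightarrow>
      (\<forall>j. \<bar>y (Suc j) - y j\<bar> \<le> C * E * decay \<beta> j)"
proof -
  define a where "a n = 1 - (\<Sum>k\<le>n. q k)" for n
  have "(\<Sum>k\<le>n. q k) \<le> 1" for n
    using sum_le_suminf[OF sums_summable[OF q(3)], of "{..n}"] q sums_unique[OF q(3)] by auto
  then have a0: "0 \<le> a n" for n unfolding a_def by (simp add: algebra_simps)
  have sa: "summable a"
    by (rule summable_comparison_test'[of "\<lambda>n. A * decay \<beta> n" 0])
      (use tail a0 in \<open>auto intro: summable_mult summable_decay \<beta> simp: a_def\<close>)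
  define Af where "Af = Abs_fps (\<lambda>n. complex_of_real (a n))"
  have "fps_decay \<beta> Af"
    unfolding fps_decay_def Af_def using tail a0 by (intro exI[of _ A]) (auto simp flip: a_def)
  moreover have "(\<Sum>n. fps_nth Af n * z ^ n) \<noteq> 0" if "norm z \<le> 1" for z
    using aperiodic_nonvanishing[OF q gcd _ sa that] by (simp add: Af_def a_def)
  ultimately have "fps_decay \<beta> (inverse Af)" by (intro fps_decay_inverse \<beta>) auto
  then obtain B where B: "\<And>n. norm (fps_nth (inverse Af) n) \<le> B * decay \<beta> n" by (auto simp: fps_decay_def)
  obtain c where c: "fps_l1 (inverse Af) c" using fps_decay_imp_l1[OF \<beta> \<open>fps_decay \<beta> (inverse Af)\<close>] .
  define S where "S = suminf (decay \<beta>)"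
  have S0: "0 \<le> S" unfolding S_def by (intro suminf_nonneg summable_decay \<beta>) auto
  have B0: "0 \<le> B" using order_trans[OF norm_ge_zero B[of 0]] by simp
  have c0: "0 \<le> c" using c[unfolded fps_l1_def, rule_format, of 0] order_trans[OF norm_ge_zero] by fastforce
  define C where "C = 2 powr \<beta> * (B * S + c) + 1"
  have "0 < C" using B0 S0 c0 by (simp add: C_def add_nonneg_pos)
  have main: "\<bar>y (Suc j) - y j\<bar> \<le> C * E * decay \<beta> j"
    if y: "renewal_solution q y e" and e: "\<forall>j. \<bar>e j\<bar> \<le> E * decay \<beta> j"
    for y e :: "nat \<Rightarrow> real" and E j
  proof -
    have E0: "0 \<le> E" using order_trans[OF abs_ge_zero e[rule_format, of 0]] by simp
    define Yf where "Yf = Abs_fps (\<lambda>n. complex_of_real (y n))"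
    define Ef where "Ef = Abs_fps (\<lambda>n. complex_of_real (e n))"
    define Qf where "Qf = Abs_fps (\<lambda>n. complex_of_real (q n))"
    have Y: "Yf = Qf * Yf + Ef"
    proof (rule fps_ext)
      fix n
      have "(\<Sum>i=0..n. q i * y (n - i)) = (\<Sum>i=1..n. q i * y (n - i))"
        by (rule sum.mono_neutral_right) (auto simp: q(2) not_le)
      then have "(\<Sum>i=0..n. q i * y (n - i)) + e n = y n" using y[unfolded renewal_solution_def, rule_format, of n] by simp
      then show "fps_nth Yf n = fps_nth (Qf * Yf + Ef) n"
        by (simp add: fps_mult_nth Yf_def Ef_def Qf_def flip: of_real_mult of_real_sum of_real_add)
    qed
    have AQ: "(1 - fps_X) * Af = 1 - Qf"
    proof (rule fps_ext)
      fix n show "fps_nth ((1 - fps_X) * Af) n = fps_nth (1 - Qf) n"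
        by (cases n) (simp_all add: Af_def Qf_def a_def q(2) algebra_simps)
    qed
    have "Af * inverse Af = 1" by (rule inverse_mult_eq_1') (simp add: Af_def a_def q(2))
    have "(1 - fps_X) * Yf = (1 - fps_X) * (Af * inverse Af) * Yf" using \<open>Af * inverse Af = 1\<close> by simp
    also have "\<dots> = inverse Af * ((1 - fps_X) * Af * Yf)" by (simp only: mult_ac)
    also have "(1 - fps_X) * Af * Yf = Ef" unfolding AQ using Y by (simp add: algebra_simps)
    finally have X: "(1 - fps_X) * Yf = inverse Af * Ef" .
    have "fps_nth ((1 - fps_X) * Yf) (Suc j) = complex_of_real (y (Suc j) - y j)"
      by (simp add: algebra_simps Yf_def)
    then have "\<bar>y (Suc j) - y j\<bar> = norm (fps_nth (inverse Af * Ef) (Suc j))"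
      unfolding X by (metis norm_of_real real_norm_def)
    also have "\<dots> \<le> (\<Sum>i\<le>Suc j. norm (fps_nth (inverse Af) i) * norm (fps_nth Ef (Suc j - i)))"
      by (rule norm_fps_mult_nth_le)
    also have "\<dots> \<le> 2 powr \<beta> * (B * (E * S) + c * E) * decay \<beta> (Suc j)"
    proof (rule conv_decay)
      fix n
      have "(\<Sum>k\<le>n. norm (fps_nth Ef k)) \<le> (\<Sum>k\<le>n. E * decay \<beta> k)"
        by (intro sum_mono) (use e in \<open>auto simp: Ef_def\<close>)
      also have "\<dots> = E * (\<Sum>k\<le>n. decay \<beta> k)" by (simp add: sum_distrib_left)
      also have "\<dots> \<le> E * S" unfolding S_def by (intro mult_left_mono sum_decay_le \<beta> E0) auto
      finally show "(\<Sum>k\<le>n. norm (fps_nth Ef k)) \<le> E * S" .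
    qed (use B c e \<beta> in \<open>auto simp: fps_l1_def Ef_def\<close>)
    also have "\<dots> \<le> 2 powr \<beta> * (B * (E * S) + c * E) * decay \<beta> j"
      using \<beta> B0 S0 c0 E0 by (intro mult_left_mono decay_antimono) auto
    also have "\<dots> \<le> C * E * decay \<beta> j"
      using E0 by (intro mult_right_mono) (auto simp: C_def algebra_simps)
    finally show ?thesis .
  qed
  show ?thesis
  proof (intro exI[of _ C] conjI allI impI)
    fix y e :: "nat \<Rightarrow> real" and E :: real and j :: nat
    assume "renewal_solution q y e" "\<forall>j. \<bar>e j\<bar> \<le> E * decay \<beta> j"
    then show "\<bar>y (Suc j) - y j\<bar> \<le> C * E * decay \<beta> j" by (rule main)
  qed fact
qed

text \<open>Telescoping the increments loses one power. Two values of the solution are compared, so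
  its limit need not be identified.\<close>

lemma renewal_convergence:
  fixes q :: "nat \<Rightarrow> real"
  assumes \<beta>: "1 < \<beta>" and q: "\<And>k. 0 \<le> q k" "q 0 = 0" "q sums 1"
    and tail: "\<And>n. 1 - (\<Sum>k\<le>n. q k) \<le> A * decay \<beta> n" and gcd: "Gcd {k. 0 < q k} = 1"
  shows "\<exists>C>0. \<forall>(y :: nat \<Rightarrow> real) e E.
      renewal_solution q y e \<longrightarrow> (\<forall>j. \<bar>e j\<bar> \<le> E * decay \<beta> j) \<longrightarrow>
      (\<forall>i j. i \<le> j \<longrightarrow> \<bar>y j - y i\<bar> \<le> C * E * decay (\<beta> - 1) i)"
proof -
  have "\<exists>C>0. \<forall>(y :: nat \<Rightarrow> real) e E. renewal_solution q y e \<longrightarrow> (\<forall>j. \<bar>e j\<bar> \<le> E * decay \<beta> j) \<longrightarrow>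
      (\<forall>j. \<bar>y (Suc j) - y j\<bar> \<le> C * E * decay \<beta> j)"
    by (rule renewal_increments) fact+
  then obtain C where C: "0 < C" "\<forall>(y :: nat \<Rightarrow> real) e E. renewal_solution q y e \<longrightarrow>
      (\<forall>j. \<bar>e j\<bar> \<le> E * decay \<beta> j) \<longrightarrow> (\<forall>j. \<bar>y (Suc j) - y j\<bar> \<le> C * E * decay \<beta> j)"
    by blast
  obtain D where D: "0 < D" "\<And>N L. (\<Sum>n\<in>{N..<L}. decay \<beta> n) \<le> D * decay (\<beta> - 1) N"
    using sum_decay_tail[OF \<beta>] by blast
  have main: "\<bar>y j - y i\<bar> \<le> (C * D) * E * decay (\<beta> - 1) i"
    if y: "renewal_solution q y e" and e: "\<forall>j. \<bar>e j\<bar> \<le> E * decay \<beta> j" and "i \<le> j"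
    for y e :: "nat \<Rightarrow> real" and E i j
  proof -
    have E0: "0 \<le> E" using order_trans[OF abs_ge_zero e[rule_format, of 0]] by simp
    have "y j - y i = (\<Sum>k\<in>{i..<j}. y (Suc k) - y k)" using \<open>i \<le> j\<close> by (simp add: sum_Suc_diff')
    also have "\<bar>\<dots>\<bar> \<le> (\<Sum>k\<in>{i..<j}. C * E * decay \<beta> k)"
      by (rule order_trans[OF sum_abs]) (intro sum_mono C(2)[rule_format, OF y e[rule_format]])
    also have "\<dots> = C * E * (\<Sum>k\<in>{i..<j}. decay \<beta> k)" by (simp add: sum_distrib_left)
    also have "\<dots> \<le> C * E * (D * decay (\<beta> - 1) i)" using C E0 by (intro mult_left_mono D) auto
    finally show ?thesis by (simp add: mult_ac)
  qed
  have "0 < C * D" using C(1) D(1) by simp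
  show ?thesis
  proof (intro exI[of _ "C * D"] conjI allI impI)
    fix y e :: "nat \<Rightarrow> real" and E :: real and i j :: nat
    assume "renewal_solution q y e" "\<forall>j. \<bar>e j\<bar> \<le> E * decay \<beta> j" "i \<le> j"
    then show "\<bar>y j - y i\<bar> \<le> (C * D) * E * decay (\<beta> - 1) i" by (rule main)
  qed fact
qed

section \<open>Separation times and the quotient tower\<close>

lemma epow_shift_enat: "epow_shift \<theta> (enat m) 0 = \<theta> ^ m"
  by (simp add: epow_shift_def power_int_def)

lemma epow_nonneg: "0 \<le> \<theta> \<Longrightarrow> 0 \<le> epow \<theta> s"
  by (cases s) (auto simp: epow_shift_enat, simp add: epow_shift_def)

lemma epow_eSuc: "epow \<theta> (eSuc s) = \<theta> * epow \<theta> s"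
  by (cases s) (auto simp: epow_shift_enat eSuc_enat, simp add: epow_shift_def)

lemma epow_antimono:
  assumes "0 \<le> \<theta>" "\<theta> \<le> 1" "s \<le> t" shows "epow \<theta> t \<le> epow \<theta> s"
proof (cases t)
  case (enat n)
  then obtain m where "s = enat m" "m \<le> n" using assms(3) by (cases s) auto
  then show ?thesis using assms enat by (simp add: epow_shift_enat power_decreasing)
next
  case infinity
  then show ?thesis using epow_nonneg[OF assms(1), of s] by (simp add: epow_shift_def[of _ \<infinity>])
qed

lemma epow_le_1: "0 \<le> \<theta> \<Longrightarrow> \<theta> \<le> 1 \<Longrightarrow> epow \<theta> s \<le> 1"
  using epow_antimono[of \<theta> 0 s] epow_shift_enat[of \<theta> 0] by (simp add: enat_0)

lemma measurable_into_countable: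
  assumes "countable A" "f \<in> space M \<rightarrow> A" "\<And>a. a \<in> A \<Longrightarrow> f -` {a} \<inter> space M \<in> sets M"
  shows "f \<in> M \<rightarrow>\<^sub>M count_space A"
proof (rule measurableI)
  fix X assume "X \<in> sets (count_space A)"
  then have X: "X \<subseteq> A" by simp
  have "f -` X \<inter> space M = (\<Union>a\<in>X. f -` {a} \<inter> space M)" by auto
  also have "\<dots> \<in> sets M" using X assms(3) countable_subset[OF X assms(1)] by (intro sets.countable_UN') auto
  finally show "f -` X \<inter> space M \<in> sets M" .
qed (use assms(2) in auto)

text \<open>The one-sided system, with a return time defined at every point. The tail is that of
  \<open>n + 1 \<le> \<phi>\<close>, in agreement with the shift by one in \<open>decay\<close>,
  which keeps the weight positive at 0.\<close>

locale Gibbs_Markov_tower = full_branch_Gibbs_Markov M F \<alpha> K \<theta>\<^sub>0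
  for M :: "'b measure" and F :: "'b \<Rightarrow> 'b" and \<alpha> :: "'b set set" and K \<theta>\<^sub>0 :: real +
  fixes \<phi> :: "'b \<Rightarrow> nat" and \<beta> A :: real
  assumes \<phi>_pos: "\<And>z. z \<in> space M \<Longrightarrow> 0 < \<phi> z"
    and \<phi>_cell: "\<And>a z z'. a \<in> \<alpha> \<Longrightarrow> z \<in> a \<Longrightarrow> z' \<in> a \<Longrightarrow> \<phi> z = \<phi> z'"
    and \<beta>: "1 < \<beta>"
    and tail: "\<And>n. prob {z \<in> space M. n < \<phi> z} \<le> A * decay \<beta> n"
begin

definition cell :: "'b \<Rightarrow> 'b set" where "cell z = (THE a. a \<in> \<alpha> \<and> z \<in> a)"

definition prox :: "'b \<Rightarrow> 'b \<Rightarrow> real" where "prox z z' = epow \<theta>\<^sub>0 (separation_time F \<alpha> z z')"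

lemma cell_eq: "a \<in> \<alpha> \<Longrightarrow> z \<in> a \<Longrightarrow> cell z = a"
  unfolding cell_def using partition(1) by (intro the_equality) (auto simp: partition_on_def disjoint_def)

lemma cell_mem:
  assumes "z \<in> space M" shows "cell z \<in> \<alpha>" "z \<in> cell z"
proof -
  obtain a where "a \<in> \<alpha>" "z \<in> a" using assms partition(1) by (auto simp: partition_on_def)
  then show "cell z \<in> \<alpha>" "z \<in> cell z" using cell_eq by auto
qed

lemma \<alpha>_subset: "a \<in> \<alpha> \<Longrightarrow> a \<subseteq> space M"
  using partition(3) sets.sets_into_space by auto

lemma F_space: "z \<in> space M \<Longrightarrow> F z \<in> space M"
  using T_measurable by (rule measurable_space)

lemma Fn_space: "z \<in> space M \<Longrightarrow> (F ^^ n) z \<in> space M"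
  by (induction n) (auto intro: F_space)

lemma measurable_cell [measurable]: "cell \<in> M \<rightarrow>\<^sub>M count_space \<alpha>"
proof (rule measurable_into_countable[OF partition(2)])
  show "cell \<in> space M \<rightarrow> \<alpha>" using cell_mem by auto
  fix a assume a: "a \<in> \<alpha>"
  then have "cell -` {a} \<inter> space M = a" using cell_eq[OF a] cell_mem \<alpha>_subset[OF a] by auto
  then show "cell -` {a} \<inter> space M \<in> sets M" using a partition(3) by auto
qed

lemma \<phi>_eq_cell: "z \<in> space M \<Longrightarrow> \<phi> z = \<phi> (SOME x. x \<in> cell z)"
  using cell_mem by (intro \<phi>_cell[of "cell z"] someI[of "\<lambda>x. x \<in> cell z"]) auto

lemma measurable_\<phi> [measurable]: "\<phi> \<in> M \<rightarrow>\<^sub>M count_space UNIV"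
proof (subst measurable_cong[OF \<phi>_eq_cell])
  show "(\<lambda>z. \<phi> (SOME x. x \<in> cell z)) \<in> M \<rightarrow>\<^sub>M count_space UNIV"
    by (rule measurable_compose[OF measurable_cell]) auto
qed

lemma F_measurable [measurable]: "F \<in> M \<rightarrow>\<^sub>M M"
  by (rule T_measurable)

lemma separation_ge:
  assumes "z \<in> space M" "z' \<in> space M" "\<And>i. i < j \<Longrightarrow> cell ((F ^^ i) z) = cell ((F ^^ i) z')"
  shows "enat j \<le> separation_time F \<alpha> z z'"
  unfolding separation_time_def
proof (rule INF_greatest)
  fix n assume "n \<in> {n. \<exists>a\<in>\<alpha>. \<exists>b\<in>\<alpha>. a \<noteq> b \<and> (F ^^ n) z \<in> a \<and> (F ^^ n) z' \<in> b}"
  then have "cell ((F ^^ n) z) \<noteq> cell ((F ^^ n) z')" using cell_eq by auto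
  then show "enat j \<le> enat n" using assms(3)[of n] by (auto simp: not_less[symmetric])
qed

lemma prox_bounds: "0 \<le> prox z z'" "prox z z' \<le> 1"
  unfolding prox_def using \<theta>\<^sub>0 by (auto intro: epow_nonneg epow_le_1)

text \<open>Pulling two points back into a common cell postpones their separation by one step. This
  is the source of all contraction of densities.\<close>

lemma prox_inverse_branch:
  assumes a: "a \<in> \<alpha>" and u: "u \<in> space M" "v \<in> space M"
  shows "prox (the_inv_into a F u) (the_inv_into a F v) \<le> \<theta>\<^sub>0 * prox u v"
proof -
  let ?\<psi> = "the_inv_into a F"
  have F\<psi>: "F (?\<psi> x) = x" "?\<psi> x \<in> a" if "x \<in> space M" for x
    using full_branch[OF a] that
    by (auto simp: bij_betw_def f_the_inv_into_f the_inv_into_into)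
  have "eSuc (separation_time F \<alpha> u v) \<le> separation_time F \<alpha> (?\<psi> u) (?\<psi> v)"
    unfolding separation_time_def[of F \<alpha> "?\<psi> u"]
  proof (rule INF_greatest)
    fix n assume n: "n \<in> {n. \<exists>b\<in>\<alpha>. \<exists>c\<in>\<alpha>. b \<noteq> c \<and> (F ^^ n) (?\<psi> u) \<in> b \<and> (F ^^ n) (?\<psi> v) \<in> c}"
    have "n \<noteq> 0"
    proof
      assume "n = 0"
      then show False using n cell_eq[OF a F\<psi>(2)[OF u(1)]] cell_eq[OF a F\<psi>(2)[OF u(2)]] cell_eq by force
    qed
    then obtain m where m: "n = Suc m" by (cases n) auto
    have "separation_time F \<alpha> u v \<le> enat m"
      unfolding separation_time_def
      by (rule INF_lower) (use n u in \<open>simp add: m funpow_Suc_right F\<psi> del: funpow.simps\<close>)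
    then show "eSuc (separation_time F \<alpha> u v) \<le> enat n" by (simp add: m eSuc_enat[symmetric])
  qed
  then show ?thesis
    unfolding prox_def epow_eSuc[symmetric] using \<theta>\<^sub>0 by (intro epow_antimono) auto
qed

subsection \<open>Regular densities\<close>

text \<open>Nonnegative functions whose logarithm is \<open>R\<close>-Lipschitz for the symbolic
  distance \<open>prox\<close>. In multiplicative form the zero function is included and the set is
  closed under sums and nonnegative multiples.\<close>

definition cone :: "real \<Rightarrow> ('b \<Rightarrow> real) set" where
  "cone R = {\<rho> \<in> borel_measurable M. (\<forall>z\<in>space M. 0 \<le> \<rho> z) \<and>
     (\<forall>z\<in>space M. \<forall>z'\<in>space M. \<rho> z \<le> exp (R * prox z z') * \<rho> z')}"

lemma coneD:
  assumes "\<rho> \<in> cone R"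
  shows "\<rho> \<in> borel_measurable M" "\<And>z. z \<in> space M \<Longrightarrow> 0 \<le> \<rho> z"
    "\<And>z z'. z \<in> space M \<Longrightarrow> z' \<in> space M \<Longrightarrow> \<rho> z \<le> exp (R * prox z z') * \<rho> z'"
  using assms by (auto simp: cone_def)

lemma cone_mono:
  assumes "R \<le> R'" shows "cone R \<subseteq> cone R'"
proof
  fix \<rho> assume \<rho>: "\<rho> \<in> cone R"
  have "\<rho> z \<le> exp (R' * prox z z') * \<rho> z'" if "z \<in> space M" "z' \<in> space M" for z z'
  proof -
    have "\<rho> z \<le> exp (R * prox z z') * \<rho> z'" using coneD(3)[OF \<rho>] that by auto
    also have "\<dots> \<le> exp (R' * prox z z') * \<rho> z'"
      using assms prox_bounds coneD(2)[OF \<rho>] that by (intro mult_right_mono) (auto intro: mult_right_mono)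
    finally show ?thesis .
  qed
  then show "\<rho> \<in> cone R'" using coneD[OF \<rho>] by (auto simp: cone_def)
qed

lemma cone_const: "0 \<le> R \<Longrightarrow> 0 \<le> x \<Longrightarrow> (\<lambda>_. x) \<in> cone R"
  using prox_bounds by (auto simp: cone_def intro!: mult_le_cancel_right1[THEN iffD2])

lemma cone_scale: "\<rho> \<in> cone R \<Longrightarrow> 0 \<le> x \<Longrightarrow> (\<lambda>z. x * \<rho> z) \<in> cone R"
  by (auto simp: cone_def mult.left_commute intro!: mult_left_mono)

lemma cone_integrable_mult:
  assumes \<rho>: "\<rho> \<in> cone R" and g: "g \<in> borel_measurable M" "\<And>z. z \<in> space M \<Longrightarrow> \<bar>g z\<bar> \<le> B"
  shows "integrable M (\<lambda>z. g z * \<rho> z)"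
proof -
  obtain z0 where z0: "z0 \<in> space M" using not_empty by auto
  have B: "0 \<le> B" using g(2)[OF z0] by linarith
  show ?thesis
  proof (rule integrable_const_bound[where B="B * (exp \<bar>R\<bar> * \<rho> z0)"])
    have [measurable]: "\<rho> \<in> borel_measurable M" "g \<in> borel_measurable M" using coneD[OF \<rho>] g by auto
    show "(\<lambda>z. g z * \<rho> z) \<in> borel_measurable M" by measurable
    show "AE z in M. norm (g z * \<rho> z) \<le> B * (exp \<bar>R\<bar> * \<rho> z0)"
    proof (rule AE_I2)
      fix z assume z: "z \<in> space M"
      have "\<rho> z \<le> exp (R * prox z z0) * \<rho> z0" by (rule coneD(3)[OF \<rho> z z0])
      also have "\<dots> \<le> exp \<bar>R\<bar> * \<rho> z0"
      proof (rule mult_right_mono)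
        have "R * prox z z0 \<le> \<bar>R\<bar> * 1" using prox_bounds[of z z0] by (intro mult_mono) auto
        then show "exp (R * prox z z0) \<le> exp \<bar>R\<bar>" by simp
      qed (use coneD(2)[OF \<rho> z0] in auto)
      finally show "norm (g z * \<rho> z) \<le> B * (exp \<bar>R\<bar> * \<rho> z0)"
        unfolding real_norm_def abs_mult using g(2)[OF z] coneD(2)[OF \<rho> z] B by (intro mult_mono) auto
    qed
  qed
qed

lemma cone_integrable: "\<rho> \<in> cone R \<Longrightarrow> integrable M \<rho>"
  using cone_integrable_mult[of \<rho> R "\<lambda>_. 1" 1] by simp

lemma cone_integral_nonneg: "\<rho> \<in> cone R \<Longrightarrow> 0 \<le> integral\<^sup>L M \<rho>"
  by (intro integral_nonneg_AE AE_I2) (auto dest: coneD)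

text \<open>Since \<open>prox\<close> is at most 1, values at two points differ by a factor of at
  most \<open>exp R\<close>; averaging over one of the points compares each value with the
  integral.\<close>

lemma cone_le_integral:
  assumes \<rho>: "\<rho> \<in> cone R" and R: "0 \<le> R" and z: "z \<in> space M"
  shows "\<rho> z \<le> exp R * integral\<^sup>L M \<rho>" "exp (- R) * integral\<^sup>L M \<rho> \<le> \<rho> z"
proof -
  have le: "\<rho> u \<le> exp R * \<rho> v" if "u \<in> space M" "v \<in> space M" for u v
  proof -
    have "\<rho> u \<le> exp (R * prox u v) * \<rho> v" by (rule coneD(3)[OF \<rho> that])
    also have "\<dots> \<le> exp R * \<rho> v"
      using R prox_bounds[of u v] coneD(2)[OF \<rho> that(2)] by (intro mult_right_mono) (auto simp: mult_left_le)
    finally show ?thesis .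
  qed
  have "(\<integral>u. \<rho> z \<partial>M) \<le> (\<integral>u. exp R * \<rho> u \<partial>M)"
    using le z cone_integrable[OF \<rho>] by (intro integral_mono) auto
  then show "\<rho> z \<le> exp R * integral\<^sup>L M \<rho>" by (simp add: prob_space)
  have "(\<integral>u. \<rho> u \<partial>M) \<le> (\<integral>u. exp R * \<rho> z \<partial>M)"
    using le z cone_integrable[OF \<rho>] by (intro integral_mono) auto
  then have "integral\<^sup>L M \<rho> \<le> exp R * \<rho> z" by (simp add: prob_space)
  then have "exp (- R) * integral\<^sup>L M \<rho> \<le> exp (- R) * (exp R * \<rho> z)" by (intro mult_left_mono) auto
  then show "exp (- R) * integral\<^sup>L M \<rho> \<le> \<rho> z" by (simp add: exp_minus field_simps)
qed

text \<open>One branch of the transfer operator. Along the inverse branch the logarithm of the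
  weight has Lipschitz constant \<open>K\<close> and that of the density \<open>R\<close>, while
  distances shrink by \<open>\<theta>\<^sub>0\<close>: this is a Lasota-Yorke inequality for
  logarithms. The new density is described by duality with test functions.\<close>

lemma branch_transfer:
  assumes a: "a \<in> \<alpha>" and \<rho>: "\<rho> \<in> cone R" and R: "0 \<le> R"
  shows "\<exists>\<rho>'\<in>cone (\<theta>\<^sub>0 * (K + R)). \<forall>g\<in>borel_measurable M.
    (\<integral>z. indicator a z * (g (F z) * \<rho> z) \<partial>M) = (\<integral>z. g z * \<rho>' z \<partial>M)"
proof -
  let ?\<psi> = "the_inv_into a F" and ?N = "restrict_space M a"
  have F\<psi>: "F (?\<psi> x) = x" "?\<psi> x \<in> a" if "x \<in> space M" for x
    using full_branch[OF a] that
    by (auto simp: bij_betw_def f_the_inv_into_f the_inv_into_into)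
  have [measurable]: "?\<psi> \<in> M \<rightarrow>\<^sub>M ?N" by (rule inverse_branch_measurable[OF a])
  have [measurable]: "a \<in> sets M" using a partition(3) by auto
  have [measurable]: "\<rho> \<in> borel_measurable M" by (rule coneD[OF \<rho>])
  have restr: "f \<in> borel_measurable ?N" if "f \<in> borel_measurable M" for f :: "'b \<Rightarrow> real"
    using that by (rule measurable_restrict_space1)
  have [measurable]: "\<rho> \<in> borel_measurable ?N" by (rule restr) fact
  have sp: "space ?N = a" using \<alpha>_subset[OF a] by (auto simp: space_restrict_space)
  obtain \<zeta> :: "'b \<Rightarrow> real" where \<zeta>[measurable]: "\<zeta> \<in> borel_measurable ?N" and \<zeta>_pos: "\<And>y. y \<in> a \<Longrightarrow> 0 < \<zeta> y"
    and dens: "?N = density (distr M ?N ?\<psi>) (\<lambda>y. ennreal (\<zeta> y))"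
    and dist: "\<And>y y'. y \<in> a \<Longrightarrow> y' \<in> a \<Longrightarrow> \<bar>ln (\<zeta> y) - ln (\<zeta> y')\<bar> \<le> K * prox y y'"
    using distortion[OF a] unfolding prox_def by blast
  \<comment> \<open>The function \<zeta> is the density of the restricted measure with respect to
    the image of \<open>M\<close> under the inverse branch, hence the weight of the transfer
    operator itself and not its reciprocal.\<close>
  define \<rho>' where "\<rho>' u = \<zeta> (?\<psi> u) * \<rho> (?\<psi> u)" for u
  have \<rho>'m: "\<rho>' \<in> borel_measurable M" unfolding \<rho>'_def by measurable
  have "\<rho>' u \<le> exp (\<theta>\<^sub>0 * (K + R) * prox u v) * \<rho>' v" if uv: "u \<in> space M" "v \<in> space M" for u v
  proof -
    have in_a: "?\<psi> u \<in> a" "?\<psi> v \<in> a" using F\<psi> uv by auto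
    then have in_M: "?\<psi> u \<in> space M" "?\<psi> v \<in> space M" using \<alpha>_subset[OF a] by auto
    let ?p = "prox (?\<psi> u) (?\<psi> v)"
    have p: "?p \<le> \<theta>\<^sub>0 * prox u v" by (rule prox_inverse_branch[OF a uv])
    have "ln (\<zeta> (?\<psi> u)) \<le> K * ?p + ln (\<zeta> (?\<psi> v))" using dist[OF in_a] by linarith
    then have "exp (ln (\<zeta> (?\<psi> u))) \<le> exp (K * ?p + ln (\<zeta> (?\<psi> v)))" by simp
    then have "\<zeta> (?\<psi> u) \<le> exp (K * ?p) * \<zeta> (?\<psi> v)" using \<zeta>_pos in_a by (simp add: exp_add)
    moreover have "\<rho> (?\<psi> u) \<le> exp (R * ?p) * \<rho> (?\<psi> v)" by (rule coneD(3)[OF \<rho> in_M])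
    ultimately have "\<rho>' u \<le> (exp (K * ?p) * \<zeta> (?\<psi> v)) * (exp (R * ?p) * \<rho> (?\<psi> v))"
      unfolding \<rho>'_def using coneD(2)[OF \<rho>] in_M \<zeta>_pos in_a by (intro mult_mono) (auto intro: less_imp_le)
    also have "\<dots> = exp ((K + R) * ?p) * \<rho>' v"
      by (simp add: \<rho>'_def exp_add algebra_simps)
    also have "\<dots> \<le> exp ((K + R) * (\<theta>\<^sub>0 * prox u v)) * \<rho>' v"
    proof (rule mult_right_mono)
      show "exp ((K + R) * ?p) \<le> exp ((K + R) * (\<theta>\<^sub>0 * prox u v))"
        using p K_pos R by (simp add: mult_left_mono)
      show "0 \<le> \<rho>' v" unfolding \<rho>'_def
        using coneD(2)[OF \<rho>] in_M \<zeta>_pos in_a by (intro mult_nonneg_nonneg) (auto intro: less_imp_le)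
    qed
    finally show ?thesis by (simp add: mult_ac)
  qed
  moreover have "0 \<le> \<rho>' u" if "u \<in> space M" for u
  proof -
    have "?\<psi> u \<in> a" "?\<psi> u \<in> space M" using F\<psi>(2)[OF that] \<alpha>_subset[OF a] by auto
    then show ?thesis unfolding \<rho>'_def
      using coneD(2)[OF \<rho>] \<zeta>_pos by (intro mult_nonneg_nonneg) (auto intro: less_imp_le)
  qed
  ultimately have "\<rho>' \<in> cone (\<theta>\<^sub>0 * (K + R))" using \<rho>'m by (auto simp: cone_def)
  moreover have "(\<integral>z. indicator a z * (g (F z) * \<rho> z) \<partial>M) = (\<integral>z. g z * \<rho>' z \<partial>M)"
    if [measurable]: "g \<in> borel_measurable M" for g
  proof -
    define f where "f z = g (F z) * \<rho> z" for z
    have [measurable]: "f \<in> borel_measurable M" unfolding f_def by measurable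
    have [measurable]: "f \<in> borel_measurable ?N" by (rule restr) fact
    have "(\<integral>z. indicator a z * (g (F z) * \<rho> z) \<partial>M) = integral\<^sup>L ?N f"
      by (subst integral_restrict_space) (auto simp: f_def)
    also have "\<dots> = integral\<^sup>L (density (distr M ?N ?\<psi>) (\<lambda>y. ennreal (\<zeta> y))) f"
      by (rule arg_cong[OF dens, of "\<lambda>X. integral\<^sup>L X f"])
    also have "\<dots> = (\<integral>z. \<zeta> z *\<^sub>R f z \<partial>distr M ?N ?\<psi>)"
      using \<zeta>_pos by (intro integral_density) (auto intro!: AE_I2 less_imp_le simp: sp)
    also have "\<dots> = (\<integral>u. \<zeta> (?\<psi> u) *\<^sub>R f (?\<psi> u) \<partial>M)"
      by (rule integral_distr) auto
    also have "\<dots> = (\<integral>z. g z * \<rho>' z \<partial>M)"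
      by (rule Bochner_Integration.integral_cong) (auto simp: f_def \<rho>'_def F\<psi>)
    finally show ?thesis .
  qed
  ultimately show ?thesis by blast
qed

text \<open>The branches are summed over all cells with return time \<open>k\<close>. The cone
  inequality passes to countable sums; these converge at every point because each term is bounded by
  its integral and the integrals are summable. The test functions are bounded so that sum and
  integral may be exchanged.\<close>

lemma level_transfer:
  assumes \<rho>: "\<rho> \<in> cone R" and R: "0 \<le> R"
  shows "\<exists>\<rho>'\<in>cone (\<theta>\<^sub>0 * (K + R)). \<forall>g B. g \<in> borel_measurable M \<longrightarrow> (\<forall>z\<in>space M. \<bar>g z\<bar> \<le> B) \<longrightarrow>
    (\<integral>z. of_bool (\<phi> z = k) * (g (F z) * \<rho> z) \<partial>M) = (\<integral>z. g z * \<rho>' z \<partial>M)"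
proof -
  let ?R = "\<theta>\<^sub>0 * (K + R)"
  have R': "0 \<le> ?R" using R K_pos \<theta>\<^sub>0 by auto
  have [measurable]: "\<rho> \<in> borel_measurable M" by (rule coneD[OF \<rho>])
  \<comment> \<open>Cells are indexed by natural numbers; an index that belongs to no cell of level
    \<open>k\<close> gives the empty set and contributes the zero density, so finite and infinite
    partitions need not be distinguished.\<close>
  define E where "E i = {z \<in> space M. \<phi> z = k \<and> to_nat_on \<alpha> (cell z) = i}" for i
  have [measurable]: "E i \<in> sets M" for i unfolding E_def by measurable
  have E_cell: "E i = {} \<or> E i \<in> \<alpha>" for i
  proof (cases "E i = {}")
    case False
    then obtain z where z: "z \<in> space M" "\<phi> z = k" "to_nat_on \<alpha> (cell z) = i" by (auto simp: E_def)
    have "E i = cell z"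
    proof (intro set_eqI iffI)
      fix x assume "x \<in> E i"
      then have x: "x \<in> space M" "to_nat_on \<alpha> (cell x) = to_nat_on \<alpha> (cell z)" by (auto simp: E_def z)
      then have "cell x = cell z"
        using inj_onD[OF inj_on_to_nat_on[OF partition(2)]] cell_mem(1) z(1) by metis
      then show "x \<in> cell z" using cell_mem[OF x(1)] by simp
    next
      fix x assume x: "x \<in> cell z"
      have "x \<in> space M" using \<alpha>_subset[OF cell_mem(1)[OF z(1)]] x by auto
      moreover have "cell x = cell z" by (rule cell_eq[OF cell_mem(1)[OF z(1)] x])
      moreover have "\<phi> x = \<phi> z" by (rule \<phi>_cell[OF cell_mem(1)[OF z(1)] x cell_mem(2)[OF z(1)]])
      ultimately show "x \<in> E i" using z by (simp add: E_def)
    qed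
    then show ?thesis using cell_mem[OF z(1)] by simp
  qed auto
  have ex: "\<exists>\<rho>'\<in>cone ?R. \<forall>g\<in>borel_measurable M.
      (\<integral>z. indicator (E i) z * (g (F z) * \<rho> z) \<partial>M) = (\<integral>z. g z * \<rho>' z \<partial>M)" for i
  proof (cases "E i = {}")
    case True
    then show ?thesis using R' by (intro bexI[of _ "\<lambda>_. 0"] cone_const) auto
  next
    case False
    then have "E i \<in> \<alpha>" using E_cell[of i] by auto
    then show ?thesis by (rule branch_transfer[OF _ \<rho> R])
  qed
  obtain r where r: "\<And>i. r i \<in> cone ?R" and r_int: "\<And>i g. g \<in> borel_measurable M \<Longrightarrow>
      (\<integral>z. indicator (E i) z * (g (F z) * \<rho> z) \<partial>M) = (\<integral>z. g z * r i z \<partial>M)"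
    using bchoice[of UNIV "\<lambda>i \<rho>'. \<rho>' \<in> cone ?R \<and> (\<forall>g\<in>borel_measurable M.
      (\<integral>z. indicator (E i) z * (g (F z) * \<rho> z) \<partial>M) = (\<integral>z. g z * \<rho>' z \<partial>M))"] ex by blast
  have [measurable]: "r i \<in> borel_measurable M" for i by (rule coneD[OF r])
  define I where "I i = integral\<^sup>L M (r i)" for i
  have I0: "0 \<le> I i" for i unfolding I_def by (rule cone_integral_nonneg[OF r])
  have I_eq: "I i = (\<integral>z. indicator (E i) z * \<rho> z \<partial>M)" for i
    using r_int[of "\<lambda>_. 1" i] by (simp add: I_def)
  have int_E: "integrable M (\<lambda>z. indicator (E i) z * \<rho> z)" for i
    by (rule cone_integrable_mult[OF \<rho>, where B=1]) (auto simp: indicator_def)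
  have sums_E: "(\<lambda>i. indicator (E i) z * x) sums (of_bool (\<phi> z = k) * x)" if "z \<in> space M" for z and x :: real
  proof -
    have "(\<lambda>i. indicator (E i) z * x) = (\<lambda>i. if i = to_nat_on \<alpha> (cell z) then of_bool (\<phi> z = k) * x else 0)"
      using that by (auto simp: E_def fun_eq_iff)
    then show ?thesis using sums_single[of "to_nat_on \<alpha> (cell z)" "\<lambda>_. of_bool (\<phi> z = k) * x"] by simp
  qed
  have sumI: "summable I"
  proof (rule bounded_imp_summable[OF I0])
    fix n
    have "(\<Sum>i\<le>n. I i) = (\<integral>z. (\<Sum>i\<le>n. indicator (E i) z * \<rho> z) \<partial>M)"
      unfolding I_eq by (subst Bochner_Integration.integral_sum) (auto intro: int_E)
    also have "\<dots> \<le> (\<integral>z. \<rho> z \<partial>M)"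
    proof (rule integral_mono_AE)
      show "AE z in M. (\<Sum>i\<le>n. indicator (E i) z * \<rho> z) \<le> \<rho> z"
      proof (rule AE_I2)
        fix z assume z: "z \<in> space M"
        have "(\<Sum>i\<le>n. indicator (E i) z * \<rho> z) \<le> (\<Sum>i. indicator (E i) z * \<rho> z)"
          using sums_E[OF z, of "\<rho> z"] coneD(2)[OF \<rho> z] by (intro sum_le_suminf) (auto dest: sums_summable)
        also have "\<dots> \<le> \<rho> z" using sums_unique[OF sums_E[OF z, of "\<rho> z"], symmetric] coneD(2)[OF \<rho> z] by (auto simp: of_bool_def)
        finally show "(\<Sum>i\<le>n. indicator (E i) z * \<rho> z) \<le> \<rho> z" .
      qed
    qed (rule Bochner_Integration.integrable_sum[OF int_E], rule cone_integrable[OF \<rho>])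
    finally show "(\<Sum>i\<le>n. I i) \<le> integral\<^sup>L M \<rho>" .
  qed
  have r_le: "r i z \<le> exp ?R * I i" if "z \<in> space M" for i z
    unfolding I_def by (rule cone_le_integral(1)[OF r R' that])
  have sum_r: "summable (\<lambda>i. r i z)" if "z \<in> space M" for z
    by (rule summable_comparison_test'[of "\<lambda>i. exp ?R * I i" 0])
      (use that r_le coneD(2)[OF r] sumI in \<open>auto intro: summable_mult\<close>)
  define \<rho>' where "\<rho>' z = (\<Sum>i. r i z)" for z
  have "\<rho>' z \<le> exp (?R * prox z z') * \<rho>' z'" if "z \<in> space M" "z' \<in> space M" for z z'
    unfolding \<rho>'_def
    by (subst suminf_mult[symmetric]) (use that sum_r coneD(3)[OF r] in \<open>auto intro!: suminf_le summable_mult\<close>)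
  moreover have "0 \<le> \<rho>' z" if "z \<in> space M" for z
    unfolding \<rho>'_def using that sum_r coneD(2)[OF r] by (intro suminf_nonneg) auto
  moreover have "\<rho>' \<in> borel_measurable M" unfolding \<rho>'_def by measurable
  ultimately have "\<rho>' \<in> cone ?R" by (auto simp: cone_def)
  moreover have "(\<integral>z. of_bool (\<phi> z = k) * (g (F z) * \<rho> z) \<partial>M) = (\<integral>z. g z * \<rho>' z \<partial>M)"
    if [measurable]: "g \<in> borel_measurable M" and B: "\<forall>z\<in>space M. \<bar>g z\<bar> \<le> B" for g B
  proof -
    obtain z0 where z0: "z0 \<in> space M" using not_empty by auto
    have B0: "0 \<le> B" using B z0 by fastforce
    have int_gr: "integrable M (\<lambda>z. g z * r i z)" for i
      by (rule cone_integrable_mult[OF r]) (use B in auto)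
    have gF: "(\<lambda>z. indicator (E i) z * g (F z)) \<in> borel_measurable M" "\<bar>indicator (E i) z * g (F z)\<bar> \<le> B"
      if "z \<in> space M" for i z
      using B B0 F_space[OF that] by (auto simp: indicator_def)
    have int_gE: "integrable M (\<lambda>z. indicator (E i) z * (g (F z) * \<rho> z))" for i
      using cone_integrable_mult[OF \<rho> gF(1)[OF z0] gF(2), of i] by (simp add: mult.assoc)
    have "(\<integral>z. of_bool (\<phi> z = k) * (g (F z) * \<rho> z) \<partial>M) = (\<integral>z. (\<Sum>i. indicator (E i) z * (g (F z) * \<rho> z)) \<partial>M)"
      by (intro Bochner_Integration.integral_cong refl sums_unique sums_E)
    also have "\<dots> = (\<Sum>i. \<integral>z. indicator (E i) z * (g (F z) * \<rho> z) \<partial>M)"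
    proof (rule integral_suminf[OF int_gE])
      show "AE z in M. summable (\<lambda>i. norm (indicator (E i) z * (g (F z) * \<rho> z)))"
      proof (rule AE_I2)
        fix z assume z: "z \<in> space M"
        have "(\<lambda>i. norm (indicator (E i) z * (g (F z) * \<rho> z))) = (\<lambda>i. indicator (E i) z * \<bar>g (F z) * \<rho> z\<bar>)"
          by (auto simp: abs_mult)
        then show "summable (\<lambda>i. norm (indicator (E i) z * (g (F z) * \<rho> z)))"
          using sums_summable[OF sums_E[OF z, of "\<bar>g (F z) * \<rho> z\<bar>"]] by simp
      qed
      show "summable (\<lambda>i. \<integral>z. norm (indicator (E i) z * (g (F z) * \<rho> z)) \<partial>M)"
      proof (rule summable_comparison_test'[of "\<lambda>i. B * I i" 0])
        fix i :: nat
        have "(\<integral>z. norm (indicator (E i) z * (g (F z) * \<rho> z)) \<partial>M) \<le> (\<integral>z. B * (indicator (E i) z * \<rho> z) \<partial>M)"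
        proof (rule integral_mono[OF integrable_norm[OF int_gE]])
          show "integrable M (\<lambda>z. B * (indicator (E i) z * \<rho> z))" using int_E by simp
          fix z assume z: "z \<in> space M"
          show "norm (indicator (E i) z * (g (F z) * \<rho> z)) \<le> B * (indicator (E i) z * \<rho> z)"
            using B F_space[OF z] coneD(2)[OF \<rho> z]
            by (auto simp: indicator_def abs_mult intro!: mult_right_mono)
        qed
        then show "norm (\<integral>z. norm (indicator (E i) z * (g (F z) * \<rho> z)) \<partial>M) \<le> B * I i"
          by (simp add: I_eq)
      qed (use sumI in \<open>auto intro: summable_mult\<close>)
    qed
    also have "\<dots> = (\<Sum>i. \<integral>z. g z * r i z \<partial>M)" by (simp add: r_int)
    also have "\<dots> = (\<integral>z. (\<Sum>i. g z * r i z) \<partial>M)"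
    proof (rule integral_suminf[OF int_gr, symmetric])
      show "AE z in M. summable (\<lambda>i. norm (g z * r i z))"
      proof (rule AE_I2)
        fix z assume z: "z \<in> space M"
        have "(\<lambda>i. norm (g z * r i z)) = (\<lambda>i. \<bar>g z\<bar> * r i z)"
          using coneD(2)[OF r z] by (auto simp: abs_mult)
        then show "summable (\<lambda>i. norm (g z * r i z))" using sum_r[OF z] by (simp add: summable_mult)
      qed
      show "summable (\<lambda>i. \<integral>z. norm (g z * r i z) \<partial>M)"
      proof (rule summable_comparison_test'[of "\<lambda>i. B * I i" 0])
        fix i :: nat
        have "(\<integral>z. norm (g z * r i z) \<partial>M) \<le> (\<integral>z. B * r i z \<partial>M)"
        proof (rule integral_mono[OF integrable_norm[OF int_gr]])
          show "integrable M (\<lambda>z. B * r i z)" using cone_integrable[OF r] by simp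
          fix z assume z: "z \<in> space M"
          show "norm (g z * r i z) \<le> B * r i z"
            using B z coneD(2)[OF r z] by (auto simp: abs_mult intro!: mult_right_mono)
        qed
        then show "norm (\<integral>z. norm (g z * r i z) \<partial>M) \<le> B * I i"
          by (simp add: I_def)
      qed (use sumI in \<open>auto intro: summable_mult\<close>)
    qed
    also have "\<dots> = (\<integral>z. g z * \<rho>' z \<partial>M)"
      unfolding \<rho>'_def by (intro Bochner_Integration.integral_cong refl suminf_mult sum_r)
    finally show ?thesis .
  qed
  ultimately show ?thesis by blast
qed

text \<open>The cone is mapped strictly into itself if
  \<open>\<theta>\<^sub>0 * (K + R) < R\<close>; here
  \<open>R\<^sub>0 * (1 - \<theta>\<^sub>0)\<close> equals \<open>2 * K\<close>, which exceeds
  \<open>\<theta>\<^sub>0 * K\<close>.\<close>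

definition R\<^sub>0 :: real where "R\<^sub>0 = 2 * K / (1 - \<theta>\<^sub>0)"

definition R\<^sub>1 :: real where "R\<^sub>1 = \<theta>\<^sub>0 * (K + R\<^sub>0)"

text \<open>The share of a returning density that is split off as a constant. It satisfies \<open>c
  * R\<^sub>0 * exp R\<^sub>0 = exp (- R\<^sub>1) * (R\<^sub>0 - R\<^sub>1)\<close>, the identity on
  which \<open>drop_cone\<close> rests.\<close>

definition c :: real where "c = exp (- R\<^sub>1 - R\<^sub>0) * ((R\<^sub>0 - R\<^sub>1) / R\<^sub>0)"

text \<open>Duality determines the density only up to null sets, so a version that lies in the cone
  at every point is selected.\<close>

definition transfer :: "nat \<Rightarrow> ('b \<Rightarrow> real) \<Rightarrow> 'b \<Rightarrow> real" where
  "transfer k \<rho> = (SOME \<rho>'. \<rho>' \<in> cone R\<^sub>1 \<and> (\<forall>g B. g \<in> borel_measurable M \<longrightarrow> (\<forall>z\<in>space M. \<bar>g z\<bar> \<le> B) \<longrightarrow>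
    (\<integral>z. of_bool (\<phi> z = k) * (g (F z) * \<rho> z) \<partial>M) = (\<integral>z. g z * \<rho>' z \<partial>M)))"

definition drop :: "nat \<Rightarrow> ('b \<Rightarrow> real) \<Rightarrow> 'b \<Rightarrow> real" where
  "drop k \<rho> z = transfer k \<rho> z - c * integral\<^sup>L M (transfer k \<rho>)"

definition mass :: "nat \<Rightarrow> ('b \<Rightarrow> real) \<Rightarrow> real" where
  "mass k \<rho> = (\<integral>z. of_bool (\<phi> z = k) * \<rho> z \<partial>M)"

lemma R_bounds: "0 < R\<^sub>0" "0 < R\<^sub>1" "R\<^sub>1 < R\<^sub>0"
proof -
  show R: "0 < R\<^sub>0" using K_pos \<theta>\<^sub>0 by (simp add: R\<^sub>0_def)
  then show "0 < R\<^sub>1" using K_pos \<theta>\<^sub>0 by (simp add: R\<^sub>1_def)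
  have "R\<^sub>0 * (1 - \<theta>\<^sub>0) = 2 * K" using \<theta>\<^sub>0 by (simp add: R\<^sub>0_def)
  moreover have "\<theta>\<^sub>0 * K < 2 * K" using K_pos \<theta>\<^sub>0 by simp
  ultimately show "R\<^sub>1 < R\<^sub>0" by (simp add: R\<^sub>1_def algebra_simps)
qed

lemma c_bounds: "0 < c" "c < 1"
proof -
  show "0 < c" using R_bounds by (simp add: c_def)
  have "c < 1 * 1" unfolding c_def using R_bounds by (intro mult_strict_mono) auto
  then show "c < 1" by simp
qed

lemma transfer:
  assumes "\<rho> \<in> cone R\<^sub>0"
  shows "transfer k \<rho> \<in> cone R\<^sub>1"
    and "\<And>g B. g \<in> borel_measurable M \<Longrightarrow> (\<And>z. z \<in> space M \<Longrightarrow> \<bar>g z\<bar> \<le> B) \<Longrightarrow>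
      (\<integral>z. of_bool (\<phi> z = k) * (g (F z) * \<rho> z) \<partial>M) = (\<integral>z. g z * transfer k \<rho> z \<partial>M)"
proof -
  let ?P = "\<lambda>\<rho>'. \<rho>' \<in> cone R\<^sub>1 \<and> (\<forall>g B. g \<in> borel_measurable M \<longrightarrow> (\<forall>z\<in>space M. \<bar>g z\<bar> \<le> B) \<longrightarrow>
    (\<integral>z. of_bool (\<phi> z = k) * (g (F z) * \<rho> z) \<partial>M) = (\<integral>z. g z * \<rho>' z \<partial>M))"
  have "\<exists>\<rho>'. ?P \<rho>'" using level_transfer[OF assms, of k] R_bounds unfolding R\<^sub>1_def by auto
  then have "?P (transfer k \<rho>)" unfolding transfer_def by (rule someI_ex)
  then show "transfer k \<rho> \<in> cone R\<^sub>1"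
    and "\<And>g B. g \<in> borel_measurable M \<Longrightarrow> (\<And>z. z \<in> space M \<Longrightarrow> \<bar>g z\<bar> \<le> B) \<Longrightarrow>
      (\<integral>z. of_bool (\<phi> z = k) * (g (F z) * \<rho> z) \<partial>M) = (\<integral>z. g z * transfer k \<rho> z \<partial>M)"
    by blast+
qed

lemma transfer_cone: "\<rho> \<in> cone R\<^sub>0 \<Longrightarrow> transfer k \<rho> \<in> cone R\<^sub>0"
  using transfer(1) cone_mono[of R\<^sub>1 R\<^sub>0] R_bounds by (auto intro: less_imp_le)

lemma integral_transfer: "\<rho> \<in> cone R\<^sub>0 \<Longrightarrow> integral\<^sup>L M (transfer k \<rho>) = mass k \<rho>"
  using transfer(2)[of \<rho> "\<lambda>_. 1" 1 k] by (simp add: mass_def)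

text \<open>The gap between \<open>R\<^sub>1\<close> and \<open>R\<^sub>0\<close> pays for the
  subtraction. With \<open>t = prox z z'\<close> and \<open>I\<close> the integral, the cone
  inequality for the difference follows from \<open>c * (exp (R\<^sub>0 * t) - 1) * I \<le> (exp
  (R\<^sub>0 * t) - exp (R\<^sub>1 * t)) * transfer k \<rho> z'\<close>. There the density is at
  least \<open>exp (- R\<^sub>1) * I\<close>, and both brackets are compared with multiples of
  \<open>t\<close>.\<close>

lemma drop_cone:
  assumes \<rho>: "\<rho> \<in> cone R\<^sub>0" shows "drop k \<rho> \<in> cone R\<^sub>0"
proof -
  let ?r = "transfer k \<rho>" and ?I = "integral\<^sup>L M (transfer k \<rho>)"
  have r: "?r \<in> cone R\<^sub>1" by (rule transfer(1)[OF \<rho>])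
  have [measurable]: "?r \<in> borel_measurable M" by (rule coneD[OF r])
  have I: "0 \<le> ?I" by (rule cone_integral_nonneg[OF r])
  have low: "exp (- R\<^sub>1) * ?I \<le> ?r z" if "z \<in> space M" for z
    using cone_le_integral(2)[OF r _ that] R_bounds by simp
  have c_le: "c \<le> exp (- R\<^sub>1)"
  proof -
    have "c \<le> exp (- R\<^sub>1) * 1" unfolding c_def using R_bounds
      by (intro mult_mono) auto
    then show ?thesis by simp
  qed
  have "drop k \<rho> \<in> borel_measurable M" unfolding drop_def by measurable
  moreover have "0 \<le> drop k \<rho> z" if "z \<in> space M" for z
    unfolding drop_def using low[OF that] mult_right_mono[OF c_le I] by linarith
  moreover have "drop k \<rho> z \<le> exp (R\<^sub>0 * prox z z') * drop k \<rho> z'" if z: "z \<in> space M" "z' \<in> space M" for z z'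
  proof -
    let ?t = "prox z z'"
    have t: "0 \<le> ?t" "?t \<le> 1" by (rule prox_bounds)+
    have e0: "0 \<le> exp (R\<^sub>0 * ?t) - exp (R\<^sub>1 * ?t)" using t R_bounds by (simp add: mult_right_mono)
    have "exp (R\<^sub>0 * ?t) - 1 \<le> R\<^sub>0 * ?t * exp R\<^sub>0"
    proof -
      have "1 - R\<^sub>0 * ?t \<le> exp (- (R\<^sub>0 * ?t))" using exp_ge_add_one_self[of "- (R\<^sub>0 * ?t)"] by simp
      then have "exp (R\<^sub>0 * ?t) * (1 - R\<^sub>0 * ?t) \<le> exp (R\<^sub>0 * ?t) * exp (- (R\<^sub>0 * ?t))" by (intro mult_left_mono) auto
      then have "exp (R\<^sub>0 * ?t) - 1 \<le> R\<^sub>0 * ?t * exp (R\<^sub>0 * ?t)" by (simp add: exp_minus algebra_simps)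
      also have "\<dots> \<le> R\<^sub>0 * ?t * exp R\<^sub>0" using t R_bounds by (intro mult_left_mono) (auto simp: mult_left_le)
      finally show ?thesis .
    qed
    moreover have "(R\<^sub>0 - R\<^sub>1) * ?t \<le> exp (R\<^sub>0 * ?t) - exp (R\<^sub>1 * ?t)"
    proof -
      have "exp (R\<^sub>1 * ?t) * (1 + (R\<^sub>0 - R\<^sub>1) * ?t) \<le> exp (R\<^sub>1 * ?t) * exp ((R\<^sub>0 - R\<^sub>1) * ?t)"
        using exp_ge_add_one_self[of "(R\<^sub>0 - R\<^sub>1) * ?t"] by (intro mult_left_mono) auto
      also have "\<dots> = exp (R\<^sub>0 * ?t)" by (simp add: algebra_simps flip: exp_add)
      finally have "exp (R\<^sub>1 * ?t) * ((R\<^sub>0 - R\<^sub>1) * ?t) \<le> exp (R\<^sub>0 * ?t) - exp (R\<^sub>1 * ?t)" by (simp add: algebra_simps)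
      moreover have "1 * ((R\<^sub>0 - R\<^sub>1) * ?t) \<le> exp (R\<^sub>1 * ?t) * ((R\<^sub>0 - R\<^sub>1) * ?t)"
        using t R_bounds by (intro mult_right_mono) auto
      ultimately show ?thesis by simp
    qed
    ultimately have "c * (exp (R\<^sub>0 * ?t) - 1) \<le> exp (- R\<^sub>1) * (exp (R\<^sub>0 * ?t) - exp (R\<^sub>1 * ?t))"
    proof -
      assume a: "exp (R\<^sub>0 * ?t) - 1 \<le> R\<^sub>0 * ?t * exp R\<^sub>0" and b: "(R\<^sub>0 - R\<^sub>1) * ?t \<le> exp (R\<^sub>0 * ?t) - exp (R\<^sub>1 * ?t)"
      have "c * (exp (R\<^sub>0 * ?t) - 1) \<le> c * (R\<^sub>0 * ?t * exp R\<^sub>0)"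
        using a c_bounds by (intro mult_left_mono) auto
      also have "\<dots> = exp (- R\<^sub>1) * (exp (- R\<^sub>0) * exp R\<^sub>0) * ((R\<^sub>0 - R\<^sub>1) * ?t)"
      proof -
        have "exp (- R\<^sub>1 - R\<^sub>0) = exp (- R\<^sub>1) * exp (- R\<^sub>0)" by (simp flip: exp_add)
        then show ?thesis using R_bounds by (simp add: c_def field_simps)
      qed
      also have "\<dots> = exp (- R\<^sub>1) * ((R\<^sub>0 - R\<^sub>1) * ?t)" by (simp flip: exp_add)
      also have "\<dots> \<le> exp (- R\<^sub>1) * (exp (R\<^sub>0 * ?t) - exp (R\<^sub>1 * ?t))" using b by (intro mult_left_mono) auto
      finally show ?thesis .
    qed
    then have "c * (exp (R\<^sub>0 * ?t) - 1) * ?I \<le> exp (- R\<^sub>1) * (exp (R\<^sub>0 * ?t) - exp (R\<^sub>1 * ?t)) * ?I"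
      by (rule mult_right_mono[OF _ I])
    also have "\<dots> = (exp (R\<^sub>0 * ?t) - exp (R\<^sub>1 * ?t)) * (exp (- R\<^sub>1) * ?I)" by (simp only: mult_ac)
    also have "\<dots> \<le> (exp (R\<^sub>0 * ?t) - exp (R\<^sub>1 * ?t)) * ?r z'" by (rule mult_left_mono[OF low[OF z(2)] e0])
    finally have "c * (exp (R\<^sub>0 * ?t) - 1) * ?I \<le> (exp (R\<^sub>0 * ?t) - exp (R\<^sub>1 * ?t)) * ?r z'" .
    moreover have "?r z \<le> exp (R\<^sub>1 * ?t) * ?r z'" by (rule coneD(3)[OF r z])
    ultimately show ?thesis unfolding drop_def by (simp add: algebra_simps)
  qed
  ultimately show ?thesis by (auto simp: cone_def)
qed

lemma integral_drop:
  assumes "\<rho> \<in> cone R\<^sub>0" shows "integral\<^sup>L M (drop k \<rho>) = (1 - c) * mass k \<rho>"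
  unfolding drop_def using cone_integrable[OF transfer(1)[OF assms]]
  by (simp add: prob_space integral_transfer[OF assms] algebra_simps)

end

text \<open>\<open>tpos F \<phi> n z\<close> is the position at time \<open>n\<close> of the orbit of \<open>(z, 0)\<close> in the tower, and
  \<open>ret F \<phi> n z\<close> the number of its returns to the base up to time \<open>n\<close>.\<close>

fun tpos :: "('a \<Rightarrow> 'a) \<Rightarrow> ('a \<Rightarrow> nat) \<Rightarrow> nat \<Rightarrow> 'a \<Rightarrow> 'a \<times> nat" where
  "tpos F \<phi> n z = (if \<phi> z = 0 \<or> n < \<phi> z then (z, n) else tpos F \<phi> (n - \<phi> z) (F z))"

fun ret :: "('a \<Rightarrow> 'a) \<Rightarrow> ('a \<Rightarrow> nat) \<Rightarrow> nat \<Rightarrow> 'a \<Rightarrow> nat" where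
  "ret F \<phi> n z = (if \<phi> z = 0 \<or> n < \<phi> z then 0 else Suc (ret F \<phi> (n - \<phi> z) (F z)))"

declare tpos.simps [simp del] ret.simps [simp del]

lemma sum_swap_conv:
  fixes f :: "nat \<Rightarrow> nat \<Rightarrow> real"
  shows "(\<Sum>j\<le>n. \<Sum>k=1..j. f k (j - k)) = (\<Sum>k=1..n. \<Sum>i\<le>n - k. f k i)"
  unfolding sum.Sigma[OF finite_atMost ballI[OF finite_atLeastAtMost]]
    sum.Sigma[OF finite_atLeastAtMost ballI[OF finite_atMost]]
  by (rule sum.reindex_bij_witness[of _ "\<lambda>(k, i). (k + i, k)" "\<lambda>(j, k). (k, j - k)"]) auto

section \<open>Orbits in the quotient tower\<close>

context Gibbs_Markov_tower
begin

abbreviation "pos \<equiv> tpos F \<phi>"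

abbreviation "rt \<equiv> ret F \<phi>"

lemma pos_less: "n < \<phi> z \<Longrightarrow> pos n z = (z, n)" and ret_less: "n < \<phi> z \<Longrightarrow> rt n z = 0"
  by (simp_all add: tpos.simps[of _ _ n z] ret.simps[of _ _ n z])

lemma pos_ge: "z \<in> space M \<Longrightarrow> \<phi> z \<le> n \<Longrightarrow> pos n z = pos (n - \<phi> z) (F z)"
  and ret_ge: "z \<in> space M \<Longrightarrow> \<phi> z \<le> n \<Longrightarrow> rt n z = Suc (rt (n - \<phi> z) (F z))"
  using \<phi>_pos[of z] by (simp_all add: tpos.simps[of _ _ n z] ret.simps[of _ _ n z])

text \<open>A point on level \<open>l\<close> is the base point of its column after \<open>l\<close>
  steps. Restarting an orbit anywhere in the tower therefore amounts to restarting on the base with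
  \<open>l\<close> extra units of time.\<close>

lemma pos_add:
  assumes "z \<in> space M"
  shows "pos (n + m) z = pos (snd (pos n z) + m) (fst (pos n z)) \<and>
    rt (n + m) z = rt n z + rt (snd (pos n z) + m) (fst (pos n z))"
  using assms
proof (induction n arbitrary: z rule: less_induct)
  case (less n)
  show ?case
  proof (cases "n < \<phi> z")
    case True
    then show ?thesis by (simp add: pos_less ret_less)
  next
    case False
    then have "n + m - \<phi> z = (n - \<phi> z) + m" by simp
    then show ?thesis using False less.IH[of "n - \<phi> z" "F z"] \<phi>_pos[OF less.prems] F_space[OF less.prems]
      by (simp add: pos_ge ret_ge less.prems)
  qed
qed

lemma ret_mono: "z \<in> space M \<Longrightarrow> n \<le> m \<Longrightarrow> rt n z \<le> rt m z"
  using pos_add[of z n "m - n"] by simp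

lemma measurable_first_return:
  assumes u: "u \<in> borel_measurable M"
    and v: "\<And>k. 0 < k \<Longrightarrow> k \<le> n \<Longrightarrow> v k \<in> borel_measurable M"
    and f: "\<And>z. z \<in> space M \<Longrightarrow> f z = (if n < \<phi> z then u z else v (\<phi> z) (F z))"
  shows "(f :: 'b \<Rightarrow> real) \<in> borel_measurable M"
proof -
  define w where "w k = (if 0 < k \<and> k \<le> n then v k else (\<lambda>_. 0))" for k
  have w [measurable]: "w k \<in> borel_measurable M" for k using v by (auto simp: w_def)
  have [measurable]: "(\<lambda>z. w (\<phi> z) (F z)) \<in> borel_measurable M"
    by (rule measurable_compose_countable[where g=\<phi>]) measurable
  note u [measurable]
  have "(\<lambda>z. if n < \<phi> z then u z else w (\<phi> z) (F z)) \<in> borel_measurable M" by measurable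
  then show ?thesis
    by (rule measurable_cong[THEN iffD1, rotated]) (use \<phi>_pos in \<open>auto simp: f w_def not_less\<close>)
qed

text \<open>The bound is imposed on all pairs, including those outside the tower, so that it can be
  used without checking levels.\<close>

definition adm :: "('b \<times> nat \<Rightarrow> real) \<Rightarrow> real \<Rightarrow> bool" where
  "adm h B \<longleftrightarrow> (\<forall>l. (\<lambda>z. h (z, l)) \<in> borel_measurable M) \<and> (\<forall>p. \<bar>h p\<bar> \<le> B)"

lemma admD: "adm h B \<Longrightarrow> (\<lambda>z. h (z, l)) \<in> borel_measurable M" "adm h B \<Longrightarrow> \<bar>h p\<bar> \<le> B"
  and adm_nonneg: "adm h B \<Longrightarrow> 0 \<le> B"
  by (auto simp: adm_def simp del: split_paired_All intro: order_trans[OF abs_ge_zero])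

lemma measurable_pos:
  assumes "adm h B" shows "(\<lambda>z. h (pos n z)) \<in> borel_measurable M"
proof (induction n rule: less_induct)
  case (less n)
  show ?case
  proof (rule measurable_first_return[where u="\<lambda>z. h (z, n)" and v="\<lambda>k z. h (pos (n - k) z)"])
    show "(\<lambda>z. h (pos (n - k) z)) \<in> borel_measurable M" if "0 < k" "k \<le> n" for k
      using that by (intro less) auto
  qed (use admD[OF assms] in \<open>auto simp: pos_less pos_ge not_less\<close>)
qed

lemma measurable_ret [measurable]: "(\<lambda>z. x ^ rt n z :: real) \<in> borel_measurable M"
proof (induction n rule: less_induct)
  case (less n)
  show ?case
  proof (rule measurable_first_return[where u="\<lambda>z. 1" and v="\<lambda>k z. x * x ^ rt (n - k) z"])
    show "(\<lambda>z. x * x ^ rt (n - k) z) \<in> borel_measurable M" if "0 < k" "k \<le> n" for k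
      using that less[of "n - k"] by auto
  qed (auto simp: ret_less ret_ge not_less)
qed

lemma measurable_window:
  assumes x: "0 \<le> x" "x \<le> (1::real)"
  shows "(\<lambda>z. x ^ (rt (m + u) z - rt m z)) \<in> borel_measurable M"
proof -
  define h where "h p = x ^ rt (snd p + u) (fst p)" for p
  have h: "adm h 1" using x by (auto simp: adm_def h_def power_le_one)
  show ?thesis
    using measurable_pos[OF h, of m]
    by (rule measurable_cong[THEN iffD1, rotated]) (use pos_add in \<open>auto simp: h_def\<close>)
qed

text \<open>Conditioning on the first return: an orbit that has not returned by time
  \<open>n\<close> is still in its first column, and one that returns at time \<open>k\<close>
  continues with density \<open>transfer k \<rho>\<close>. The recursions for positions, for counts
  of returns and for windows are instances of this identity.\<close>

lemma first_return_integral: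
  assumes \<rho>: "\<rho> \<in> cone R\<^sub>0" and u: "u \<in> borel_measurable M" "\<And>z. z \<in> space M \<Longrightarrow> \<bar>u z\<bar> \<le> B"
    and v: "\<And>k. k \<in> {1..n} \<Longrightarrow> v k \<in> borel_measurable M" "\<And>k z. k \<in> {1..n} \<Longrightarrow> z \<in> space M \<Longrightarrow> \<bar>v k z\<bar> \<le> B"
    and f: "\<And>z. z \<in> space M \<Longrightarrow> f z = (if n < \<phi> z then u z else v (\<phi> z) (F z))"
  shows "(\<integral>z. f z * \<rho> z \<partial>M) = (\<integral>z. of_bool (n < \<phi> z) * u z * \<rho> z \<partial>M) +
    (\<Sum>k=1..n. \<integral>z. v k z * transfer k \<rho> z \<partial>M)"
proof -
  obtain z0 where z0: "z0 \<in> space M" using not_empty by auto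
  have B: "0 \<le> B" using u(2)[OF z0] by linarith
  note u(1) [measurable]
  have i1: "integrable M (\<lambda>z. of_bool (n < \<phi> z) * u z * \<rho> z)"
    by (rule cone_integrable_mult[OF \<rho>, where B=B]) (use u B in auto)
  have i2: "integrable M (\<lambda>z. of_bool (\<phi> z = k) * (v k (F z) * \<rho> z))" if k: "k \<in> {1..n}" for k
  proof -
    note v(1)[OF k, measurable]
    have "integrable M (\<lambda>z. (of_bool (\<phi> z = k) * v k (F z)) * \<rho> z)"
      by (rule cone_integrable_mult[OF \<rho>, where B=B]) (use v(2)[OF k] F_space B in auto)
    then show ?thesis by (simp add: mult.assoc)
  qed
  have "(\<integral>z. f z * \<rho> z \<partial>M) = (\<integral>z. of_bool (n < \<phi> z) * u z * \<rho> z +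
      (\<Sum>k=1..n. of_bool (\<phi> z = k) * (v k (F z) * \<rho> z)) \<partial>M)"
  proof (rule Bochner_Integration.integral_cong[OF refl])
    fix z assume z: "z \<in> space M"
    have "(\<Sum>k=1..n. of_bool (\<phi> z = k) * (v k (F z) * \<rho> z)) =
        (\<Sum>k=1..n. if k = \<phi> z then v k (F z) * \<rho> z else 0)"
      by (intro sum.cong) auto
    also have "\<dots> = (if \<phi> z \<le> n then v (\<phi> z) (F z) * \<rho> z else 0)"
      using \<phi>_pos[OF z] by (simp add: Suc_le_eq)
    finally show "f z * \<rho> z = of_bool (n < \<phi> z) * u z * \<rho> z +
      (\<Sum>k=1..n. of_bool (\<phi> z = k) * (v k (F z) * \<rho> z))" by (simp add: f[OF z])
  qed
  also have "\<dots> = (\<integral>z. of_bool (n < \<phi> z) * u z * \<rho> z \<partial>M) +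
      (\<Sum>k=1..n. \<integral>z. of_bool (\<phi> z = k) * (v k (F z) * \<rho> z) \<partial>M)"
    by (simp only: Bochner_Integration.integral_add[OF i1 Bochner_Integration.integrable_sum[OF i2]]
        Bochner_Integration.integral_sum[OF i2])
  also have "(\<Sum>k=1..n. \<integral>z. of_bool (\<phi> z = k) * (v k (F z) * \<rho> z) \<partial>M) =
      (\<Sum>k=1..n. \<integral>z. v k z * transfer k \<rho> z \<partial>M)"
    by (intro sum.cong refl transfer(2)[OF \<rho>, where B=B] v)
  finally show ?thesis .
qed

section \<open>First-return recursions and the rarity of windows with few returns\<close>

definition late :: "nat \<Rightarrow> ('b \<Rightarrow> real) \<Rightarrow> real" where
  "late n \<rho> = (\<integral>z. of_bool (n < \<phi> z) * \<rho> z \<partial>M)"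

text \<open>The law at time \<open>n\<close> of an orbit that starts on the base with density
  \<rho>, tested against \<open>h\<close>.\<close>

definition X :: "nat \<Rightarrow> ('b \<Rightarrow> real) \<Rightarrow> ('b \<times> nat \<Rightarrow> real) \<Rightarrow> real" where
  "X n \<rho> h = (\<integral>z. h (pos n z) * \<rho> z \<partial>M)"

lemma X_first_return:
  assumes "\<rho> \<in> cone R\<^sub>0" "adm h B"
  shows "X n \<rho> h = (\<integral>z. of_bool (n < \<phi> z) * h (z, n) * \<rho> z \<partial>M) + (\<Sum>k=1..n. X (n - k) (transfer k \<rho>) h)"
  unfolding X_def
  by (rule first_return_integral[OF assms(1), where B=B])
    (use admD[OF assms(2)] measurable_pos[OF assms(2)] in \<open>auto simp: pos_less pos_ge not_less\<close>)

lemma mass_nonneg: "\<rho> \<in> cone R\<^sub>0 \<Longrightarrow> 0 \<le> mass k \<rho>"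
  unfolding mass_def by (intro integral_nonneg_AE AE_I2) (auto dest: coneD)

lemma integrable_of_bool:
  assumes "\<rho> \<in> cone R" "Measurable.pred M P"
  shows "integrable M (\<lambda>z. of_bool (P z) * \<rho> z)"
  using assms(2) by (intro cone_integrable_mult[OF assms(1), where B=1]) auto

lemma integral_of_bool_le:
  assumes \<rho>: "\<rho> \<in> cone R\<^sub>0" and [measurable]: "Measurable.pred M P"
  shows "(\<integral>z. of_bool (P z) * \<rho> z \<partial>M) \<le> exp R\<^sub>0 * integral\<^sup>L M \<rho> * prob {z \<in> space M. P z}"
proof -
  have "(\<integral>z. of_bool (P z) * \<rho> z \<partial>M) \<le> (\<integral>z. (exp R\<^sub>0 * integral\<^sup>L M \<rho>) * indicator {z \<in> space M. P z} z \<partial>M)"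
  proof (rule integral_mono[OF integrable_of_bool[OF \<rho>]])
    show "integrable M (\<lambda>z. (exp R\<^sub>0 * integral\<^sup>L M \<rho>) * indicator {z \<in> space M. P z} z)"
      by (intro integrable_mult_right integrable_real_indicator) (auto simp: emeasure_eq_measure)
    fix z assume "z \<in> space M"
    then show "of_bool (P z) * \<rho> z \<le> (exp R\<^sub>0 * integral\<^sup>L M \<rho>) * indicator {z \<in> space M. P z} z"
      using cone_le_integral(1)[OF \<rho> less_imp_le[OF R_bounds(1)], of z] by (auto simp: indicator_def)
  qed auto
  then show ?thesis by simp
qed

lemma sum_mass:
  assumes \<rho>: "\<rho> \<in> cone R\<^sub>0" and "finite I"
  shows "(\<Sum>k\<in>I. mass k \<rho>) = (\<integral>z. of_bool (\<phi> z \<in> I) * \<rho> z \<partial>M)"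
proof -
  have "(\<Sum>k\<in>I. mass k \<rho>) = (\<integral>z. (\<Sum>k\<in>I. of_bool (\<phi> z = k) * \<rho> z) \<partial>M)"
    unfolding mass_def by (rule Bochner_Integration.integral_sum[symmetric]) (intro integrable_of_bool[OF \<rho>], measurable)
  also have "\<dots> = (\<integral>z. of_bool (\<phi> z \<in> I) * \<rho> z \<partial>M)"
    using assms(2) by (intro Bochner_Integration.integral_cong refl)
      (simp add: of_bool_def if_distrib[of "\<lambda>x. x * _"] cong: if_cong)
  finally show ?thesis .
qed

lemma integral_of_bool_mono:
  assumes \<rho>: "\<rho> \<in> cone R\<^sub>0" and m: "Measurable.pred M P" "Measurable.pred M Q"
    and "\<And>z. z \<in> space M \<Longrightarrow> P z \<Longrightarrow> Q z"
  shows "(\<integral>z. of_bool (P z) * \<rho> z \<partial>M) \<le> (\<integral>z. of_bool (Q z) * \<rho> z \<partial>M)"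
  by (rule integral_mono[OF integrable_of_bool[OF \<rho> m(1)] integrable_of_bool[OF \<rho> m(2)]])
    (use assms(4) coneD(2)[OF \<rho>] in auto)

lemma sum_mass_le: "\<rho> \<in> cone R\<^sub>0 \<Longrightarrow> finite I \<Longrightarrow> (\<Sum>k\<in>I. mass k \<rho>) \<le> integral\<^sup>L M \<rho>"
  using integral_of_bool_mono[of \<rho> "\<lambda>z. \<phi> z \<in> I" "\<lambda>_. True"] by (simp add: sum_mass)

lemma late_nonneg: "\<rho> \<in> cone R\<^sub>0 \<Longrightarrow> 0 \<le> late k \<rho>"
  unfolding late_def by (intro integral_nonneg_AE AE_I2) (auto dest: coneD)

lemma sum_mass_le_late:
  assumes "\<rho> \<in> cone R\<^sub>0" "finite I" "\<And>k. k \<in> I \<Longrightarrow> n < k"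
  shows "(\<Sum>k\<in>I. mass k \<rho>) \<le> late n \<rho>"
  unfolding late_def sum_mass[OF assms(1,2)]
  by (rule integral_of_bool_mono[OF assms(1)]) (use assms(3) in auto)

lemma late_add_sum_mass:
  assumes \<rho>: "\<rho> \<in> cone R\<^sub>0"
  shows "integral\<^sup>L M \<rho> = late n \<rho> + (\<Sum>k=1..n. mass k \<rho>)"
proof -
  have "(\<Sum>k=1..n. mass k \<rho>) = (\<integral>z. of_bool (\<phi> z \<in> {1..n}) * \<rho> z \<partial>M)" by (rule sum_mass[OF \<rho>]) auto
  then have "late n \<rho> + (\<Sum>k=1..n. mass k \<rho>) = (\<integral>z. of_bool (n < \<phi> z) * \<rho> z + of_bool (\<phi> z \<in> {1..n}) * \<rho> z \<partial>M)"
    unfolding late_def by (subst Bochner_Integration.integral_add) (auto intro!: integrable_of_bool[OF \<rho>])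
  also have "\<dots> = integral\<^sup>L M \<rho>"
    using \<phi>_pos by (intro Bochner_Integration.integral_cong refl) (auto simp: Suc_le_eq)
  finally show ?thesis by simp
qed

lemma A_nonneg: "0 \<le> A"
  using order_trans[OF measure_nonneg tail[of 0]] by simp

lemma late_le:
  assumes "\<rho> \<in> cone R\<^sub>0" shows "late n \<rho> \<le> exp R\<^sub>0 * A * decay \<beta> n * integral\<^sup>L M \<rho>"
proof -
  have "late n \<rho> \<le> exp R\<^sub>0 * integral\<^sup>L M \<rho> * prob {z \<in> space M. n < \<phi> z}"
    unfolding late_def by (rule integral_of_bool_le[OF assms]) measurable
  also have "\<dots> \<le> exp R\<^sub>0 * integral\<^sup>L M \<rho> * (A * decay \<beta> n)"
    using cone_integral_nonneg[OF assms] by (intro mult_left_mono tail) auto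
  finally show ?thesis by (simp add: mult_ac)
qed

text \<open>The number of steps in \<open>V\<close> is subgeometric, so a polynomial tail of \<open>\<phi>\<close> passes to \<open>V\<close>.\<close>

lemma defective_return_decay:
  assumes V: "\<And>n \<rho>. \<rho> \<in> cone R\<^sub>0 \<Longrightarrow> V n \<rho> \<le> integral\<^sup>L M \<rho>"
    and rec: "\<And>n \<rho>. \<rho> \<in> cone R\<^sub>0 \<Longrightarrow> V n \<rho> \<le> late n \<rho> + (\<Sum>k=1..n. V (n - k) (D k \<rho>))"
    and D: "\<And>k \<rho>. \<rho> \<in> cone R\<^sub>0 \<Longrightarrow> D k \<rho> \<in> cone R\<^sub>0"
      "\<And>k \<rho>. \<rho> \<in> cone R\<^sub>0 \<Longrightarrow> integral\<^sup>L M (D k \<rho>) \<le> \<kappa> * mass k \<rho>"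
    and \<kappa>: "0 \<le> \<kappa>" "\<kappa> < 1"
  shows "\<exists>C\<ge>0. \<forall>n. \<forall>\<rho>\<in>cone R\<^sub>0. V n \<rho> \<le> C * decay \<beta> n * integral\<^sup>L M \<rho>"
proof -
  have "0 < \<beta>" using \<beta> by simp
  obtain x where x: "1 < x" "\<kappa> * x powr \<beta> < 1" by (rule exists_scale_less_1[OF \<kappa> \<open>0 < \<beta>\<close>])
  define y where "y = (2 * (x / (x - 1))) powr \<beta>"
  define E where "E = exp R\<^sub>0 * A * (1 + y)"
  define C where "C = E / (1 - \<kappa> * x powr \<beta>)"
  have y: "0 \<le> y" and E: "0 \<le> E" using A_nonneg by (auto simp: y_def E_def)
  have C: "0 \<le> C" "E + \<kappa> * x powr \<beta> * C = C" using E x by (auto simp: C_def field_simps)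
  have "V n \<rho> \<le> C * decay \<beta> n * integral\<^sup>L M \<rho>" if "\<rho> \<in> cone R\<^sub>0" for n \<rho>
    using that
  proof (induction n arbitrary: \<rho> rule: less_induct)
    case (less n)
    note \<rho> = less.prems
    let ?I = "integral\<^sup>L M \<rho>"
    have I: "0 \<le> ?I" by (rule cone_integral_nonneg[OF \<rho>])
    \<comment> \<open>For these \<open>k\<close> the remaining time \<open>n - k\<close> is too
      short for its weight to be comparable with the weight at \<open>n\<close> up to the constant
      \<open>x powr \<beta>\<close>.\<close>
    define bad where "bad = {k \<in> {1..n}. \<not> real (Suc n) \<le> x * real (Suc (n - k))}"
    have "finite bad" by (simp add: bad_def)
    have 1: "V (n - k) (D k \<rho>) \<le> \<kappa> * x powr \<beta> * C * decay \<beta> n * mass k \<rho> + of_bool (k \<in> bad) * mass k \<rho>"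
      if k: "k \<in> {1..n}" for k
    proof (cases "k \<in> bad")
      case True
      have "V (n - k) (D k \<rho>) \<le> integral\<^sup>L M (D k \<rho>)" by (rule V[OF D(1)[OF \<rho>]])
      also have "\<dots> \<le> \<kappa> * mass k \<rho>" by (rule D(2)[OF \<rho>])
      also have "\<dots> \<le> 1 * mass k \<rho>" using \<kappa> mass_nonneg[OF \<rho>] by (intro mult_right_mono) auto
      finally show ?thesis using True C(1) \<kappa> mass_nonneg[OF \<rho>, of k] by (simp add: add_increasing)
    next
      case False
      then have "real (Suc n) \<le> x * real (Suc (n - k))" using k by (simp add: bad_def)
      then have dk: "decay \<beta> (n - k) \<le> x powr \<beta> * decay \<beta> n" using x \<beta> by (intro decay_scale) auto
      have "V (n - k) (D k \<rho>) \<le> C * decay \<beta> (n - k) * integral\<^sup>L M (D k \<rho>)"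
        using k by (intro less.IH D(1)[OF \<rho>]) auto
      also have "\<dots> \<le> C * (x powr \<beta> * decay \<beta> n) * (\<kappa> * mass k \<rho>)"
        using C(1) dk D(2)[OF \<rho>] cone_integral_nonneg[OF D(1)[OF \<rho>]]
        by (intro mult_mono) auto
      finally show ?thesis using False by (simp add: mult_ac)
    qed
    \<comment> \<open>All bad \<open>k\<close> lie beyond a fixed fraction of \<open>n\<close>, so
      their masses together are at most one tail. Estimating them one by one and summing would lose
      a power.\<close>
    have "(\<Sum>k\<in>bad. mass k \<rho>) \<le> exp R\<^sub>0 * A * y * decay \<beta> n * ?I"
    proof (cases "bad = {}")
      case True
      then show ?thesis using A_nonneg y I by simp
    next
      case False
      define m where "m = Min bad - 1"
      have Min: "Min bad \<in> bad" using False \<open>finite bad\<close> by simp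
      then have "1 \<le> Min bad" "Min bad \<le> n" and b: "x * real (Suc (n - Min bad)) < real (Suc n)"
        by (auto simp: bad_def)
      then have m: "Min bad = Suc m" "Suc m \<le> n" by (auto simp: m_def)
      have "m < k" if "k \<in> bad" for k using Min_le[OF \<open>finite bad\<close> that] m by simp
      then have "(\<Sum>k\<in>bad. mass k \<rho>) \<le> late m \<rho>" by (rule sum_mass_le_late[OF \<rho> \<open>finite bad\<close>])
      also have "\<dots> \<le> exp R\<^sub>0 * A * decay \<beta> m * ?I" by (rule late_le[OF \<rho>])
      also have "\<dots> \<le> exp R\<^sub>0 * A * (y * decay \<beta> n) * ?I"
      proof -
        have "x * (real n - real m) < real n + 1" using b m by (simp add: of_nat_diff algebra_simps)
        then have "(x - 1) * (real n + 1) \<le> x * (real m + 1) + x * 1" using x by (simp add: algebra_simps)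
        also have "\<dots> \<le> x * (real m + 1) + x * (real m + 1)" using x by (intro add_left_mono mult_left_mono) auto
        finally have "real (Suc n) \<le> 2 * (x / (x - 1)) * real (Suc m)" using x by (simp add: field_simps)
        then have "decay \<beta> m \<le> y * decay \<beta> n" unfolding y_def using x \<beta> by (intro decay_scale) auto
        then show ?thesis using A_nonneg I by (intro mult_right_mono mult_left_mono) auto
      qed
      finally show ?thesis by (simp add: mult_ac)
    qed
    moreover have "(\<Sum>k=1..n. of_bool (k \<in> bad) * mass k \<rho>) = (\<Sum>k\<in>bad. mass k \<rho>)"
      by (rule sum.mono_neutral_cong_right) (auto simp: bad_def)
    moreover have "(\<Sum>k=1..n. \<kappa> * x powr \<beta> * C * decay \<beta> n * mass k \<rho>) \<le> \<kappa> * x powr \<beta> * C * decay \<beta> n * ?I"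
      unfolding sum_distrib_left[symmetric] using C \<kappa> by (intro mult_left_mono sum_mass_le[OF \<rho>]) auto
    moreover have "(\<Sum>k=1..n. V (n - k) (D k \<rho>)) \<le>
        (\<Sum>k=1..n. \<kappa> * x powr \<beta> * C * decay \<beta> n * mass k \<rho>) + (\<Sum>k=1..n. of_bool (k \<in> bad) * mass k \<rho>)"
      unfolding sum.distrib[symmetric] by (rule sum_mono[OF 1])
    ultimately have "(\<Sum>k=1..n. V (n - k) (D k \<rho>)) \<le> \<kappa> * x powr \<beta> * C * decay \<beta> n * ?I + exp R\<^sub>0 * A * y * decay \<beta> n * ?I"
      by linarith
    then have "V n \<rho> \<le> (E + \<kappa> * x powr \<beta> * C) * decay \<beta> n * ?I"
      using rec[OF \<rho>, of n] late_le[OF \<rho>, of n] by (simp add: E_def algebra_simps)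
    then show ?case unfolding C(2) .
  qed
  then show ?thesis using C(1) by blast
qed

lemma ret_first_return:
  assumes \<rho>: "\<rho> \<in> cone R\<^sub>0" and x: "0 \<le> x" "x \<le> 1"
  shows "(\<integral>z. x ^ rt n z * \<rho> z \<partial>M) = late n \<rho> + (\<Sum>k=1..n. \<integral>z. x ^ rt (n - k) z * (x * transfer k \<rho> z) \<partial>M)"
proof -
  have b: "\<bar>x ^ k\<bar> \<le> 1" for k using x by (simp add: power_le_one)
  have b': "\<bar>x * x ^ k\<bar> \<le> 1" for k using b[of "Suc k"] by simp
  have "(\<integral>z. x ^ rt n z * \<rho> z \<partial>M) = (\<integral>z. of_bool (n < \<phi> z) * 1 * \<rho> z \<partial>M) +
     (\<Sum>k=1..n. \<integral>z. (x * x ^ rt (n - k) z) * transfer k \<rho> z \<partial>M)"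
    by (rule first_return_integral[OF \<rho>, where B=1]) (use b b' in \<open>auto simp: ret_less ret_ge not_less\<close>)
  then show ?thesis by (simp add: late_def mult_ac)
qed

lemma ret_integral_le:
  assumes \<rho>: "\<rho> \<in> cone R" and x: "0 \<le> x" "x \<le> 1"
  shows "(\<integral>z. x ^ rt n z * \<rho> z \<partial>M) \<le> integral\<^sup>L M \<rho>"
proof (rule integral_mono)
  show "integrable M (\<lambda>z. x ^ rt n z * \<rho> z)"
    by (rule cone_integrable_mult[OF \<rho>, where B=1]) (use x in \<open>auto simp: power_le_one\<close>)
qed (use x coneD(2)[OF \<rho>] cone_integrable[OF \<rho>] in \<open>auto simp: power_le_one mult_left_le_one_le\<close>)

text \<open>The integrand is small unless there are few returns by time \<open>n\<close>. Every
  return multiplies the mass by \<open>x\<close>, which gives a defective recursion of mass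
  \<open>x\<close>.\<close>

lemma ret_decay:
  assumes x: "0 \<le> x" "x < 1"
  shows "\<exists>C\<ge>0. \<forall>n. \<forall>\<rho>\<in>cone R\<^sub>0. (\<integral>z. x ^ rt n z * \<rho> z \<partial>M) \<le> C * decay \<beta> n * integral\<^sup>L M \<rho>"
proof (rule defective_return_decay[where D="\<lambda>k \<rho> z. x * transfer k \<rho> z" and \<kappa>=x])
  fix \<rho> n k assume \<rho>: "\<rho> \<in> cone R\<^sub>0"
  show "(\<integral>z. x ^ rt n z * \<rho> z \<partial>M) \<le> integral\<^sup>L M \<rho>" by (rule ret_integral_le[OF \<rho>]) (use x in auto)
  show "(\<integral>z. x ^ rt n z * \<rho> z \<partial>M) \<le> late n \<rho> + (\<Sum>k=1..n. \<integral>z. x ^ rt (n - k) z * (x * transfer k \<rho> z) \<partial>M)"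
    using ret_first_return[OF \<rho>] x by simp
  show "(\<lambda>z. x * transfer k \<rho> z) \<in> cone R\<^sub>0" by (intro cone_scale transfer_cone \<rho> x)
  show "(\<integral>z. x * transfer k \<rho> z \<partial>M) \<le> x * mass k \<rho>" by (simp add: integral_transfer[OF \<rho>])
qed (use x in auto)

text \<open>An upper bound in the spirit of Kac's formula, uniform in time: the law on the tower has
  density at most \<open>exp R\<^sub>0 * integral\<^sup>L M \<rho>\<close> with respect to the
  product of \<open>M\<close> with counting measure. The part that has not returned lies on level
  \<open>n\<close>; the part that returns first at time \<open>k\<close> lies on levels up to
  \<open>n - k < n\<close> and is covered by induction.\<close>

lemma X_le_Kac:
  assumes \<rho>: "\<rho> \<in> cone R\<^sub>0" and h: "adm h B" "\<And>p. 0 \<le> h p"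
  shows "X n \<rho> h \<le> exp R\<^sub>0 * integral\<^sup>L M \<rho> * (\<Sum>l\<le>n. \<integral>z. of_bool (l < \<phi> z) * h (z, l) \<partial>M)"
  using \<rho>
proof (induction n arbitrary: \<rho> rule: less_induct)
  case (less n)
  note \<rho> = less.prems
  let ?I = "integral\<^sup>L M \<rho>"
  have I: "0 \<le> ?I" by (rule cone_integral_nonneg[OF \<rho>])
  define a where "a l = (\<integral>z. of_bool (l < \<phi> z) * h (z, l) \<partial>M)" for l
  have a: "0 \<le> a l" for l unfolding a_def by (intro integral_nonneg_AE AE_I2) (auto simp: h)
  have B: "0 \<le> B" by (rule adm_nonneg[OF h(1)])
  have [measurable]: "(\<lambda>z. h (z, l)) \<in> borel_measurable M" for l by (rule admD[OF h(1)])
  have "(\<integral>z. of_bool (n < \<phi> z) * h (z, n) * \<rho> z \<partial>M) \<le> (\<integral>z. exp R\<^sub>0 * ?I * (of_bool (n < \<phi> z) * h (z, n)) \<partial>M)"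
  proof (rule integral_mono)
    show "integrable M (\<lambda>z. of_bool (n < \<phi> z) * h (z, n) * \<rho> z)"
      by (rule cone_integrable_mult[OF \<rho>, where B=B]) (use admD(2)[OF h(1)] B in auto)
    have "integrable M (\<lambda>z. of_bool (n < \<phi> z) * h (z, n))"
      by (rule integrable_const_bound[where B=B]) (use admD(2)[OF h(1)] B in auto)
    then show "integrable M (\<lambda>z. exp R\<^sub>0 * ?I * (of_bool (n < \<phi> z) * h (z, n)))" by simp
    fix z assume "z \<in> space M"
    then have "\<rho> z \<le> exp R\<^sub>0 * ?I" by (intro cone_le_integral(1)[OF \<rho>] less_imp_le R_bounds)
    then have "(of_bool (n < \<phi> z) * h (z, n)) * \<rho> z \<le> (of_bool (n < \<phi> z) * h (z, n)) * (exp R\<^sub>0 * ?I)"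
      by (intro mult_left_mono) (auto simp: h)
    then show "of_bool (n < \<phi> z) * h (z, n) * \<rho> z \<le> exp R\<^sub>0 * ?I * (of_bool (n < \<phi> z) * h (z, n))"
      by (simp add: mult_ac)
  qed
  then have 1: "(\<integral>z. of_bool (n < \<phi> z) * h (z, n) * \<rho> z \<partial>M) \<le> exp R\<^sub>0 * ?I * a n" by (simp add: a_def)
  have "X (n - k) (transfer k \<rho>) h \<le> exp R\<^sub>0 * (\<Sum>l<n. a l) * mass k \<rho>" if k: "k \<in> {1..n}" for k
  proof -
    have "X (n - k) (transfer k \<rho>) h \<le> exp R\<^sub>0 * mass k \<rho> * (\<Sum>l\<le>n - k. a l)"
      using less.IH[of "n - k" "transfer k \<rho>"] k transfer_cone[OF \<rho>] by (simp add: integral_transfer[OF \<rho>] a_def)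
    also have "\<dots> \<le> exp R\<^sub>0 * mass k \<rho> * (\<Sum>l<n. a l)"
      using k a mass_nonneg[OF \<rho>] by (intro mult_left_mono sum_mono2) auto
    finally show ?thesis by (simp add: mult_ac)
  qed
  then have "(\<Sum>k=1..n. X (n - k) (transfer k \<rho>) h) \<le> (\<Sum>k=1..n. exp R\<^sub>0 * (\<Sum>l<n. a l) * mass k \<rho>)"
    by (rule sum_mono)
  also have "\<dots> \<le> exp R\<^sub>0 * (\<Sum>l<n. a l) * ?I"
    unfolding sum_distrib_left[symmetric]
    by (intro mult_left_mono sum_mass_le[OF \<rho>] mult_nonneg_nonneg sum_nonneg a) auto
  finally have "X n \<rho> h \<le> exp R\<^sub>0 * ?I * (a n + (\<Sum>l<n. a l))"
    using X_first_return[OF \<rho> h(1), of n] 1 by (simp add: algebra_simps)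
  also have "a n + (\<Sum>l<n. a l) = (\<Sum>l\<le>n. a l)" by (simp add: lessThan_Suc_atMost[symmetric])
  finally show ?case by (simp add: a_def)
qed

lemma one_cone: "(\<lambda>_. 1) \<in> cone R\<^sub>0"
  using R_bounds by (intro cone_const) auto

text \<open>At time \<open>t\<close> the orbit is on some level \<open>l\<close>, with weights
  controlled by \<open>X_le_Kac\<close>. Few returns follow either because the column is higher than
  \<open>l + u\<close>, or because at least \<open>u\<close> units of time after its top contain few
  returns, where \<open>u\<close> is half of \<open>m\<close>. Summing the tails
  \<open>decay \<beta> (l + u)\<close> over \<open>l\<close>, the case of a window inside a long
  excursion, loses one power; the second case does not.\<close>

lemma window_decay:
  assumes x: "0 \<le> x" "x < 1"
  shows "\<exists>C\<ge>0. \<forall>t m. (\<integral>z. x ^ (rt (t + m) z - rt t z) \<partial>M) \<le> C * decay (\<beta> - 1) m"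
proof -
  obtain C where C: "0 \<le> C" "\<And>n \<rho>. \<rho> \<in> cone R\<^sub>0 \<Longrightarrow> (\<integral>z. x ^ rt n z * \<rho> z \<partial>M) \<le> C * decay \<beta> n * integral\<^sup>L M \<rho>"
    using ret_decay[OF x] by blast
  obtain D where D: "0 < D" "\<And>N L. (\<Sum>n\<in>{N..<L}. decay \<beta> n) \<le> D * decay (\<beta> - 1) N"
    using sum_decay_tail[OF \<beta>] by blast
  let ?S = "suminf (decay \<beta>)" and ?A = "exp R\<^sub>0 * A"
  have S0: "0 \<le> ?S" by (intro suminf_nonneg summable_decay \<beta>) auto
  have A0: "0 \<le> ?A" using A_nonneg by simp
  define C' where "C' = exp R\<^sub>0 * (?A * (2 * D + C * ?S)) * 2 powr (\<beta> - 1)"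
  have x1: "\<bar>x ^ k\<bar> \<le> 1" for k using x by (simp add: power_le_one)
  have "(\<integral>z. x ^ (rt (t + m) z - rt t z) \<partial>M) \<le> C' * decay (\<beta> - 1) m" for t m
  proof -
    define u where "u = m div 2"
    define h where "h p = x ^ rt (snd p + m) (fst p)" for p
    have h: "adm h 1" "\<And>p. 0 \<le> h p" using x x1 by (auto simp: adm_def h_def)
    have "(\<integral>z. x ^ (rt (t + m) z - rt t z) \<partial>M) = X t (\<lambda>_. 1) h"
      unfolding X_def h_def using pos_add[of _ t m] by (intro Bochner_Integration.integral_cong refl) simp
    also have "\<dots> \<le> exp R\<^sub>0 * (\<Sum>l\<le>t. \<integral>z. of_bool (l < \<phi> z) * h (z, l) \<partial>M)"
      using X_le_Kac[OF one_cone h, of t] by (simp add: prob_space)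
    also have "(\<Sum>l\<le>t. \<integral>z. of_bool (l < \<phi> z) * h (z, l) \<partial>M) \<le>
        (\<Sum>l\<le>t. ?A * (2 * decay \<beta> (l + u) + C * decay \<beta> u * decay \<beta> l))"
    proof (rule sum_mono)
      fix l
      let ?T = "\<lambda>k. transfer k (\<lambda>_. 1)" and ?m = "\<lambda>k. mass k (\<lambda>_. 1)"
      have "(\<integral>z. (of_bool (l < \<phi> z) * h (z, l)) * 1 \<partial>M) = (\<integral>z. of_bool (l + m < \<phi> z) * 1 * 1 \<partial>M) +
          (\<Sum>k=1..l + m. \<integral>z. (of_bool (l < k) * (x * x ^ rt (l + m - k) z)) * ?T k z \<partial>M)"
      proof (rule first_return_integral[OF one_cone, where B=1])
        fix k z show "\<bar>of_bool (l < k) * (x * x ^ rt (l + m - k) z)\<bar> \<le> 1"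
          using x1[of "Suc (rt (l + m - k) z)"] by (cases "l < k") auto
      qed (auto simp: h_def ret_less ret_ge not_less)
      also have "(\<integral>z. of_bool (l + m < \<phi> z) * 1 * 1 \<partial>M) = late (l + m) (\<lambda>_. 1)" by (simp add: late_def)
      also have "\<dots> \<le> ?A * decay \<beta> (l + m)" using late_le[OF one_cone, of "l + m"] by (simp add: prob_space)
      also have "\<dots> \<le> ?A * decay \<beta> (l + u)" using A0 \<beta> by (intro mult_left_mono decay_antimono) (auto simp: u_def)
      also have "(\<Sum>k=1..l + m. \<integral>z. (of_bool (l < k) * (x * x ^ rt (l + m - k) z)) * ?T k z \<partial>M) \<le>
          (\<Sum>k=1..l + m. C * decay \<beta> u * (of_bool (l < k) * ?m k) + of_bool (l + u < k) * ?m k)"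
      proof (rule sum_mono)
        fix k assume k: "k \<in> {1..l + m}"
        let ?J = "\<integral>z. x ^ rt (l + m - k) z * ?T k z \<partial>M"
        have mk: "0 \<le> ?m k" by (rule mass_nonneg[OF one_cone])
        have J: "?J \<le> ?m k" "?J \<le> C * decay \<beta> (l + m - k) * ?m k"
          using ret_integral_le[OF transfer_cone[OF one_cone], of x "l + m - k" k] x
            C(2)[OF transfer_cone[OF one_cone], of "l + m - k" k] by (auto simp: integral_transfer[OF one_cone])
        have J0: "0 \<le> ?J" using x coneD(2)[OF transfer_cone[OF one_cone]] by (intro integral_nonneg_AE AE_I2) auto
        have "(\<integral>z. (of_bool (l < k) * (x * x ^ rt (l + m - k) z)) * ?T k z \<partial>M) = of_bool (l < k) * x * ?J"
          by (simp add: mult.assoc)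
        also have "\<dots> \<le> of_bool (l < k) * 1 * ?J" using x J0 by (intro mult_right_mono mult_left_mono) auto
        also have "\<dots> \<le> C * decay \<beta> u * (of_bool (l < k) * ?m k) + of_bool (l + u < k) * ?m k"
        proof (cases "l < k \<and> k \<le> l + u")
          case True
          then have "u \<le> l + m - k" unfolding u_def by presburger
          then have "C * decay \<beta> (l + m - k) * ?m k \<le> C * decay \<beta> u * ?m k"
            using C(1) mk \<beta> by (intro mult_right_mono mult_left_mono decay_antimono) auto
          then show ?thesis using True J(2) by simp
        next
          case False
          have "0 \<le> C * decay \<beta> u * ?m k" using C(1) mk by simp
          then show ?thesis using False J(1) mk by (cases "l < k") auto
        qed
        finally show "(\<integral>z. (of_bool (l < k) * (x * x ^ rt (l + m - k) z)) * ?T k z \<partial>M) \<le>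
          C * decay \<beta> u * (of_bool (l < k) * ?m k) + of_bool (l + u < k) * ?m k" .
      qed
      also have "\<dots> = C * decay \<beta> u * (\<Sum>k\<in>{l<..l + m}. ?m k) + (\<Sum>k\<in>{l + u<..l + m}. ?m k)"
      proof -
        have "(\<Sum>k=1..l + m. of_bool (j < k) * ?m k) = (\<Sum>k\<in>{j<..l + m}. ?m k)" for j
          by (rule sum.mono_neutral_cong_right) auto
        then show ?thesis by (simp add: sum.distrib flip: sum_distrib_left)
      qed
      also have "\<dots> \<le> C * decay \<beta> u * (?A * decay \<beta> l) + ?A * decay \<beta> (l + u)"
      proof -
        have "(\<Sum>k\<in>{j<..l + m}. ?m k) \<le> ?A * decay \<beta> j" for j
          using sum_mass_le_late[OF one_cone, of "{j<..l + m}" j] late_le[OF one_cone, of j] by (simp add: prob_space)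
        then show ?thesis using C(1) by (intro add_mono mult_left_mono) auto
      qed
      finally show "(\<integral>z. of_bool (l < \<phi> z) * h (z, l) \<partial>M) \<le> ?A * (2 * decay \<beta> (l + u) + C * decay \<beta> u * decay \<beta> l)"
        by (simp add: algebra_simps)
    qed
    also have "\<dots> = ?A * (2 * (\<Sum>l\<le>t. decay \<beta> (l + u)) + C * decay \<beta> u * (\<Sum>l\<le>t. decay \<beta> l))"
      by (simp only: sum_distrib_left[symmetric] sum.distrib)
    also have "\<dots> \<le> ?A * (2 * (D * decay (\<beta> - 1) u) + C * decay (\<beta> - 1) u * ?S)"
    proof (intro mult_left_mono add_mono mult_mono A0 sum_decay_le \<beta> decay_mono_exponent)
      have "(\<Sum>l\<le>t. decay \<beta> (l + u)) = (\<Sum>l\<in>{u..<u + Suc t}. decay \<beta> l)"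
        by (rule sum.reindex_bij_witness[of _ "\<lambda>i. i - u" "\<lambda>i. i + u"]) auto
      then show "(\<Sum>l\<le>t. decay \<beta> (l + u)) \<le> D * decay (\<beta> - 1) u" using D(2)[of u "u + Suc t"] by simp
    qed (use C in \<open>auto intro: sum_nonneg\<close>)
    also have "\<dots> = ?A * (2 * D + C * ?S) * decay (\<beta> - 1) u" by (simp add: algebra_simps)
    also have "\<dots> \<le> ?A * (2 * D + C * ?S) * (2 powr (\<beta> - 1) * decay (\<beta> - 1) m)"
      using A0 D C S0 \<beta> by (intro mult_left_mono decay_scale) (auto simp: u_def)
    finally show ?thesis by (simp add: C'_def mult_ac)
  qed
  moreover have "0 \<le> C'" using A0 D C S0 by (simp add: C'_def)
  ultimately show ?thesis by blast
qed

subsection \<open>Regeneration\<close>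

text \<open>Each return regenerates, i.e. restarts from the density \<open>1\<close>, a fraction \<open>c\<close> of the mass, while
  \<^const>\<open>drop\<close> carries the rest; \<open>q n \<rho>\<close> is the mass that regenerates first at time \<open>n\<close>.\<close>

fun q :: "nat \<Rightarrow> ('b \<Rightarrow> real) \<Rightarrow> real" where
  "q n \<rho> = c * mass n \<rho> + (\<Sum>k\<in>{1..<n}. q (n - k) (drop k \<rho>))"

declare q.simps [simp del]

definition Q :: "nat \<Rightarrow> ('b \<Rightarrow> real) \<Rightarrow> real" where
  "Q n \<rho> = integral\<^sup>L M \<rho> - (\<Sum>k\<le>n. q k \<rho>)"

lemma mass_0: "mass 0 \<rho> = 0"
proof -
  have "mass 0 \<rho> = (\<integral>z. 0 \<partial>M)"
    unfolding mass_def using \<phi>_pos by (intro Bochner_Integration.integral_cong) auto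
  then show ?thesis by simp
qed

lemma q_0: "q 0 \<rho> = 0"
  by (subst q.simps) (simp add: mass_0)

text \<open>The recursive definition needs \<open>k < n\<close> for termination. The extra term is
  \<open>q 0 = 0\<close>, and with it the sum ranges over the same \<open>k\<close> as the
  first-return identities.\<close>

lemma q_rec: "q n \<rho> = c * mass n \<rho> + (\<Sum>k=1..n. q (n - k) (drop k \<rho>))"
proof -
  have "(\<Sum>k=1..n. q (n - k) (drop k \<rho>)) = (\<Sum>k\<in>{1..<n}. q (n - k) (drop k \<rho>))"
  proof (rule sum.mono_neutral_right)
    show "\<forall>k\<in>{1..n} - {1..<n}. q (n - k) (drop k \<rho>) = 0"
    proof
      fix k assume "k \<in> {1..n} - {1..<n}"
      then have "k = n" by auto
      then show "q (n - k) (drop k \<rho>) = 0" by (simp add: q_0)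
    qed
  qed auto
  then show ?thesis by (simp add: q.simps[of n])
qed

lemma q_nonneg: "\<rho> \<in> cone R\<^sub>0 \<Longrightarrow> 0 \<le> q n \<rho>"
proof (induction n arbitrary: \<rho> rule: less_induct)
  case (less n)
  then show ?case
    unfolding q.simps[of n] using c_bounds
    by (intro add_nonneg_nonneg mult_nonneg_nonneg mass_nonneg sum_nonneg less.IH drop_cone) auto
qed

text \<open>Mass that has not regenerated has either not returned, or it has returned and belongs to
  the share \<open>1 - c\<close> kept by \<open>drop\<close>.\<close>

lemma Q_rec:
  assumes \<rho>: "\<rho> \<in> cone R\<^sub>0"
  shows "Q n \<rho> = late n \<rho> + (\<Sum>k=1..n. Q (n - k) (drop k \<rho>))"
proof -
  have "(\<Sum>j\<le>n. q j \<rho>) = (\<Sum>j\<le>n. c * mass j \<rho> + (\<Sum>k=1..j. q (j - k) (drop k \<rho>)))"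
    by (intro sum.cong refl q_rec)
  also have "\<dots> = c * (\<Sum>j\<le>n. mass j \<rho>) + (\<Sum>k=1..n. \<Sum>i\<le>n - k. q i (drop k \<rho>))"
    unfolding sum.distrib sum_swap_conv[of "\<lambda>k i. q i (drop k \<rho>)"] sum_distrib_left ..
  also have "(\<Sum>j\<le>n. mass j \<rho>) = (\<Sum>j=1..n. mass j \<rho>)"
    by (rule sum.mono_neutral_right) (auto simp: mass_0 not_less_eq_eq)
  finally have 1: "(\<Sum>j\<le>n. q j \<rho>) = c * (\<Sum>j=1..n. mass j \<rho>) + (\<Sum>k=1..n. \<Sum>i\<le>n - k. q i (drop k \<rho>))" .
  have "(\<Sum>k=1..n. Q (n - k) (drop k \<rho>)) = (1 - c) * (\<Sum>k=1..n. mass k \<rho>) - (\<Sum>k=1..n. \<Sum>i\<le>n - k. q i (drop k \<rho>))"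
    by (simp add: Q_def integral_drop[OF \<rho>] sum_subtractf sum_distrib_left)
  then show ?thesis
    unfolding Q_def[of n] 1 late_add_sum_mass[OF \<rho>, of n] by (simp add: algebra_simps)
qed

lemma Q_nonneg: "\<rho> \<in> cone R\<^sub>0 \<Longrightarrow> 0 \<le> Q n \<rho>"
proof (induction n arbitrary: \<rho> rule: less_induct)
  case (less n)
  then show ?case
    unfolding Q_rec[OF less.prems]
    by (intro add_nonneg_nonneg late_nonneg sum_nonneg less.IH drop_cone) auto
qed

lemma Q_le: "\<rho> \<in> cone R\<^sub>0 \<Longrightarrow> Q n \<rho> \<le> integral\<^sup>L M \<rho>"
  unfolding Q_def using q_nonneg by (simp add: sum_nonneg)

lemma Q_decay: "\<exists>C\<ge>0. \<forall>n. \<forall>\<rho>\<in>cone R\<^sub>0. Q n \<rho> \<le> C * decay \<beta> n * integral\<^sup>L M \<rho>"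
proof (rule defective_return_decay[where D=drop and \<kappa>="1 - c"])
  fix \<rho> n k assume \<rho>: "\<rho> \<in> cone R\<^sub>0"
  show "Q n \<rho> \<le> late n \<rho> + (\<Sum>k=1..n. Q (n - k) (drop k \<rho>))" by (simp only: Q_rec[OF \<rho>] order_refl)
  show "integral\<^sup>L M (drop k \<rho>) \<le> (1 - c) * mass k \<rho>" by (simp add: integral_drop[OF \<rho>])
qed (use c_bounds in \<open>auto intro: Q_le drop_cone\<close>)

text \<open>The constant split off at a return evolves like the density 1, whatever \<rho> was; here
  the past is forgotten.\<close>

lemma X_transfer:
  assumes \<rho>: "\<rho> \<in> cone R\<^sub>0" and h: "adm h B"
  shows "X m (transfer k \<rho>) h = c * mass k \<rho> * X m (\<lambda>_. 1) h + X m (drop k \<rho>) h"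
proof -
  have int: "integrable M (\<lambda>z. h (pos m z) * r z)" if "r \<in> cone R\<^sub>0" for r
    by (rule cone_integrable_mult[OF that measurable_pos[OF h] admD(2)[OF h]])
  have "X m (transfer k \<rho>) h = (\<integral>z. h (pos m z) * drop k \<rho> z + c * mass k \<rho> * (h (pos m z) * 1) \<partial>M)"
    unfolding X_def
    by (intro Bochner_Integration.integral_cong refl)
      (simp add: drop_def integral_transfer[OF \<rho>] algebra_simps)
  also have "\<dots> = X m (drop k \<rho>) h + c * mass k \<rho> * X m (\<lambda>_. 1) h"
    unfolding X_def using int[OF drop_cone[OF \<rho>]] int[OF one_cone]
    by (subst Bochner_Integration.integral_add) auto
  finally show ?thesis by simp
qed

lemma X_le: 
  assumes \<rho>: "\<rho> \<in> cone R\<^sub>0" and h: "adm h B" shows "\<bar>X n \<rho> h\<bar> \<le> B * integral\<^sup>L M \<rho>"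
proof -
  have "\<bar>X n \<rho> h\<bar> \<le> (\<integral>z. \<bar>h (pos n z) * \<rho> z\<bar> \<partial>M)" unfolding X_def by (rule integral_abs_bound)
  also have "\<dots> \<le> (\<integral>z. B * \<rho> z \<partial>M)"
  proof (rule integral_mono)
    show "integrable M (\<lambda>z. \<bar>h (pos n z) * \<rho> z\<bar>)"
      by (intro integrable_abs cone_integrable_mult[OF \<rho> measurable_pos[OF h] admD(2)[OF h]])
    show "integrable M (\<lambda>z. B * \<rho> z)" using cone_integrable[OF \<rho>] by simp
    fix z assume "z \<in> space M"
    then show "\<bar>h (pos n z) * \<rho> z\<bar> \<le> B * \<rho> z"
      using admD(2)[OF h, of "pos n z"] coneD(2)[OF \<rho>] by (auto simp: abs_mult intro!: mult_right_mono)
  qed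
  finally show ?thesis by simp
qed

text \<open>Up to time \<open>n\<close> all regenerated mass evolves from the density 1 at its time
  of regeneration. The error satisfies the recursion \<open>Q_rec\<close> with forcing term at most
  \<open>B * late n \<rho>\<close>, so it is bounded by \<open>B\<close> times the mass that has not
  regenerated.\<close>

lemma X_renewal:
  assumes h: "adm h B"
  shows "\<rho> \<in> cone R\<^sub>0 \<Longrightarrow> \<bar>X n \<rho> h - (\<Sum>k\<le>n. q k \<rho> * X (n - k) (\<lambda>_. 1) h)\<bar> \<le> B * Q n \<rho>"
proof (induction n arbitrary: \<rho> rule: less_induct)
  case (less n)
  note \<rho> = less.prems
  let ?x = "\<lambda>m. X m (\<lambda>_. 1) h"
  let ?e = "\<lambda>n \<rho>. X n \<rho> h - (\<Sum>k\<le>n. q k \<rho> * ?x (n - k))"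
  let ?T = "\<integral>z. of_bool (n < \<phi> z) * h (z, n) * \<rho> z \<partial>M"
  have B: "0 \<le> B" by (rule adm_nonneg[OF h])
  have "(\<Sum>j\<le>n. q j \<rho> * ?x (n - j)) =
      (\<Sum>j\<le>n. c * mass j \<rho> * ?x (n - j) + (\<Sum>k=1..j. q (j - k) (drop k \<rho>) * ?x (n - k - (j - k))))"
  proof (rule sum.cong[OF refl])
    fix j assume "j \<in> {..n}"
    have "(\<Sum>k=1..j. q (j - k) (drop k \<rho>)) * ?x (n - j) = (\<Sum>k=1..j. q (j - k) (drop k \<rho>) * ?x (n - k - (j - k)))"
      unfolding sum_distrib_right by (intro sum.cong refl) auto
    then show "q j \<rho> * ?x (n - j) = c * mass j \<rho> * ?x (n - j) + (\<Sum>k=1..j. q (j - k) (drop k \<rho>) * ?x (n - k - (j - k)))"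
      by (simp add: q_rec[of j] algebra_simps)
  qed
  also have "\<dots> = (\<Sum>j\<le>n. c * mass j \<rho> * ?x (n - j)) + (\<Sum>k=1..n. \<Sum>i\<le>n - k. q i (drop k \<rho>) * ?x (n - k - i))"
    unfolding sum.distrib sum_swap_conv[of "\<lambda>k i. q i (drop k \<rho>) * ?x (n - k - i)"] ..
  also have "(\<Sum>j\<le>n. c * mass j \<rho> * ?x (n - j)) = (\<Sum>j=1..n. c * mass j \<rho> * ?x (n - j))"
    by (rule sum.mono_neutral_right) (auto simp: mass_0 not_less_eq_eq)
  finally have S: "(\<Sum>j\<le>n. q j \<rho> * ?x (n - j)) = (\<Sum>k=1..n. c * mass k \<rho> * ?x (n - k)) +
     (\<Sum>k=1..n. \<Sum>i\<le>n - k. q i (drop k \<rho>) * ?x (n - k - i))" .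
  have "X n \<rho> h = ?T + (\<Sum>k=1..n. c * mass k \<rho> * ?x (n - k) + X (n - k) (drop k \<rho>) h)"
    unfolding X_first_return[OF \<rho> h, of n] X_transfer[OF \<rho> h] ..
  then have e_eq: "?e n \<rho> = ?T + (\<Sum>k=1..n. ?e (n - k) (drop k \<rho>))"
    unfolding S by (simp add: sum.distrib sum_subtractf)
  have b1: "\<bar>?e n \<rho>\<bar> \<le> \<bar>?T\<bar> + (\<Sum>k=1..n. \<bar>?e (n - k) (drop k \<rho>)\<bar>)"
    unfolding e_eq by (rule order_trans[OF abs_triangle_ineq]) (intro add_left_mono sum_abs)
  have b2: "(\<Sum>k=1..n. \<bar>?e (n - k) (drop k \<rho>)\<bar>) \<le> (\<Sum>k=1..n. B * Q (n - k) (drop k \<rho>))"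
  proof (rule sum_mono)
    fix k assume "k \<in> {1..n}"
    then have "n - k < n" by auto
    then show "\<bar>?e (n - k) (drop k \<rho>)\<bar> \<le> B * Q (n - k) (drop k \<rho>)"
      by (rule less.IH[OF _ drop_cone[OF \<rho>]])
  qed
  have b3: "\<bar>?T\<bar> \<le> B * late n \<rho>"
  proof -
    have [measurable]: "(\<lambda>z. h (z, n)) \<in> borel_measurable M" by (rule admD[OF h])
    have "\<bar>?T\<bar> \<le> (\<integral>z. \<bar>of_bool (n < \<phi> z) * h (z, n) * \<rho> z\<bar> \<partial>M)" by (rule integral_abs_bound)
    also have "\<dots> \<le> (\<integral>z. B * (of_bool (n < \<phi> z) * \<rho> z) \<partial>M)"
    proof (rule integral_mono)
      show "integrable M (\<lambda>z. \<bar>of_bool (n < \<phi> z) * h (z, n) * \<rho> z\<bar>)"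
        by (intro integrable_abs cone_integrable_mult[OF \<rho>, where B=B]) (use admD(2)[OF h] B in auto)
      show "integrable M (\<lambda>z. B * (of_bool (n < \<phi> z) * \<rho> z))"
        using integrable_of_bool[OF \<rho>, of "\<lambda>z. n < \<phi> z"] by simp
      fix z assume "z \<in> space M"
      then show "\<bar>of_bool (n < \<phi> z) * h (z, n) * \<rho> z\<bar> \<le> B * (of_bool (n < \<phi> z) * \<rho> z)"
        using admD(2)[OF h] coneD(2)[OF \<rho>] by (auto simp: abs_mult intro!: mult_right_mono)
    qed
    finally show ?thesis by (simp add: late_def)
  qed
  have b4: "B * late n \<rho> + (\<Sum>k=1..n. B * Q (n - k) (drop k \<rho>)) = B * Q n \<rho>"
    unfolding Q_rec[OF \<rho>, of n] by (simp add: sum_distrib_left algebra_simps)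
  show ?case using b1 b2 b3 b4 by linarith
qed

text \<open>On a null cell the positive function \<zeta>, pulled back by the inverse branch, would
  have integral zero. Hence every value taken by the return time is taken with positive
  probability.\<close>

lemma cell_prob_pos:
  assumes a: "a \<in> \<alpha>" shows "0 < prob a"
proof (rule ccontr)
  assume "\<not> 0 < prob a"
  then have "emeasure M a = 0" by (simp add: emeasure_eq_measure not_less measure_le_0_iff)
  let ?\<psi> = "the_inv_into a F" and ?N = "restrict_space M a"
  have aM: "a \<in> sets M" "a \<subseteq> space M" using a partition(3) \<alpha>_subset by auto
  have \<psi> [measurable]: "?\<psi> \<in> M \<rightarrow>\<^sub>M ?N" by (rule inverse_branch_measurable[OF a])
  have sp: "space ?N = a" using aM by (auto simp: space_restrict_space)
  obtain \<zeta> :: "'b \<Rightarrow> real" where \<zeta> [measurable]: "\<zeta> \<in> borel_measurable ?N" and \<zeta>_pos: "\<And>y. y \<in> a \<Longrightarrow> 0 < \<zeta> y"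
    and dens: "?N = density (distr M ?N ?\<psi>) (\<lambda>y. ennreal (\<zeta> y))"
    using distortion[OF a] by blast
  have "0 = emeasure ?N a" using aM \<open>emeasure M a = 0\<close> by (simp add: emeasure_restrict_space)
  also have "\<dots> = emeasure (density (distr M ?N ?\<psi>) (\<lambda>y. ennreal (\<zeta> y))) (space ?N)"
    using arg_cong[OF dens, of "\<lambda>X. emeasure X a"] by (simp add: sp)
  also have "\<dots> = (\<integral>\<^sup>+y. ennreal (\<zeta> y) * indicator (space ?N) y \<partial>distr M ?N ?\<psi>)"
    by (subst emeasure_density) auto
  also have "\<dots> = (\<integral>\<^sup>+u. ennreal (\<zeta> (?\<psi> u)) * indicator (space ?N) (?\<psi> u) \<partial>M)"
    by (subst nn_integral_distr) auto
  also have "\<dots> = (\<integral>\<^sup>+u. ennreal (\<zeta> (?\<psi> u)) \<partial>M)"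
    using measurable_space[OF \<psi>] by (intro nn_integral_cong) (simp add: indicator_def)
  finally have "AE u in M. ennreal (\<zeta> (?\<psi> u)) = 0"
    by (subst (asm) eq_commute, subst (asm) nn_integral_0_iff_AE) auto
  then have "AE u in M. False"
  proof (rule AE_mp[OF _ AE_I2], intro impI)
    fix u assume "u \<in> space M" "ennreal (\<zeta> (?\<psi> u)) = 0"
    then show False using \<zeta>_pos[of "?\<psi> u"] measurable_space[OF \<psi>, of u] by (simp add: sp ennreal_eq_0_iff)
  qed
  then show False by simp
qed

lemma mass_pos:
  assumes z: "z \<in> space M" shows "0 < mass (\<phi> z) (\<lambda>_. 1)"
proof -
  have "mass (\<phi> z) (\<lambda>_. 1) = (\<integral>x. indicator {x \<in> space M. \<phi> x = \<phi> z} x \<partial>M)"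
    unfolding mass_def by (intro Bochner_Integration.integral_cong) (auto simp: indicator_def)
  also have "\<dots> = prob {x \<in> space M. \<phi> x = \<phi> z}" by simp
  also have "\<dots> \<ge> prob (cell z)"
    using \<alpha>_subset[OF cell_mem(1)[OF z]] \<phi>_cell[OF cell_mem(1)[OF z] _ cell_mem(2)[OF z]]
    by (intro finite_measure_mono) auto
  ultimately show ?thesis using cell_prob_pos[OF cell_mem(1)[OF z]] by linarith
qed

definition period :: nat where "period = Gcd (\<phi> ` space M)"

lemma period_dvd: "z \<in> space M \<Longrightarrow> period dvd \<phi> z"
  unfolding period_def by (intro Gcd_dvd) auto

lemma period_pos: "0 < period"
proof -
  obtain z0 where z0: "z0 \<in> space M" using not_empty by auto
  show ?thesis using period_dvd[OF z0] \<phi>_pos[OF z0] by (intro gr0I) auto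
qed

text \<open>Regeneration takes place at returns only. If the period does not divide
  \<open>k\<close>, the function \<open>drop k \<rho>\<close> has integral zero, though it need not
  be the zero function; nonnegativity of \<open>Q\<close> then bounds \<open>q\<close> of it by that
  integral.\<close>

lemma q_eq_0:
  assumes "\<rho> \<in> cone R\<^sub>0" "\<not> period dvd n" shows "q n \<rho> = 0"
  using assms
proof (induction n arbitrary: \<rho> rule: less_induct)
  case (less n)
  have mass0: "mass k r = 0" if "\<not> period dvd k" for k and r :: "'b \<Rightarrow> real"
  proof -
    have "mass k r = (\<integral>z. 0 \<partial>M)"
      unfolding mass_def using period_dvd that by (intro Bochner_Integration.integral_cong) auto
    then show ?thesis by simp
  qed
  have "q (n - k) (drop k \<rho>) = 0" if k: "k \<in> {1..<n}" for k
  proof (cases "period dvd k")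
    case True
    then have "\<not> period dvd n - k" using less.prems(2) k by (auto dest: dvd_diffD)
    then show ?thesis using k by (intro less.IH drop_cone less.prems(1)) auto
  next
    case False
    then have "integral\<^sup>L M (drop k \<rho>) = 0" by (simp add: integral_drop[OF less.prems(1)] mass0)
    moreover have "0 \<le> Q (n - k) (drop k \<rho>)" by (intro Q_nonneg drop_cone less.prems)
    moreover have "q (n - k) (drop k \<rho>) \<le> (\<Sum>i\<le>n - k. q i (drop k \<rho>))"
      by (rule member_le_sum) (auto intro: q_nonneg drop_cone less.prems)
    ultimately show ?thesis using q_nonneg[OF drop_cone[OF less.prems(1)], of "n - k" k] by (simp add: Q_def)
  qed
  then show ?case using mass0[OF less.prems(2)] by (simp add: q.simps[of n])
qed

lemma sum_period:
  assumes f: "\<And>k. \<not> period dvd k \<Longrightarrow> f k = (0::real)" and r: "r < period"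
  shows "(\<Sum>k\<le>r + period * j. f k) = (\<Sum>i\<le>j. f (period * i))"
proof -
  have "(\<Sum>k\<le>r + period * j. f k) = (\<Sum>k\<in>(\<lambda>i. period * i) ` {..j}. f k)"
  proof (rule sum.mono_neutral_right)
    show "\<forall>k\<in>{..r + period * j} - (\<lambda>i. period * i) ` {..j}. f k = 0"
    proof
      fix k assume k: "k \<in> {..r + period * j} - (\<lambda>i. period * i) ` {..j}"
      have "\<not> period dvd k"
      proof
        assume "period dvd k"
        then obtain i where i: "k = period * i" by auto
        then have "period * i < period * Suc j" using k r by auto
        then have "i \<le> j" using mult_less_cancel1[of period i "Suc j"] by simp
        then show False using k i by auto
      qed
      then show "f k = 0" by (rule f)
    qed
    show "(\<lambda>i. period * i) ` {..j} \<subseteq> {..r + period * j}"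
      by (auto intro: trans_le_add2)
  qed auto
  also have "\<dots> = (\<Sum>i\<le>j. f (period * i))"
    using period_pos by (subst sum.reindex) (auto simp: inj_on_def)
  finally show ?thesis .
qed

text \<open>On one residue class modulo the period, the values at times
  \<open>r + period * j\<close> solve a renewal equation on the index \<open>j\<close>, and
  \<open>X_renewal\<close> bounds its forcing term. The inter-arrival law is aperiodic on this
  rescaled lattice, because \<open>q (\<phi> z)\<close> is at least
  \<open>c * mass (\<phi> z)\<close>, which is positive for every \<open>z\<close>.\<close>

lemma X_one_convergence:
  "\<exists>C\<ge>0. \<forall>h B n n'. adm h B \<longrightarrow> n \<le> n' \<longrightarrow> [n = n'] (mod period) \<longrightarrow>
    \<bar>X n' (\<lambda>_. 1) h - X n (\<lambda>_. 1) h\<bar> \<le> C * B * decay (\<beta> - 1) n"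
proof -
  let ?x = "\<lambda>m h. X m (\<lambda>_. 1) h" and ?q = "\<lambda>i. q (period * i) (\<lambda>_. 1)"
  have P: "1 \<le> period" using period_pos by simp
  obtain C where C: "0 \<le> C" "\<And>n. Q n (\<lambda>_. 1) \<le> C * decay \<beta> n"
    using Q_decay one_cone by (fastforce simp: prob_space)
  have b0: "0 \<le> \<beta>" using \<beta> by simp
  have sq: "(\<Sum>i\<le>j. ?q i) = 1 - Q (period * j) (\<lambda>_. 1)" for j
    using sum_period[of "\<lambda>k. q k (\<lambda>_. 1)" 0 j, OF q_eq_0[OF one_cone] period_pos]
    by (simp add: Q_def prob_space)
  have QP: "Q (r + period * j) (\<lambda>_. 1) \<le> C * decay \<beta> j" for r j
  proof -
    have "j \<le> r + period * j" using P by (simp add: trans_le_add2)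
    then show ?thesis using C(1) by (intro order_trans[OF C(2)] mult_left_mono decay_antimono b0) auto
  qed
  have lim0: "(\<lambda>j. C * decay \<beta> j) \<longlonglongrightarrow> 0"
    using tendsto_mult_right[OF summable_LIMSEQ_zero[OF summable_decay[OF \<beta>]], of C] by (simp add: mult.commute)
  have "\<exists>C'>0. \<forall>(y :: nat \<Rightarrow> real) e E. renewal_solution ?q y e \<longrightarrow> (\<forall>j. \<bar>e j\<bar> \<le> E * decay \<beta> j) \<longrightarrow>
      (\<forall>i j. i \<le> j \<longrightarrow> \<bar>y j - y i\<bar> \<le> C' * E * decay (\<beta> - 1) i)"
  proof (rule renewal_convergence[OF \<beta>, where A=C])
    show "0 \<le> ?q k" for k by (rule q_nonneg[OF one_cone])
    show "?q 0 = 0" by (simp add: q_0)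
    \<comment> \<open>All mass regenerates eventually, so the inter-arrival law is not
      defective.\<close>
    have "(\<lambda>j. Q (period * j) (\<lambda>_. 1)) \<longlonglongrightarrow> 0"
      by (rule tendsto_sandwich[OF _ _ tendsto_const lim0])
        (use QP[of 0] Q_nonneg[OF one_cone] in \<open>auto intro: always_eventually\<close>)
    then have "(\<lambda>j. \<Sum>i\<le>j. ?q i) \<longlonglongrightarrow> 1 - 0" unfolding sq by (intro tendsto_diff tendsto_const)
    then show "?q sums 1" by (simp add: sums_def_le)
    show "1 - (\<Sum>k\<le>n. ?q k) \<le> C * decay \<beta> n" for n using QP[of 0 n] by (simp add: sq)
    show "Gcd {k. 0 < ?q k} = 1"
    proof -
      let ?d = "Gcd {k. 0 < ?q k}"
      have "period * ?d dvd \<phi> z" if z: "z \<in> space M" for z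
      proof -
        obtain i where i: "\<phi> z = period * i" using period_dvd[OF z] by auto
        have "0 < c * mass (\<phi> z) (\<lambda>_. 1)" using mass_pos[OF z] c_bounds by simp
        moreover have "0 \<le> (\<Sum>k\<in>{1..<\<phi> z}. q (\<phi> z - k) (drop k (\<lambda>_. 1)))"
          by (intro sum_nonneg q_nonneg drop_cone one_cone)
        ultimately have "0 < q (\<phi> z) (\<lambda>_. 1)" by (simp add: q.simps[of "\<phi> z"])
        then have "?d dvd i" by (intro Gcd_dvd) (simp add: i)
        then show ?thesis by (simp add: i)
      qed
      then have "period * ?d dvd Gcd (\<phi> ` space M)" by (intro Gcd_greatest) auto
      then have "period * ?d dvd period * 1" by (simp add: period_def)
      then show ?thesis using period_pos by (simp only: dvd_times_left_cancel_iff nat_dvd_1_iff_1)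
    qed
  qed
  then obtain C' where C': "0 < C'" "\<And>(y :: nat \<Rightarrow> real) e E i j. renewal_solution ?q y e \<Longrightarrow>
      (\<forall>j. \<bar>e j\<bar> \<le> E * decay \<beta> j) \<Longrightarrow> i \<le> j \<Longrightarrow> \<bar>y j - y i\<bar> \<le> C' * E * decay (\<beta> - 1) i"
    by blast
  have "\<bar>?x n' h - ?x n h\<bar> \<le> (C' * C * real period powr (\<beta> - 1)) * B * decay (\<beta> - 1) n"
    if h: "adm h B" and n: "n \<le> n'" "[n = n'] (mod period)" for h B n n'
  proof -
    define r where "r = n mod period"
    have "r = n' mod period" using n(2) by (simp add: r_def cong_def)
    then have r: "r < period" "n = r + period * (n div period)" "n' = r + period * (n' div period)"
      using period_pos mod_mult_div_eq[of n period] mod_mult_div_eq[of n' period]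
      by (simp_all only: r_def mod_less_divisor)
    have B: "0 \<le> B" by (rule adm_nonneg[OF h])
    let ?y = "\<lambda>j. ?x (r + period * j) h"
    define e where "e j = ?y j - (\<Sum>i=1..j. ?q i * ?y (j - i))" for j
    have e: "\<bar>e j\<bar> \<le> (B * C) * decay \<beta> j" for j
    proof -
      have "(\<Sum>k\<le>r + period * j. q k (\<lambda>_. 1) * ?x (r + period * j - k) h) =
          (\<Sum>i\<le>j. ?q i * ?x (r + period * j - period * i) h)"
        by (rule sum_period[OF _ r(1)]) (simp add: q_eq_0[OF one_cone])
      also have "\<dots> = (\<Sum>i\<le>j. ?q i * ?y (j - i))"
      proof (intro sum.cong refl)
        fix i assume "i \<in> {..j}"
        then have "r + period * j - period * i = r + period * (j - i)"
          by (simp add: diff_mult_distrib2)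
        then show "?q i * ?x (r + period * j - period * i) h = ?q i * ?y (j - i)" by simp
      qed
      also have "\<dots> = (\<Sum>i=1..j. ?q i * ?y (j - i))"
        by (rule sum.mono_neutral_right) (auto simp: q_0 not_less_eq_eq)
      finally have "\<bar>e j\<bar> \<le> B * Q (r + period * j) (\<lambda>_. 1)"
        using X_renewal[OF h one_cone, of "r + period * j"] by (simp add: e_def)
      also have "\<dots> \<le> B * (C * decay \<beta> j)" by (intro mult_left_mono QP B)
      finally show ?thesis by simp
    qed
    have "renewal_solution ?q ?y e" by (simp add: renewal_solution_def e_def)
    moreover have "\<forall>j. \<bar>e j\<bar> \<le> (B * C) * decay \<beta> j" using e by blast
    moreover have "n div period \<le> n' div period" using n(1) by (rule div_le_mono)
    ultimately have "\<bar>?y (n' div period) - ?y (n div period)\<bar> \<le> C' * (B * C) * decay (\<beta> - 1) (n div period)"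
      by (rule C'(2))
    also have "\<dots> \<le> C' * (B * C) * (real period powr (\<beta> - 1) * decay (\<beta> - 1) n)"
    proof (intro mult_left_mono decay_scale)
      have "n + 1 \<le> period * (n div period + 1)" using r by simp
      then show "real (Suc n) \<le> real period * real (Suc (n div period))"
        by (metis Suc_eq_plus1 of_nat_le_iff of_nat_mult)
    qed (use \<beta> period_pos B C C' in auto)
    finally show ?thesis using r by (simp add: mult_ac)
  qed
  moreover have "0 \<le> C' * C * real period powr (\<beta> - 1)" using C C' by simp
  ultimately show ?thesis by blast
qed

text \<open>A general density is replaced by its integral times the density 1 at the moment of
  regeneration. If this happens before time \<open>u\<close>, about half of \<open>n\<close>, the
  remaining time suffices for \<open>X_one_convergence\<close>; the mass that regenerates later or
  not at all is controlled by \<open>Q_decay\<close>. As the bound is linear in the integral, it can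
  be summed over words.\<close>

theorem X_convergence:
  "\<exists>C\<ge>0. \<forall>h B n n'. \<forall>\<rho>\<in>cone R\<^sub>0. adm h B \<longrightarrow> n \<le> n' \<longrightarrow> [n = n'] (mod period) \<longrightarrow>
    \<bar>X n \<rho> h - integral\<^sup>L M \<rho> * X n' (\<lambda>_. 1) h\<bar> \<le> C * B * integral\<^sup>L M \<rho> * decay (\<beta> - 1) n"
proof -
  let ?x = "\<lambda>m h. X m (\<lambda>_. 1) h"
  obtain C where C: "0 \<le> C" "\<And>n \<rho>. \<rho> \<in> cone R\<^sub>0 \<Longrightarrow> Q n \<rho> \<le> C * decay \<beta> n * integral\<^sup>L M \<rho>"
    using Q_decay by blast
  obtain C' where C': "0 \<le> C'" "\<And>h B n n'. adm h B \<Longrightarrow> n \<le> n' \<Longrightarrow> [n = n'] (mod period) \<Longrightarrow>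
    \<bar>?x n' h - ?x n h\<bar> \<le> C' * B * decay (\<beta> - 1) n"
    using X_one_convergence by blast
  \<comment> \<open>Of the four copies of \<open>C\<close>, one is the error in
    \<open>X_renewal\<close>, two come from regeneration after time \<open>u\<close>, where two
    values bounded by \<open>B\<close> are compared, and one from the mass not regenerated by time
    \<open>n\<close>.\<close>
  define D where "D = (C' + 4 * C) * 2 powr (\<beta> - 1)"
  have "\<bar>X n \<rho> h - integral\<^sup>L M \<rho> * ?x n' h\<bar> \<le> D * B * integral\<^sup>L M \<rho> * decay (\<beta> - 1) n"
    if h: "adm h B" and \<rho>: "\<rho> \<in> cone R\<^sub>0" and n: "n \<le> n'" "[n = n'] (mod period)" for h B n n' \<rho>
  proof -
    define u where "u = n div 2"
    let ?I = "integral\<^sup>L M \<rho>" and ?d = "decay (\<beta> - 1) u"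
    have I: "0 \<le> ?I" by (rule cone_integral_nonneg[OF \<rho>])
    have B: "0 \<le> B" by (rule adm_nonneg[OF h])
    have x_le: "\<bar>?x m h\<bar> \<le> B" for m using X_le[OF one_cone h, of m] by (simp add: prob_space)
    have Qd: "Q m \<rho> \<le> C * ?d * ?I" if "u \<le> m" for m
    proof -
      have "decay \<beta> m \<le> decay \<beta> u" using \<beta> that by (intro decay_antimono) auto
      also have "\<dots> \<le> ?d" by (rule decay_mono_exponent) simp
      finally have "C * decay \<beta> m * ?I \<le> C * ?d * ?I" using C(1) I by (intro mult_right_mono mult_left_mono)
      then show ?thesis using C(2)[OF \<rho>, of m] by linarith
    qed
    have un: "u \<le> n" by (simp add: u_def)
    have each: "\<bar>q k \<rho> * (?x (n - k) h - ?x n' h)\<bar> \<le> q k \<rho> * (C' * B * ?d) + of_bool (u < k) * q k \<rho> * (2 * B)"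
      if k: "k \<le> n" for k
    proof -
      have qk: "0 \<le> q k \<rho>" by (rule q_nonneg[OF \<rho>])
      consider "q k \<rho> = 0" | "period dvd k" "k \<le> u" | "u < k" using q_eq_0[OF \<rho>] by force
      then show ?thesis
      proof cases
        case 2
        have "[n - k = n'] (mod period)"
        proof -
          have "[n = n - k] (mod period)" using 2 k by (auto simp: cong_def elim!: dvdE) (metis le_add_diff_inverse2 mod_mult_self2)
          then show ?thesis using n(2) by (metis cong_sym cong_trans)
        qed
        then have "\<bar>?x n' h - ?x (n - k) h\<bar> \<le> C' * B * decay (\<beta> - 1) (n - k)"
          using n(1) by (intro C'(2)[OF h]) auto
        also have "\<dots> \<le> C' * B * ?d"
        proof -
          have "u \<le> n - k" using 2(2) by (simp add: u_def)
          then show ?thesis using \<beta> C' B by (intro mult_left_mono decay_antimono) auto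
        qed
        finally have "q k \<rho> * \<bar>?x n' h - ?x (n - k) h\<bar> \<le> q k \<rho> * (C' * B * ?d)" using qk by (rule mult_left_mono)
        then show ?thesis using 2 qk by (simp add: abs_mult abs_minus_commute)
      next
        case 3
        have "\<bar>?x (n - k) h - ?x n' h\<bar> \<le> 2 * B" using x_le[of "n - k"] x_le[of n'] by linarith
        then have "q k \<rho> * \<bar>?x (n - k) h - ?x n' h\<bar> \<le> q k \<rho> * (2 * B)" using qk by (rule mult_left_mono)
        moreover have "0 \<le> q k \<rho> * (C' * B * ?d)" using qk C' B by simp
        ultimately show ?thesis using 3 qk by (simp add: abs_mult)
      qed auto
    qed
    have sum_q: "(\<Sum>k\<le>n. q k \<rho>) = ?I - Q n \<rho>" by (simp add: Q_def)
    have "(\<Sum>k\<le>n. of_bool (u < k) * q k \<rho>) = (\<Sum>k\<in>{..n} - {..u}. q k \<rho>)"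
      by (rule sum.mono_neutral_cong_right) auto
    also have "\<dots> = Q u \<rho> - Q n \<rho>"
      using un by (subst sum_diff) (auto simp: Q_def)
    finally have tailq: "(\<Sum>k\<le>n. of_bool (u < k) * q k \<rho>) \<le> C * ?d * ?I"
      using Qd[OF order_refl] Q_nonneg[OF \<rho>, of n] by linarith
    have "\<bar>\<Sum>k\<le>n. q k \<rho> * (?x (n - k) h - ?x n' h)\<bar> \<le>
        (\<Sum>k\<le>n. q k \<rho> * (C' * B * ?d) + of_bool (u < k) * q k \<rho> * (2 * B))"
      by (rule order_trans[OF sum_abs]) (intro sum_mono each, simp)
    also have "\<dots> = (\<Sum>k\<le>n. q k \<rho>) * (C' * B * ?d) + (\<Sum>k\<le>n. of_bool (u < k) * q k \<rho>) * (2 * B)"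
      by (simp only: sum.distrib sum_distrib_right)
    also have "\<dots> \<le> ?I * (C' * B * ?d) + (C * ?d * ?I) * (2 * B)"
      using B C' tailq Q_nonneg[OF \<rho>, of n] by (intro add_mono mult_right_mono) (auto simp: sum_q)
    finally have 1: "\<bar>\<Sum>k\<le>n. q k \<rho> * (?x (n - k) h - ?x n' h)\<bar> \<le> ?I * (C' * B * ?d) + (C * ?d * ?I) * (2 * B)" .
    have BQ: "B * Q n \<rho> \<le> B * (C * ?d * ?I)" by (intro mult_left_mono Qd un B)
    have "\<bar>Q n \<rho> * ?x n' h\<bar> \<le> Q n \<rho> * B"
      using Q_nonneg[OF \<rho>, of n] x_le[of n'] by (simp add: abs_mult mult_left_mono)
    moreover have "X n \<rho> h - ?I * ?x n' h = (X n \<rho> h - (\<Sum>k\<le>n. q k \<rho> * ?x (n - k) h)) +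
       (\<Sum>k\<le>n. q k \<rho> * (?x (n - k) h - ?x n' h)) - Q n \<rho> * ?x n' h"
    proof -
      have "(\<Sum>k\<le>n. q k \<rho> * (?x (n - k) h - ?x n' h)) = (\<Sum>k\<le>n. q k \<rho> * ?x (n - k) h) - (?I - Q n \<rho>) * ?x n' h"
        unfolding sum_q[symmetric] by (simp add: right_diff_distrib sum_subtractf sum_distrib_right)
      then show ?thesis by (simp add: algebra_simps)
    qed
    ultimately have "\<bar>X n \<rho> h - ?I * ?x n' h\<bar> \<le> (C' + 4 * C) * B * ?I * ?d"
      using X_renewal[OF h \<rho>, of n] 1 BQ by (simp add: algebra_simps)
    also have "\<dots> \<le> (C' + 4 * C) * B * ?I * (2 powr (\<beta> - 1) * decay (\<beta> - 1) n)"
      using C C' B I \<beta> by (intro mult_left_mono decay_scale) (auto simp: u_def)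
    finally show ?thesis by (simp add: D_def mult_ac)
  qed
  moreover have "0 \<le> D" using C C' by (simp add: D_def)
  ultimately show ?thesis by blast
qed

subsection \<open>Words\<close>

text \<open>\<open>wd m z\<close> lists the cells visited by \<open>z\<close> until the first return at or after time \<open>m\<close>, and
  \<open>dur\<close> is the time of that return.\<close>

fun wd :: "nat \<Rightarrow> 'b \<Rightarrow> 'b set list" where
  "wd m z = (if m = 0 \<or> \<phi> z = 0 then [] else cell z # wd (m - \<phi> z) (F z))"

declare wd.simps [simp del]

definition dur :: "'b set list \<Rightarrow> nat" where
  "dur w = (\<Sum>a\<leftarrow>w. \<phi> (SOME x. x \<in> a))"

lemma wd_0 [simp]: "wd 0 z = []"
  by (simp add: wd.simps)

lemma wd_pos: "z \<in> space M \<Longrightarrow> 0 < m \<Longrightarrow> wd m z = cell z # wd (m - \<phi> z) (F z)"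
  using \<phi>_pos[of z] by (simp add: wd.simps[of m])

lemma dur_Nil [simp]: "dur [] = 0"
  by (simp add: dur_def)

lemma dur_Cons: "z \<in> space M \<Longrightarrow> dur (cell z # w) = \<phi> z + dur w"
  using \<phi>_eq_cell[of z] by (simp add: dur_def)

lemma wd_induct [consumes 1, case_names 0 step]:
  assumes "z \<in> space M" and "\<And>z. z \<in> space M \<Longrightarrow> P 0 z"
    and step: "\<And>m z. z \<in> space M \<Longrightarrow> 0 < m \<Longrightarrow> F z \<in> space M \<Longrightarrow> 0 < \<phi> z \<Longrightarrow> P (m - \<phi> z) (F z) \<Longrightarrow> P m z"
  shows "P m z"
  using assms(1)
proof (induction m arbitrary: z rule: less_induct)
  case (less m)
  show ?case
  proof (cases "m = 0")
    case False
    then have "m - \<phi> z < m" using \<phi>_pos[OF less.prems] by simp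
    then have P: "P (m - \<phi> z) (F z)" by (rule less.IH[OF _ F_space[OF less.prems]])
    have "0 < m" using False by simp
    then show ?thesis by (rule step[OF less.prems _ F_space[OF less.prems] \<phi>_pos[OF less.prems] P])
  qed (use less.prems assms(2) in auto)
qed

lemma pos_wd:
  assumes "z \<in> space M" "dur (wd m z) \<le> t"
  shows "pos t z = pos (t - dur (wd m z)) ((F ^^ length (wd m z)) z)"
  using assms
proof (induction m z arbitrary: t rule: wd_induct)
  case (step m z)
  then show ?case
    by (simp add: wd_pos dur_Cons pos_ge funpow_swap1 del: funpow.simps(2))
      (simp add: funpow_swap1)
qed auto

lemma period_dvd_dur:
  assumes "z \<in> space M" shows "period dvd dur (wd m z)"
  using assms by (induction m z rule: wd_induct) (auto simp: wd_pos dur_Cons period_dvd)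

lemma ret_le_length: "z \<in> space M \<Longrightarrow> rt m z \<le> length (wd m z)"
proof (induction m z rule: wd_induct)
  case (0 z)
  then show ?case using \<phi>_pos by (simp add: ret_less)
next
  case (step m z)
  then show ?case by (cases "m < \<phi> z") (auto simp: wd_pos ret_less ret_ge)
qed

text \<open>The word also contains the excursion in progress at time \<open>n\<close>, which
  \<open>ret\<close> does not count. Strictness guarantees a common cell at the current return, as
  \<open>shadow\<close> requires.\<close>

lemma ret_less_length: "z \<in> space M \<Longrightarrow> n < m \<Longrightarrow> rt n z < length (wd m z)"
proof (induction m z arbitrary: n rule: wd_induct)
  case (step m z)
  then show ?case by (cases "n < \<phi> z") (auto simp: wd_pos ret_less ret_ge)
qed auto

text \<open>A word overshoots the time \<open>m\<close> by its last excursion alone. A long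
  overshoot is thus a window without returns, to which \<open>window_decay\<close> applies.\<close>

lemma dur_long: "z \<in> space M \<Longrightarrow> m + u < dur (wd m z) \<Longrightarrow> rt (m + u) z = rt m z"
proof (induction m z rule: wd_induct)
  case (step m z)
  show ?case
  proof (cases "m < \<phi> z")
    case True
    then have "m + u < \<phi> z" using step by (simp add: wd_pos dur_Cons)
    then show ?thesis using True by (simp add: ret_less)
  next
    case False
    then have "m + u - \<phi> z = m - \<phi> z + u" by simp
    then show ?thesis using False step by (simp add: wd_pos dur_Cons ret_ge)
  qed
qed auto

lemma cell_eq_imp_\<phi>_eq:
  "z \<in> space M \<Longrightarrow> z' \<in> space M \<Longrightarrow> cell z = cell z' \<Longrightarrow> \<phi> z = \<phi> z'"
  using \<phi>_eq_cell by metis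

lemma wd_nth: "z \<in> space M \<Longrightarrow> i < length (wd m z) \<Longrightarrow> wd m z ! i = cell ((F ^^ i) z)"
proof (induction m z arbitrary: i rule: wd_induct)
  case (step m z)
  then show ?case by (cases i) (auto simp: wd_pos funpow_swap1)
qed auto

lemma ret_cong:
  assumes "z \<in> space M" "z' \<in> space M" "\<And>i. i < j \<Longrightarrow> cell ((F ^^ i) z) = cell ((F ^^ i) z')" "rt n z < j"
  shows "rt n z' = rt n z"
  using assms
proof (induction n arbitrary: z z' j rule: less_induct)
  case (less n)
  have "cell z = cell z'" using less.prems(3)[of 0] less.prems(4) by simp
  then have \<phi>: "\<phi> z' = \<phi> z" using cell_eq_imp_\<phi>_eq less.prems by metis
  show ?case
  proof (cases "n < \<phi> z")
    case True
    then show ?thesis by (simp add: ret_less \<phi>)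
  next
    case False
    then obtain j' where j: "j = Suc j'" "rt (n - \<phi> z) (F z) < j'"
      using less.prems(4) by (cases j) (auto simp: ret_ge[OF less.prems(1)])
    have "rt (n - \<phi> z) (F z') = rt (n - \<phi> z) (F z)"
    proof (rule less.IH)
      show "cell ((F ^^ i) (F z)) = cell ((F ^^ i) (F z'))" if "i < j'" for i
        using less.prems(3)[of "Suc i"] that by (simp add: j funpow_swap1)
    qed (use False \<phi>_pos[OF less.prems(1)] F_space less.prems j in auto)
    then show ?thesis using False less.prems by (simp add: ret_ge \<phi>)
  qed
qed

lemma ret_le: "z \<in> space M \<Longrightarrow> rt n z \<le> n"
proof (induction n arbitrary: z rule: less_induct)
  case (less n)
  show ?case
  proof (cases "n < \<phi> z")
    case False
    then show ?thesis
      using less.IH[of "n - \<phi> z" "F z"] \<phi>_pos[OF less.prems] F_space[OF less.prems] by (simp add: ret_ge less.prems)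
  qed (simp add: ret_less)
qed

text \<open>Columns have height at least 1, and the \<open>l\<close> steps already spent in the
  first column produce no return. This bounds the number of cells needed to follow an orbit for
  \<open>u\<close> further steps.\<close>

lemma ret_le_diff: "z \<in> space M \<Longrightarrow> l < \<phi> z \<Longrightarrow> rt (l + u) z \<le> u"
  using ret_le[OF F_space, of z "l + u - \<phi> z"] by (cases "l + u < \<phi> z") (auto simp: ret_less ret_ge)

lemma wd_set: "z \<in> space M \<Longrightarrow> wd m z \<in> lists \<alpha>"
  by (induction m z rule: wd_induct) (auto simp: wd_pos cell_mem)

lemma countable_words: "countable (lists \<alpha>)"
  using partition(2) by (rule countable_lists)

definition Ew :: "nat \<Rightarrow> 'b set list \<Rightarrow> 'b set" where
  "Ew m w = {z \<in> space M. wd m z = w}"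

lemma Ew_Cons:
  "Ew m (a # w) = (if 0 < m \<and> a \<in> \<alpha> then {z \<in> space M. cell z = a \<and> F z \<in> Ew (m - \<phi> (SOME x. x \<in> a)) w} else {})"
proof (cases "0 < m \<and> a \<in> \<alpha>")
  case True
  have "wd m z = a # w \<longleftrightarrow> cell z = a \<and> wd (m - \<phi> (SOME x. x \<in> a)) (F z) = w" if z: "z \<in> space M" for z
    using wd_pos[OF z, of m] \<phi>_eq_cell[OF z] True by auto
  then show ?thesis using True F_space by (auto simp: Ew_def)
next
  case False
  have "wd m z \<noteq> a # w" if z: "z \<in> space M" for z
    using wd_pos[OF z, of m] cell_mem(1)[OF z] False by (cases "m = 0") auto
  then show ?thesis using False by (auto simp: Ew_def)
qed

lemma sets_Ew [measurable]: "Ew m w \<in> sets M"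
proof (induction w arbitrary: m)
  case Nil
  have "Ew m [] = (if m = 0 then space M else {})" by (auto simp: Ew_def wd_pos)
  then show ?case by auto
next
  case (Cons a w)
  note Cons [measurable]
  have [measurable]: "{z \<in> space M. cell z = a} \<in> sets M" if "a \<in> \<alpha>"
  proof -
    have "{z \<in> space M. cell z = a} = a" using that \<alpha>_subset[OF that] cell_mem cell_eq[OF that] by auto
    then show ?thesis using that partition(3) by auto
  qed
  have "{z \<in> space M. cell z = a \<and> F z \<in> Ew k w} \<in> sets M" if "a \<in> \<alpha>" for k
  proof -
    have "{z \<in> space M. cell z = a \<and> F z \<in> Ew k w} = {z \<in> space M. cell z = a} \<inter> (F -` Ew k w \<inter> space M)" by auto
    also have "\<dots> \<in> sets M" using that by measurable
    finally show ?thesis .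
  qed
  then show ?case by (auto simp: Ew_Cons)
qed

lemma measurable_wd [measurable]: "wd m \<in> M \<rightarrow>\<^sub>M count_space (lists \<alpha>)"
proof (rule measurable_into_countable[OF countable_words])
  fix w
  have "wd m -` {w} \<inter> space M = Ew m w" by (auto simp: Ew_def)
  then show "wd m -` {w} \<inter> space M \<in> sets M" by simp
qed (use wd_set in auto)

text \<open>\<open>branch_transfer\<close> is iterated along the word. Each step maps the cone into
  itself, so the regularity at the end does not deteriorate with the length of the word. For \<rho>
  = 1 and \<open>g = 1\<close> the integral of the new density is the probability of the
  word.\<close>

lemma word_density:
  assumes "\<rho> \<in> cone R\<^sub>0"
  shows "\<exists>\<rho>'\<in>cone R\<^sub>0. \<forall>g\<in>borel_measurable M.
    (\<integral>z. indicator (Ew m w) z * (g ((F ^^ length w) z) * \<rho> z) \<partial>M) = (\<integral>z. g z * \<rho>' z \<partial>M)"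
  using assms
proof (induction w arbitrary: m \<rho>)
  case Nil
  show ?case
  proof (cases "m = 0")
    case True
    then have "Ew m [] = space M" by (auto simp: Ew_def)
    then show ?thesis using Nil by (intro bexI[of _ \<rho>]) (auto intro!: Bochner_Integration.integral_cong)
  next
    case False
    then have "Ew m [] = {}" by (auto simp: Ew_def wd_pos)
    then show ?thesis using R_bounds by (intro bexI[of _ "\<lambda>_. 0"] cone_const) auto
  qed
next
  case (Cons a w)
  show ?case
  proof (cases "0 < m \<and> a \<in> \<alpha>")
    case False
    then have "Ew m (a # w) = {}" by (auto simp: Ew_Cons)
    then show ?thesis using R_bounds by (intro bexI[of _ "\<lambda>_. 0"] cone_const) auto
  next
    case True
    then have a: "a \<in> \<alpha>" by simp
    let ?k = "m - \<phi> (SOME x. x \<in> a)"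
    obtain r where r: "r \<in> cone R\<^sub>1" "\<And>g. g \<in> borel_measurable M \<Longrightarrow>
        (\<integral>z. indicator a z * (g (F z) * \<rho> z) \<partial>M) = (\<integral>z. g z * r z \<partial>M)"
      using branch_transfer[OF a Cons.prems less_imp_le[OF R_bounds(1)]] unfolding R\<^sub>1_def by blast
    have "r \<in> cone R\<^sub>0" using r(1) cone_mono[of R\<^sub>1 R\<^sub>0] R_bounds by auto
    from Cons.IH[OF this, of ?k] obtain \<rho>' where \<rho>': "\<rho>' \<in> cone R\<^sub>0" "\<And>g. g \<in> borel_measurable M \<Longrightarrow>
        (\<integral>z. indicator (Ew ?k w) z * (g ((F ^^ length w) z) * r z) \<partial>M) = (\<integral>z. g z * \<rho>' z \<partial>M)"
      by blast
    have "(\<integral>z. indicator (Ew m (a # w)) z * (g ((F ^^ length (a # w)) z) * \<rho> z) \<partial>M) = (\<integral>z. g z * \<rho>' z \<partial>M)"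
      if [measurable]: "g \<in> borel_measurable M" for g
    proof -
      have [measurable]: "F ^^ n \<in> M \<rightarrow>\<^sub>M M" for n by (rule measurable_compose_n) measurable
      have "(\<integral>z. indicator (Ew m (a # w)) z * (g ((F ^^ length (a # w)) z) * \<rho> z) \<partial>M) =
          (\<integral>z. indicator a z * ((indicator (Ew ?k w) (F z) * g ((F ^^ length w) (F z))) * \<rho> z) \<partial>M)"
      proof (intro Bochner_Integration.integral_cong refl)
        fix z assume z: "z \<in> space M"
        have "z \<in> Ew m (a # w) \<longleftrightarrow> z \<in> a \<and> F z \<in> Ew ?k w"
          using True z cell_mem[OF z] cell_eq[OF a] by (auto simp: Ew_Cons)
        then show "indicator (Ew m (a # w)) z * (g ((F ^^ length (a # w)) z) * \<rho> z) =
          indicator a z * ((indicator (Ew ?k w) (F z) * g ((F ^^ length w) (F z))) * \<rho> z)"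
          by (auto simp: indicator_def funpow_swap1)
      qed
      also have "\<dots> = (\<integral>z. (indicator (Ew ?k w) z * g ((F ^^ length w) z)) * r z \<partial>M)"
        by (rule r(2)[of "\<lambda>z. indicator (Ew ?k w) z * g ((F ^^ length w) z)"]) measurable
      also have "\<dots> = (\<integral>z. g z * \<rho>' z \<partial>M)" using \<rho>'(2)[OF that] by (simp add: mult.assoc)
      finally show ?thesis .
    qed
    then show ?thesis using \<rho>'(1) by blast
  qed
qed

text \<open>The bound \<open>b\<close> may depend on the word, since words of long duration admit
  only a trivial estimate. Finitely many values are treated at a time, and dominated convergence
  removes the truncation.\<close>

lemma integral_countable_partition_le:
  fixes f :: "'b \<Rightarrow> real" and b :: "'w \<Rightarrow> real"
  assumes W: "W \<in> M \<rightarrow>\<^sub>M count_space J" and J: "countable J"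
    and f: "integrable M f" and b: "integrable M (\<lambda>z. b (W z))" "\<And>w. 0 \<le> b w"
    and le: "\<And>w. w \<in> J \<Longrightarrow> \<bar>\<integral>z. indicator {z \<in> space M. W z = w} z * f z \<partial>M\<bar> \<le> b w * prob {z \<in> space M. W z = w}"
  shows "\<bar>integral\<^sup>L M f\<bar> \<le> (\<integral>z. b (W z) \<partial>M)"
proof -
  note W [measurable]
  define S where "S n = {z \<in> space M. to_nat_on J (W z) < n}" for n
  define U where "U w = {z \<in> space M. W z = w}" for w
  have [measurable]: "S n \<in> sets M" for n unfolding S_def by measurable
  have [measurable]: "U w \<in> sets M" for w
  proof -
    have "U w = W -` ({w} \<inter> J) \<inter> space M" using measurable_space[OF W] by (auto simp: U_def)
    then show ?thesis using measurable_sets[OF W, of "{w} \<inter> J"] by simp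
  qed
  have lim: "(\<lambda>n. \<integral>z. indicator (S n) z * g z \<partial>M) \<longlonglongrightarrow> integral\<^sup>L M g" if g: "integrable M g" for g :: "'b \<Rightarrow> real"
  proof (rule integral_dominated_convergence[where w="\<lambda>z. norm (g z)"])
    show "AE z in M. (\<lambda>n. indicator (S n) z * g z) \<longlonglongrightarrow> g z"
    proof (rule AE_I2)
      fix z assume z: "z \<in> space M"
      have "eventually (\<lambda>n. indicator (S n) z * g z = g z) sequentially"
        using eventually_gt_at_top[of "to_nat_on J (W z)"] by eventually_elim (simp add: S_def z)
      then show "(\<lambda>n. indicator (S n) z * g z) \<longlonglongrightarrow> g z" by (rule tendsto_eventually)
    qed
  qed (use g in \<open>auto simp: indicator_def\<close>)
  have "\<bar>\<integral>z. indicator (S n) z * f z \<partial>M\<bar> \<le> (\<integral>z. indicator (S n) z * b (W z) \<partial>M)" for n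
  proof -
    define I where "I = {w \<in> J. to_nat_on J w < n}"
    have "inj_on (to_nat_on J) I" using inj_on_to_nat_on[OF J] by (rule inj_on_subset) (auto simp: I_def)
    moreover have "finite (to_nat_on J ` I)" by (rule finite_subset[of _ "{..<n}"]) (auto simp: I_def)
    ultimately have I: "finite I" by (auto dest: finite_imageD)
    have split: "indicator (S n) z * x = (\<Sum>w\<in>I. indicator (U w) z * x)" if z: "z \<in> space M" for z and x :: real
    proof -
      have "(\<Sum>w\<in>I. indicator (U w) z * x) = (\<Sum>w\<in>I. if w = W z then x else 0)"
        using z by (intro sum.cong) (auto simp: U_def)
      then show ?thesis using I z measurable_space[OF W z] by (simp add: I_def S_def indicator_def)
    qed
    have int: "integrable M (\<lambda>z. indicator (U w) z * g z)" if "integrable M g" for w and g :: "'b \<Rightarrow> real"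
      using integrable_mult_indicator[OF _ that, of "U w"] by simp
    have eq: "(\<integral>z. indicator (S n) z * g z \<partial>M) = (\<Sum>w\<in>I. \<integral>z. indicator (U w) z * g z \<partial>M)"
      if "integrable M g" for g :: "'b \<Rightarrow> real"
    proof -
      have "(\<integral>z. indicator (S n) z * g z \<partial>M) = (\<integral>z. (\<Sum>w\<in>I. indicator (U w) z * g z) \<partial>M)"
        by (intro Bochner_Integration.integral_cong refl split)
      also have "\<dots> = (\<Sum>w\<in>I. \<integral>z. indicator (U w) z * g z \<partial>M)"
        by (rule Bochner_Integration.integral_sum[OF int[OF that]])
      finally show ?thesis .
    qed
    have "\<bar>\<integral>z. indicator (S n) z * f z \<partial>M\<bar> \<le> (\<Sum>w\<in>I. \<bar>\<integral>z. indicator (U w) z * f z \<partial>M\<bar>)"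
      unfolding eq[OF f] by (rule sum_abs)
    also have "\<dots> \<le> (\<Sum>w\<in>I. b w * prob (U w))"
      using le by (intro sum_mono) (auto simp: U_def I_def)
    also have "\<dots> = (\<Sum>w\<in>I. \<integral>z. indicator (U w) z * b (W z) \<partial>M)"
    proof (rule sum.cong[OF refl])
      fix w
      have "(\<integral>z. indicator (U w) z * b (W z) \<partial>M) = (\<integral>z. b w * indicator (U w) z \<partial>M)"
        by (intro Bochner_Integration.integral_cong) (auto simp: U_def indicator_def)
      also have "\<dots> = b w * prob (U w)" by simp
      finally show "b w * prob (U w) = (\<integral>z. indicator (U w) z * b (W z) \<partial>M)" ..
    qed
    finally show ?thesis unfolding eq[OF b(1)] .
  qed
  then show ?thesis
    using LIMSEQ_le[OF tendsto_rabs[OF lim[OF f]] lim[OF b(1)]] by blast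
qed

text \<open>By \<open>dur_long\<close> the exponent in \<open>window_decay\<close> is zero on this
  event, so the integrand there dominates its indicator; the base 1/2 is arbitrary.\<close>

lemma prob_dur_decay:
  "\<exists>C\<ge>0. \<forall>m u. prob {z \<in> space M. m + u < dur (wd m z)} \<le> C * decay (\<beta> - 1) u"
proof -
  obtain C where C: "0 \<le> C" "\<And>t m. (\<integral>z. (1/2) ^ (rt (t + m) z - rt t z) \<partial>M) \<le> C * decay (\<beta> - 1) m"
    using window_decay[of "1/2"] by auto
  have "prob {z \<in> space M. m + u < dur (wd m z)} \<le> C * decay (\<beta> - 1) u" for m u
  proof -
    let ?E = "{z \<in> space M. m + u < dur (wd m z)}"
    have [measurable]: "?E \<in> sets M"
    proof -
      have "(\<lambda>z. dur (wd m z)) \<in> M \<rightarrow>\<^sub>M count_space UNIV"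
        by (rule measurable_compose[OF measurable_wd]) auto
      then show ?thesis by measurable
    qed
    have "prob ?E = (\<integral>z. indicator ?E z \<partial>M)" by simp
    also have "\<dots> \<le> (\<integral>z. (1/2) ^ (rt (m + u) z - rt m z) \<partial>M)"
    proof (rule integral_mono)
      show "integrable M (\<lambda>z. (1/2::real) ^ (rt (m + u) z - rt m z))"
        by (intro integrable_const_bound[where B=1] measurable_window) (auto simp: power_le_one)
      fix z assume "z \<in> space M"
      then show "indicator ?E z \<le> (1/2::real) ^ (rt (m + u) z - rt m z)"
        using dur_long[of z m u] by (auto simp: indicator_def)
    qed (auto simp: emeasure_eq_measure intro!: integrable_real_indicator)
    also have "\<dots> \<le> C * decay (\<beta> - 1) u" by (rule C)
    finally show ?thesis .
  qed
  then show ?thesis using C(1) by blast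
qed

lemma measurable_wd_pos:
  assumes h: "\<And>w. adm (h w) B"
  shows "(\<lambda>z. h (wd m z) (pos t z)) \<in> borel_measurable M"
  by (rule measurable_compose_countable'[OF measurable_pos[OF h] measurable_wd countable_words])

text \<open>Given the word, the position at time \<open>m + u\<close> is reached from a density in
  the cone after the time left when the word ends, so \<open>X_convergence\<close> applies on each
  word with its own function \<open>h w\<close>. Only the bound \<open>B\<close> on
  \<open>h w\<close> enters the estimate.\<close>

theorem word_mixing:
  "\<exists>C\<ge>0. \<forall>h B m u j. (\<forall>w. adm (h w) B) \<longrightarrow>
    \<bar>(\<integral>z. h (wd m z) (pos (m + u) z) \<partial>M) -
      (\<integral>z. (\<integral>z'. h (wd m z) (pos (m + u + period * j) z') \<partial>M) \<partial>M)\<bar> \<le> C * B * decay (\<beta> - 1) u"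
proof -
  obtain C where C: "0 \<le> C" "\<And>h B n n' \<rho>. \<rho> \<in> cone R\<^sub>0 \<Longrightarrow> adm h B \<Longrightarrow> n \<le> n' \<Longrightarrow> [n = n'] (mod period) \<Longrightarrow>
    \<bar>X n \<rho> h - integral\<^sup>L M \<rho> * X n' (\<lambda>_. 1) h\<bar> \<le> C * B * integral\<^sup>L M \<rho> * decay (\<beta> - 1) n"
    using X_convergence by blast
  obtain D where D: "0 \<le> D" "\<And>m u. prob {z \<in> space M. m + u < dur (wd m z)} \<le> D * decay (\<beta> - 1) u"
    using prob_dur_decay by blast
  define C' where "C' = (C + 2 * D) * 2 powr (\<beta> - 1)"
  have "\<bar>(\<integral>z. h (wd m z) (pos (m + u) z) \<partial>M) -
      (\<integral>z. (\<integral>z'. h (wd m z) (pos (m + u + period * j) z') \<partial>M) \<partial>M)\<bar> \<le> C' * B * decay (\<beta> - 1) u"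
    if h: "\<And>w. adm (h w) B" for h B m u j
  proof -
    \<comment> \<open>Words that overshoot \<open>m\<close> by more than \<open>v\<close> are
      estimated trivially and are rare; after the others at least \<open>v\<close> units of time
      remain.\<close>
    define v where "v = u div 2"
    let ?d = "decay (\<beta> - 1) v"
    have B: "0 \<le> B" by (rule adm_nonneg[OF h])
    define a where "a w = X (m + u + period * j) (\<lambda>_. 1) (h w)" for w
    define f where "f z = h (wd m z) (pos (m + u) z) - a (wd m z)" for z
    define b where "b w = C * B * ?d + 2 * B * of_bool (m + v < dur w)" for w
    have a_le: "\<bar>a w\<bar> \<le> B" for w unfolding a_def using X_le[OF one_cone h] by (simp add: prob_space)
    have b0: "0 \<le> b w" for w using B C by (simp add: b_def)
    have am [measurable]: "(\<lambda>z. a (wd m z)) \<in> borel_measurable M" by (rule measurable_compose[OF measurable_wd]) auto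
    have hm [measurable]: "(\<lambda>z. h (wd m z) (pos (m + u) z)) \<in> borel_measurable M" by (rule measurable_wd_pos[OF h])
    have i1: "integrable M (\<lambda>z. h (wd m z) (pos (m + u) z))"
      by (rule integrable_const_bound[where B=B]) (use admD(2)[OF h] in auto)
    have i2: "integrable M (\<lambda>z. a (wd m z))"
      by (rule integrable_const_bound[where B=B]) (use a_le in auto)
    have "\<bar>integral\<^sup>L M f\<bar> \<le> (\<integral>z. b (wd m z) \<partial>M)"
    proof (rule integral_countable_partition_le[OF measurable_wd countable_words])
      show "integrable M f" unfolding f_def using i1 i2 by simp
      have "(\<lambda>z. b (wd m z)) \<in> borel_measurable M" by (rule measurable_compose[OF measurable_wd]) auto
      then show "integrable M (\<lambda>z. b (wd m z))"
        by (rule integrable_const_bound[where B="C * B * ?d + 2 * B", rotated])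
          (use b0 B in \<open>auto simp: abs_of_nonneg\<close>, simp add: b_def)
      show "0 \<le> b w" for w by (rule b0)
      fix w
      have E: "{z \<in> space M. wd m z = w} = Ew m w" by (simp add: Ew_def)
      have absf: "\<bar>f z\<bar> \<le> 2 * B" for z
        using admD(2)[OF h, of "wd m z" "pos (m + u) z"] a_le[of "wd m z"] by (simp add: f_def)
      show "\<bar>\<integral>z. indicator {z \<in> space M. wd m z = w} z * f z \<partial>M\<bar> \<le> b w * prob {z \<in> space M. wd m z = w}"
        unfolding E
      proof (cases "Ew m w = {}")
        case False
        then obtain z0 where z0: "z0 \<in> space M" "wd m z0 = w" by (auto simp: Ew_def)
        show "\<bar>\<integral>z. indicator (Ew m w) z * f z \<partial>M\<bar> \<le> b w * prob (Ew m w)"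
        proof (cases "m + v < dur w")
          case True
          have "\<bar>\<integral>z. indicator (Ew m w) z * f z \<partial>M\<bar> \<le> (\<integral>z. 2 * B * indicator (Ew m w) z \<partial>M)"
          proof (rule order_trans[OF integral_abs_bound], rule integral_mono)
            have fi: "integrable M f" unfolding f_def using i1 i2 by simp
            show "integrable M (\<lambda>z. \<bar>indicator (Ew m w) z * f z\<bar>)"
              using integrable_mult_indicator[OF sets_Ew fi] by simp
            show "integrable M (\<lambda>z. 2 * B * indicator (Ew m w) z)"
              by (intro integrable_mult_right integrable_real_indicator) (auto simp: emeasure_eq_measure)
          qed (use absf in \<open>auto simp: indicator_def\<close>)
          also have "\<dots> = 2 * B * prob (Ew m w)" by simp
          also have "\<dots> \<le> b w * prob (Ew m w)"
            using True B C by (intro mult_right_mono) (auto simp: b_def)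
          finally show ?thesis .
        next
          case False
          let ?t = "m + u - dur w"
          obtain \<rho> where \<rho>: "\<rho> \<in> cone R\<^sub>0" "\<And>g. g \<in> borel_measurable M \<Longrightarrow>
              (\<integral>z. indicator (Ew m w) z * (g ((F ^^ length w) z) * 1) \<partial>M) = (\<integral>z. g z * \<rho> z \<partial>M)"
            using word_density[OF one_cone, of m w] by blast
          have I: "integral\<^sup>L M \<rho> = prob (Ew m w)" using \<rho>(2)[of "\<lambda>_. 1"] by simp
          have du: "dur w \<le> m + u" using False by (simp add: v_def)
          have "(\<integral>z. indicator (Ew m w) z * f z \<partial>M) =
              (\<integral>z. indicator (Ew m w) z * (h w (pos ?t ((F ^^ length w) z)) * 1) - a w * indicator (Ew m w) z \<partial>M)"
          proof (intro Bochner_Integration.integral_cong refl)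
            fix z assume "z \<in> space M"
            then show "indicator (Ew m w) z * f z =
                indicator (Ew m w) z * (h w (pos ?t ((F ^^ length w) z)) * 1) - a w * indicator (Ew m w) z"
              using pos_wd[of z m "m + u"] du by (auto simp: Ew_def f_def indicator_def)
          qed
          also have "\<dots> = X ?t \<rho> (h w) - prob (Ew m w) * a w"
          proof -
            have [measurable]: "F ^^ n \<in> M \<rightarrow>\<^sub>M M" for n by (rule measurable_compose_n) measurable
            have hw [measurable]: "(\<lambda>z. h w (pos ?t z)) \<in> borel_measurable M" by (rule measurable_pos[OF h])
            have "integrable M (\<lambda>z. indicator (Ew m w) z * (h w (pos ?t ((F ^^ length w) z)) * 1))"
              by (rule integrable_const_bound[where B=B]) (use admD(2)[OF h] B in \<open>auto simp: indicator_def\<close>)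
            moreover have "integrable M (\<lambda>z. a w * indicator (Ew m w) z)"
              by (intro integrable_mult_right integrable_real_indicator) (auto simp: emeasure_eq_measure)
            ultimately show ?thesis unfolding X_def
              by (subst Bochner_Integration.integral_diff) (simp_all only: \<rho>(2)[OF hw], simp add: mult.commute)
          qed
          also have "\<bar>\<dots>\<bar> \<le> C * B * prob (Ew m w) * decay (\<beta> - 1) ?t"
          proof -
            \<comment> \<open>A word ends at a return. Hence the times compared by
              \<open>X_convergence\<close> are congruent.\<close>
            have "period dvd dur w" using period_dvd_dur[OF z0(1), of m] z0(2) by simp
            then obtain k where k: "dur w = period * k" by auto
            have "m + u + period * j = ?t + period * (k + j)" using du k by (simp add: algebra_simps)
            then have "[?t = m + u + period * j] (mod period)" by (simp add: cong_def)
            then show ?thesis using C(2)[OF \<rho>(1) h, of ?t "m + u + period * j" w] unfolding I a_def by simp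
          qed
          also have "\<dots> \<le> C * B * prob (Ew m w) * ?d"
          proof -
            have "v \<le> ?t" using False by (simp add: v_def)
            then show ?thesis using C B \<beta> by (intro mult_left_mono decay_antimono) auto
          qed
          finally show ?thesis using False by (simp add: b_def mult_ac)
        qed
      qed auto
    qed
    also have "(\<integral>z. b (wd m z) \<partial>M) = C * B * ?d + 2 * B * prob {z \<in> space M. m + v < dur (wd m z)}"
    proof -
      have [measurable]: "(\<lambda>z. dur (wd m z)) \<in> M \<rightarrow>\<^sub>M count_space UNIV"
        by (rule measurable_compose[OF measurable_wd]) auto
      have "(\<integral>z. b (wd m z) \<partial>M) = (\<integral>z. C * B * ?d + 2 * B * indicator {z \<in> space M. m + v < dur (wd m z)} z \<partial>M)"
        by (intro Bochner_Integration.integral_cong) (auto simp: b_def indicator_def)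
      also have "\<dots> = C * B * ?d + 2 * B * prob {z \<in> space M. m + v < dur (wd m z)}"
        by (subst Bochner_Integration.integral_add)
          (auto simp: prob_space emeasure_eq_measure intro!: integrable_mult_right integrable_real_indicator)
      finally show ?thesis .
    qed
    also have "\<dots> \<le> C * B * ?d + 2 * B * (D * ?d)" using B by (intro add_left_mono mult_left_mono D) auto
    also have "\<dots> = (C + 2 * D) * B * ?d" by (simp add: algebra_simps)
    also have "\<dots> \<le> (C + 2 * D) * B * (2 powr (\<beta> - 1) * decay (\<beta> - 1) u)"
      using C D B \<beta> by (intro mult_left_mono decay_scale) (auto simp: v_def)
    finally have "\<bar>integral\<^sup>L M f\<bar> \<le> C' * B * decay (\<beta> - 1) u" by (simp add: C'_def mult_ac)
    moreover have "integral\<^sup>L M f = (\<integral>z. h (wd m z) (pos (m + u) z) \<partial>M) - (\<integral>z. a (wd m z) \<partial>M)"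
      unfolding f_def using i1 i2 by (rule Bochner_Integration.integral_diff)
    ultimately show ?thesis by (simp add: a_def X_def)
  qed
  moreover have "0 \<le> C'" using C D by (simp add: C'_def)
  ultimately show ?thesis by blast
qed

lemma pos_time: "z \<in> space M \<Longrightarrow> snd (pos n z) + (\<Sum>i<rt n z. \<phi> ((F ^^ i) z)) = n"
proof (induction n arbitrary: z rule: less_induct)
  case (less n)
  show ?case
  proof (cases "n < \<phi> z")
    case False
    have "snd (pos (n - \<phi> z) (F z)) + (\<Sum>i<rt (n - \<phi> z) (F z). \<phi> ((F ^^ i) (F z))) = n - \<phi> z"
      using False \<phi>_pos[OF less.prems] by (intro less.IH F_space less.prems) auto
    then show ?thesis
      using False by (simp add: pos_ge ret_ge less.prems sum.lessThan_Suc_shift funpow_swap1 del: sum.lessThan_Suc)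
  qed (simp add: pos_less ret_less)
qed

text \<open>After the gap no stopping time has to be respected, so the itinerary is cut after a
  fixed number of cells; \<open>ret_le_diff\<close> tells how many suffice.\<close>

definition pre :: "nat \<Rightarrow> 'b \<Rightarrow> 'b set list" where
  "pre L z = map (\<lambda>i. cell ((F ^^ i) z)) [0..<L]"

lemma pre_eq_imp: "pre L z = pre L z' \<Longrightarrow> i < L \<Longrightarrow> cell ((F ^^ i) z) = cell ((F ^^ i) z')"
  by (auto simp: pre_def)

lemma measurable_pre: "pre L \<in> M \<rightarrow>\<^sub>M count_space (lists \<alpha>)"
proof (rule measurable_into_countable[OF countable_words])
  show "pre L \<in> space M \<rightarrow> lists \<alpha>" using cell_mem(1)[OF Fn_space] by (auto simp: pre_def)
  fix w assume w: "w \<in> lists \<alpha>"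
  show "pre L -` {w} \<inter> space M \<in> sets M"
  proof (cases "length w = L")
    case True
    have [measurable]: "F ^^ n \<in> M \<rightarrow>\<^sub>M M" for n by (rule measurable_compose_n) measurable
    have eq1: "pre L z = w \<longleftrightarrow> (\<forall>i<L. cell ((F ^^ i) z) = w ! i)" for z
      unfolding pre_def list_eq_iff_nth_eq by (simp add: True)
    have eq2: "cell ((F ^^ i) z) = w ! i \<longleftrightarrow> (F ^^ i) z \<in> w ! i" if "z \<in> space M" "i < L" for i z
    proof -
      have "w ! i \<in> \<alpha>" using w True that(2) by (auto simp: in_lists_conv_set)
      then show ?thesis using cell_mem(2)[OF Fn_space[OF that(1)], of i] cell_eq[of "w ! i"] by metis
    qed
    have "z \<in> pre L -` {w} \<inter> space M \<longleftrightarrow> z \<in> space M \<and> (\<forall>i<L. (F ^^ i) z \<in> w ! i)" for z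
      unfolding vimage_def Int_iff mem_Collect_eq singleton_iff eq1 using eq2 by blast
    then have "pre L -` {w} \<inter> space M = space M \<inter> (\<Inter>i\<in>{..<L}. (F ^^ i) -` (w ! i) \<inter> space M)"
      by blast
    also have "\<dots> \<in> sets M"
    proof (cases "L = 0")
      case False
      have "w ! i \<in> sets M" if "i < L" for i using w True that partition(3) by (auto simp: in_lists_conv_set)
      then have "(\<Inter>i\<in>{..<L}. (F ^^ i) -` (w ! i) \<inter> space M) \<in> sets M"
        using False by (intro sets.finite_INT) (auto intro!: measurable_sets)
      then show ?thesis by auto
    qed auto
    finally show ?thesis .
  next
    case False
    then have "pre L -` {w} \<inter> space M = {}" by (auto simp: pre_def)
    then show ?thesis by simp
  qed
qed

end

section \<open>Coordinatewise estimates and convergence of integrals\<close>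

lemma epow_shift_le:
  assumes "0 < \<theta>" "\<theta> < 1" "enat j \<le> s" "k \<le> j"
  shows "epow_shift \<theta> s k \<le> \<theta> ^ (j - k)"
proof (cases s)
  case (enat m)
  then have "\<theta> powi (int m - int k) = \<theta> ^ (m - k)"
    using assms(3,4) by (simp add: power_int_def nat_diff_distrib')
  also have "\<dots> \<le> \<theta> ^ (j - k)" using assms enat by (intro power_decreasing) auto
  finally show ?thesis by (simp add: epow_shift_def enat)
qed (use assms in \<open>simp add: epow_shift_def\<close>)

text \<open>Coordinates are exchanged one at a time, so that the total error is a sum over the
  separate seminorms.\<close>

lemma telescope_coordinates:
  fixes G :: "(nat \<Rightarrow> 'a) \<Rightarrow> real"
  assumes x: "x \<in> {..<q} \<rightarrow>\<^sub>E UNIV" "x' \<in> {..<q} \<rightarrow>\<^sub>E UNIV"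
    and le: "\<And>z i. z \<in> {..<q} \<rightarrow>\<^sub>E UNIV \<Longrightarrow> i < q \<Longrightarrow> \<bar>G (z(i := x i)) - G (z(i := x' i))\<bar> \<le> e i"
  shows "\<bar>G x - G x'\<bar> \<le> (\<Sum>i<q. e i)"
proof -
  define y where "y k i = (if i < k then x' i else x i)" for k i
  have y: "y k \<in> {..<q} \<rightarrow>\<^sub>E UNIV" for k using x by (auto simp: y_def PiE_iff extensional_def)
  have "\<bar>G (y 0) - G (y k)\<bar> \<le> (\<Sum>i<k. e i)" if "k \<le> q" for k
    using that
  proof (induction k)
    case (Suc k)
    have "(y k)(k := x k) = y k" "(y k)(k := x' k) = y (Suc k)" by (auto simp: y_def fun_eq_iff)
    then have "\<bar>G (y k) - G (y (Suc k))\<bar> \<le> e k" using le[OF y, of k k] Suc.prems by simp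
    then show ?case using Suc by simp
  qed simp
  moreover have "y 0 = x" by (simp add: y_def fun_eq_iff)
  moreover have "y q = x'" using x by (auto simp: y_def fun_eq_iff PiE_iff extensional_def)
  ultimately show ?thesis by fastforce
qed

lemma dyn_Holder_seminorm_bound:
  assumes d: "Metric_space Y d" and \<theta>: "0 < \<theta>"
    and H: "dyn_Holder_seminorm T Y \<phi> d s \<theta> v \<le> ennreal H" "0 \<le> H"
    and y: "y \<in> Y" "y' \<in> Y" "l < \<phi> y"
  shows "\<bar>v ((T ^^ l) y) - v ((T ^^ l) y')\<bar> \<le> H * (d y y' + epow \<theta> (s y y'))"
proof -
  interpret Metric_space Y d by (rule d)
  have e: "0 \<le> epow \<theta> (s y y')" using \<theta> by (intro epow_nonneg) auto
  show ?thesis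
  proof (cases "y = y'")
    case True
    then show ?thesis using e H(2) by (simp add: mult_nonneg_nonneg)
  next
    case False
    then have pos: "0 < d y y' + epow \<theta> (s y y')" using e y mdist_pos_less[of y y'] by (intro add_pos_nonneg) auto
    have "ennreal (\<bar>v ((T ^^ l) y) - v ((T ^^ l) y')\<bar> / (d y y' + epow \<theta> (s y y'))) \<le> dyn_Holder_seminorm T Y \<phi> d s \<theta> v"
      unfolding dyn_Holder_seminorm_def
      by (rule SUP_upper2[OF y(1)], rule SUP_upper2[of y'], (use False y in simp), rule SUP_upper) (use y in simp)
    then have "ennreal (\<bar>v ((T ^^ l) y) - v ((T ^^ l) y')\<bar> / (d y y' + epow \<theta> (s y y'))) \<le> ennreal H"
      using H(1) by (rule order_trans)
    then have "\<bar>v ((T ^^ l) y) - v ((T ^^ l) y')\<bar> / (d y y' + epow \<theta> (s y y')) \<le> H"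
      using H(2) by (simp add: ennreal_le_iff)
    then show ?thesis using pos by (simp add: field_simps)
  qed
qed

text \<open>Rounding down to multiples of \<delta> approximates \<psi> uniformly by a simple
  function, which has finitely many level sets because \<psi> is bounded. The approximation error is
  the same for all the measures.\<close>

lemma setwise_imp_integral_tendsto:
  fixes \<psi> :: "'a \<Rightarrow> real"
  assumes N: "\<And>n. prob_space (N n)" "\<And>n. sets (N n) = sets M" and M: "prob_space M"
    and lim: "\<And>A. A \<in> sets M \<Longrightarrow> (\<lambda>n. measure (N n) A) \<longlonglongrightarrow> measure M A"
    and \<psi>: "\<psi> \<in> borel_measurable M" "\<And>x. \<bar>\<psi> x\<bar> \<le> B"
  shows "(\<lambda>n. integral\<^sup>L (N n) \<psi>) \<longlonglongrightarrow> integral\<^sup>L M \<psi>"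
proof (rule LIMSEQ_I)
  fix r :: real assume r: "0 < r"
  note \<psi>(1) [measurable]
  define \<delta> where "\<delta> = r / 4"
  have \<delta>: "0 < \<delta>" using r by (simp add: \<delta>_def)
  define I where "I = {- \<lceil>B / \<delta>\<rceil> - 1..\<lceil>B / \<delta>\<rceil> + 1}"
  define A where "A j = {x \<in> space M. \<lfloor>\<psi> x / \<delta>\<rfloor> = j}" for j
  have A [measurable]: "A j \<in> sets M" for j unfolding A_def by measurable
  define \<psi>' where "\<psi>' x = (\<Sum>j\<in>I. (\<delta> * of_int j) * indicator (A j) x)" for x
  have close: "\<bar>\<psi> x - \<psi>' x\<bar> \<le> \<delta>" if x: "x \<in> space M" for x
  proof -
    have "\<lfloor>\<psi> x / \<delta>\<rfloor> \<in> I"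
    proof -
      have "\<psi> x / \<delta> \<le> B / \<delta>" "- (B / \<delta>) \<le> \<psi> x / \<delta>"
        using \<psi>(2)[of x] \<delta> by (auto simp: field_simps abs_le_iff)
      then show ?thesis unfolding I_def by simp linarith
    qed
    moreover have "\<psi>' x = (\<Sum>j\<in>I. if j = \<lfloor>\<psi> x / \<delta>\<rfloor> then \<delta> * of_int j else 0)"
      unfolding \<psi>'_def by (intro sum.cong) (auto simp: A_def x)
    ultimately have "\<psi>' x = \<delta> * of_int \<lfloor>\<psi> x / \<delta>\<rfloor>" by (simp add: I_def)
    moreover have "\<delta> * of_int \<lfloor>\<psi> x / \<delta>\<rfloor> \<le> \<psi> x" "\<psi> x \<le> \<delta> * of_int \<lfloor>\<psi> x / \<delta>\<rfloor> + \<delta>"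
    proof -
      have f: "of_int \<lfloor>\<psi> x / \<delta>\<rfloor> \<le> \<psi> x / \<delta>" "\<psi> x / \<delta> \<le> of_int \<lfloor>\<psi> x / \<delta>\<rfloor> + 1" by linarith+
      show "\<delta> * of_int \<lfloor>\<psi> x / \<delta>\<rfloor> \<le> \<psi> x" "\<psi> x \<le> \<delta> * of_int \<lfloor>\<psi> x / \<delta>\<rfloor> + \<delta>"
        using mult_left_mono[OF f(1) less_imp_le[OF \<delta>]] mult_left_mono[OF f(2) less_imp_le[OF \<delta>]] \<delta>
        by (simp_all add: distrib_left)
    qed
    ultimately show ?thesis by linarith
  qed
  have approx: "\<bar>integral\<^sup>L P \<psi> - (\<Sum>j\<in>I. \<delta> * of_int j * measure P (A j))\<bar> \<le> \<delta>"
    if P: "prob_space P" "sets P = sets M" for P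
  proof -
    interpret P: prob_space P by (rule P)
    have sp: "space P = space M" using P(2) by (rule sets_eq_imp_space_eq)
    have [measurable]: "A j \<in> sets P" "\<psi> \<in> borel_measurable P" for j
      using P(2) A \<psi>(1) by (auto simp: measurable_cong_sets[OF P(2) refl])
    have i1: "integrable P \<psi>" by (rule P.integrable_const_bound[where B=B]) (use \<psi> in auto)
    have i2: "integrable P (\<lambda>x. (\<delta> * of_int j) * indicator (A j) x)" for j
      by (intro integrable_mult_right integrable_real_indicator) (auto simp: P.emeasure_eq_measure)
    have "integral\<^sup>L P \<psi>' = (\<Sum>j\<in>I. \<delta> * of_int j * measure P (A j))"
      unfolding \<psi>'_def Bochner_Integration.integral_sum[OF i2] by simp
    moreover have i3: "integrable P \<psi>'" unfolding \<psi>'_def by (rule Bochner_Integration.integrable_sum[OF i2])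
    moreover have "\<bar>integral\<^sup>L P \<psi> - integral\<^sup>L P \<psi>'\<bar> \<le> (\<integral>x. \<bar>\<psi> x - \<psi>' x\<bar> \<partial>P)"
      unfolding Bochner_Integration.integral_diff[OF i1 i3, symmetric] by (rule integral_abs_bound)
    moreover have "(\<integral>x. \<bar>\<psi> x - \<psi>' x\<bar> \<partial>P) \<le> (\<integral>x. \<delta> \<partial>P)"
      using close i1 i3 by (intro integral_mono) (auto simp: sp)
    ultimately show ?thesis by (simp add: P.prob_space)
  qed
  have "(\<lambda>n. \<Sum>j\<in>I. \<delta> * of_int j * measure (N n) (A j)) \<longlonglongrightarrow> (\<Sum>j\<in>I. \<delta> * of_int j * measure M (A j))"
    by (intro tendsto_sum tendsto_mult tendsto_const lim A)
  from LIMSEQ_D[OF this \<delta>] obtain n0 where n0: "\<And>n. n \<ge> n0 \<Longrightarrow>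
      \<bar>(\<Sum>j\<in>I. \<delta> * of_int j * measure (N n) (A j)) - (\<Sum>j\<in>I. \<delta> * of_int j * measure M (A j))\<bar> < \<delta>"
    by auto
  have "norm (integral\<^sup>L (N n) \<psi> - integral\<^sup>L M \<psi>) < r" if "n \<ge> n0" for n
    using approx[OF N, of n] approx[OF M refl] n0[OF that] \<delta> unfolding real_norm_def \<delta>_def by linarith
  then show "\<exists>n0. \<forall>n\<ge>n0. norm (integral\<^sup>L (N n) \<psi> - integral\<^sup>L M \<psi>) < r" by blast
qed

text \<open>Mixing is extended in one argument only, from sets to integrable densities, by
  approximation in the mean. The other argument stays a set and is passed to bounded functions by
  \<open>setwise_imp_integral_tendsto\<close>.\<close>

lemma (in ergodic_system) mixing_integrable:
  fixes f :: "'a \<Rightarrow> real"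
  assumes mix: "mixing M T" and B: "B \<in> sets M" and f: "integrable M f"
  shows "(\<lambda>n. \<integral>x. f x * indicator ((T ^^ n) -` B \<inter> space M) x \<partial>M) \<longlonglongrightarrow> integral\<^sup>L M f * prob B"
  using f
proof (induct rule: integrable_induct)
  let ?E = "\<lambda>n. (T ^^ n) -` B \<inter> space M"
  have [measurable]: "?E n \<in> sets M" for n
    by (rule measurable_sets[OF measurable_compose_n[OF T_measurable] B])
  have int: "integrable M (\<lambda>x. f x * indicator (?E n) x)" if "integrable M f" for f :: "'a \<Rightarrow> real" and n
    using integrable_mult_indicator[of "?E n" M f] that by (simp add: mult.commute)
  {
    case (base A c)
    have "(\<integral>x. (indicator A x *\<^sub>R c) * indicator (?E n) x \<partial>M) = c * measure M (A \<inter> ?E n)" for n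
    proof -
      have "(\<integral>x. (indicator A x *\<^sub>R c) * indicator (?E n) x \<partial>M) = (\<integral>x. c * indicator (A \<inter> ?E n) x \<partial>M)"
        by (intro Bochner_Integration.integral_cong) (auto simp: indicator_def)
      then show ?thesis using base by simp
    qed
    moreover have "(\<lambda>n. c * measure M (A \<inter> ?E n)) \<longlonglongrightarrow> c * (measure M A * measure M B)"
      using mix base B unfolding mixing_def by (intro tendsto_mult tendsto_const) blast
    moreover have "(\<integral>x. indicator A x *\<^sub>R c \<partial>M) = c * measure M A" using base by (simp add: mult.commute)
    ultimately show ?case by (simp only: mult.assoc)
  next
    case (add f g)
    have "(\<integral>x. (f x + g x) * indicator (?E n) x \<partial>M) =
        (\<integral>x. f x * indicator (?E n) x \<partial>M) + (\<integral>x. g x * indicator (?E n) x \<partial>M)" for n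
      using int[OF add(1)] int[OF add(3)] by (simp add: distrib_right)
    then show ?case using tendsto_add[OF add(2) add(4)] add(1,3) by (simp add: distrib_right)
  next
    case (lim f s)
    have lim0: "(\<lambda>i. \<integral>x. \<bar>s i x - f x\<bar> \<partial>M) \<longlonglongrightarrow> (\<integral>x. 0 \<partial>M)"
    \<comment> \<open>The approximating functions are bounded by twice \<open>norm (f x)\<close>,
      hence their distance to \<open>f\<close> by three times.\<close>
    proof (rule integral_dominated_convergence[where w="\<lambda>x. 3 * norm (f x)"])
      show "AE x in M. (\<lambda>i. \<bar>s i x - f x\<bar>) \<longlonglongrightarrow> 0"
      proof (rule AE_I2)
        fix x assume x: "x \<in> space M"
        have "(\<lambda>i. \<bar>s i x - f x\<bar>) \<longlonglongrightarrow> \<bar>f x - f x\<bar>" by (intro tendsto_intros lim(3) x)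
        then show "(\<lambda>i. \<bar>s i x - f x\<bar>) \<longlonglongrightarrow> 0" by simp
      qed
      show "AE x in M. norm \<bar>s i x - f x\<bar> \<le> 3 * norm (f x)" for i
      proof (rule AE_I2)
        fix x assume "x \<in> space M"
        then show "norm \<bar>s i x - f x\<bar> \<le> 3 * norm (f x)" using lim(4)[of x i] by (simp add: abs_real_def split: if_splits)
      qed
    qed (use lim(1,5) in auto)
    show ?case
    proof (rule LIMSEQ_I)
      fix r :: real assume r: "0 < r"
      then have "0 < r / 3" by simp
      from LIMSEQ_D[OF lim0 this] obtain i where i: "(\<integral>x. \<bar>s i x - f x\<bar> \<partial>M) < r / 3" by auto
      from LIMSEQ_D[OF lim(2) \<open>0 < r / 3\<close>, of i] obtain n0 where
        n0: "\<And>n. n \<ge> n0 \<Longrightarrow> \<bar>(\<integral>x. s i x * indicator (?E n) x \<partial>M) - integral\<^sup>L M (s i) * prob B\<bar> < r / 3" by auto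
      have a: "\<bar>(\<integral>x. f x * indicator (?E n) x \<partial>M) - (\<integral>x. s i x * indicator (?E n) x \<partial>M)\<bar> \<le> (\<integral>x. \<bar>s i x - f x\<bar> \<partial>M)" for n
      proof -
        have "(\<integral>x. f x * indicator (?E n) x \<partial>M) - (\<integral>x. s i x * indicator (?E n) x \<partial>M) =
            (\<integral>x. f x * indicator (?E n) x - s i x * indicator (?E n) x \<partial>M)"
          by (rule Bochner_Integration.integral_diff[symmetric, OF int[OF lim(5)] int[OF lim(1)]])
        also have "\<bar>\<dots>\<bar> \<le> (\<integral>x. \<bar>f x * indicator (?E n) x - s i x * indicator (?E n) x\<bar> \<partial>M)" by (rule integral_abs_bound)
        also have "\<dots> \<le> (\<integral>x. \<bar>s i x - f x\<bar> \<partial>M)"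
        proof (rule integral_mono)
          show "integrable M (\<lambda>x. \<bar>f x * indicator (?E n) x - s i x * indicator (?E n) x\<bar>)"
            by (intro integrable_abs Bochner_Integration.integrable_diff int lim)
          show "integrable M (\<lambda>x. \<bar>s i x - f x\<bar>)"
            by (intro integrable_abs Bochner_Integration.integrable_diff lim)
        qed (auto simp: indicator_def)
        finally show ?thesis .
      qed
      have b: "\<bar>integral\<^sup>L M (s i) * prob B - integral\<^sup>L M f * prob B\<bar> \<le> (\<integral>x. \<bar>s i x - f x\<bar> \<partial>M)"
      proof -
        have "\<bar>integral\<^sup>L M (s i) * prob B - integral\<^sup>L M f * prob B\<bar> = \<bar>integral\<^sup>L M (s i) - integral\<^sup>L M f\<bar> * prob B"
          by (simp add: left_diff_distrib[symmetric] abs_mult)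
        also have "\<dots> \<le> \<bar>integral\<^sup>L M (s i) - integral\<^sup>L M f\<bar> * 1" by (intro mult_left_mono) auto
        also have "\<bar>integral\<^sup>L M (s i) - integral\<^sup>L M f\<bar> = \<bar>\<integral>x. s i x - f x \<partial>M\<bar>"
          by (subst Bochner_Integration.integral_diff) (auto intro: lim)
        also have "\<bar>\<integral>x. s i x - f x \<partial>M\<bar> * 1 \<le> (\<integral>x. \<bar>s i x - f x\<bar> \<partial>M)" using integral_abs_bound[of M "\<lambda>x. s i x - f x"] by simp
        finally show ?thesis .
      qed
      have "norm ((\<integral>x. f x * indicator (?E n) x \<partial>M) - integral\<^sup>L M f * prob B) < r" if "n \<ge> n0" for n
        using a[of n] b i n0[OF that] unfolding real_norm_def by linarith
      then show "\<exists>n0. \<forall>n\<ge>n0. norm ((\<integral>x. f x * indicator (?E n) x \<partial>M) - integral\<^sup>L M f * prob B) < r" by blast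
    qed
  }
qed

section \<open>Absolute continuity of the base measure\<close>

context modelled_by_Young_tower
begin

abbreviation "FY \<equiv> \<lambda>y. (T ^^ \<phi> y) y"

lemma space_\<mu>\<^sub>Y: "space \<mu>\<^sub>Y = Y"
  by (rule base.Y_borel(1))

lemma space_\<mu>: "space \<mu> = UNIV"
  using sets_eq_imp_space_eq[OF M_borel] by simp

lemma measurable_\<phi> [measurable]: "\<phi> \<in> \<mu>\<^sub>Y \<rightarrow>\<^sub>M count_space UNIV"
proof -
  have [measurable]: "(\<lambda>y. real (\<phi> y)) \<in> borel_measurable \<mu>\<^sub>Y" using \<phi>_integrable by auto
  have "(\<lambda>y. nat \<lfloor>real (\<phi> y)\<rfloor>) \<in> \<mu>\<^sub>Y \<rightarrow>\<^sub>M count_space UNIV" by measurable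
  then show ?thesis by simp
qed

lemma sets_tower: "tower Y \<phi> \<in> sets (\<mu>\<^sub>Y \<Otimes>\<^sub>M count_space UNIV)"
proof -
  have "tower Y \<phi> = (\<Union>l. {y \<in> space \<mu>\<^sub>Y. l < \<phi> y} \<times> {l})"
    by (auto simp: tower_def space_\<mu>\<^sub>Y)
  also have "\<dots> \<in> sets (\<mu>\<^sub>Y \<Otimes>\<^sub>M count_space UNIV)"
  proof (rule sets.countable_UN)
    have "{y \<in> space \<mu>\<^sub>Y. l < \<phi> y} \<in> sets \<mu>\<^sub>Y" for l by measurable
    then show "range (\<lambda>l. {y \<in> space \<mu>\<^sub>Y. l < \<phi> y} \<times> {l}) \<subseteq> sets (\<mu>\<^sub>Y \<Otimes>\<^sub>M count_space UNIV)"
      by (auto intro!: pair_measureI)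
  qed
  finally show ?thesis .
qed

lemma sets_tower_measure: "sets (tower_measure \<mu>\<^sub>Y \<phi>) = sets (restrict_space (\<mu>\<^sub>Y \<Otimes>\<^sub>M count_space UNIV) (tower Y \<phi>))"
  by (simp add: tower_measure_def space_\<mu>\<^sub>Y)

lemma space_tower_measure: "space (tower_measure \<mu>\<^sub>Y \<phi>) = tower Y \<phi>"
  using sets.sets_into_space[OF sets_tower]
  by (auto simp: sets_eq_imp_space_eq[OF sets_tower_measure] space_restrict_space)

text \<open>The sets of \<open>\<mu>\<^sub>Y\<close> are the Borel sets of \<open>d\<close>, a
  metric that is not tied to the ambient one. Measurability comes from the tower: the inclusion is
  the projection to \<open>M\<close> restricted to level 0.\<close>

lemma measurable_inclusion [measurable]: "(\<lambda>y. y) \<in> \<mu>\<^sub>Y \<rightarrow>\<^sub>M \<mu>"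
proof -
  have "(\<lambda>y. (y, 0::nat)) \<in> \<mu>\<^sub>Y \<rightarrow>\<^sub>M restrict_space (\<mu>\<^sub>Y \<Otimes>\<^sub>M count_space UNIV) (tower Y \<phi>)"
    by (rule measurable_restrict_space2) (auto simp: tower_def space_\<mu>\<^sub>Y \<phi>_positive)
  then have 1: "(\<lambda>y. (y, 0::nat)) \<in> \<mu>\<^sub>Y \<rightarrow>\<^sub>M tower_measure \<mu>\<^sub>Y \<phi>"
    by (simp add: measurable_cong_sets[OF refl sets_tower_measure])
  have 2: "(\<lambda>(y, l). (T ^^ l) y) \<in> tower_measure \<mu>\<^sub>Y \<phi> \<rightarrow>\<^sub>M \<mu>"
    using \<pi>\<^sub>M by (simp add: mp_semiconjugacy_def)
  show ?thesis using measurable_comp[OF 1 2] by (simp add: comp_def)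
qed

text \<open>Level 0 of the tower is a copy of \<open>Y\<close>. Its mass under the tower measure is
  that under \<open>\<mu>\<^sub>Y\<close> divided by the mean return time, and the tower measure
  projects to \<mu>.\<close>

lemma base_le:
  assumes B: "B \<in> sets \<mu>" "measure \<mu> B = 0" shows "measure \<mu>\<^sub>Y (B \<inter> Y) = 0"
proof -
  let ?c = "LINT y|\<mu>\<^sub>Y. real (\<phi> y)" and ?h = "\<lambda>(y, l). (T ^^ l) y" and ?P = "\<mu>\<^sub>Y \<Otimes>\<^sub>M count_space (UNIV :: nat set)"
  interpret C: sigma_finite_measure "count_space (UNIV :: nat set)"
    by (rule sigma_finite_measure_count_space)
  have "(\<integral>y. 1 \<partial>\<mu>\<^sub>Y) \<le> ?c"
    using \<phi>_integrable \<phi>_positive by (intro integral_mono) (auto simp: space_\<mu>\<^sub>Y Suc_le_eq)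
  then have c: "0 < ?c" by (simp add: base.prob_space)
  have BY: "B \<inter> Y \<in> sets \<mu>\<^sub>Y" using measurable_sets[OF measurable_inclusion B(1)] by (simp add: space_\<mu>\<^sub>Y)
  have h: "?h \<in> tower_measure \<mu>\<^sub>Y \<phi> \<rightarrow>\<^sub>M \<mu>" "distr (tower_measure \<mu>\<^sub>Y \<phi>) \<mu> ?h = \<mu>"
    using \<pi>\<^sub>M by (auto simp: mp_semiconjugacy_def)
  let ?E = "?h -` B \<inter> tower Y \<phi>"
  have E: "?E \<in> sets (restrict_space ?P (tower Y \<phi>))"
    using measurable_sets[OF h(1) B(1)] by (simp add: space_tower_measure sets_tower_measure)
  then have EP: "?E \<in> sets ?P" using sets_tower by (simp add: sets_restrict_space_iff)
  have "0 = emeasure \<mu> B" using B by (simp add: emeasure_eq_measure)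
  also have "\<dots> = emeasure (tower_measure \<mu>\<^sub>Y \<phi>) ?E"
    using emeasure_distr[OF h(1) B(1)] by (simp add: h(2) space_tower_measure)
  also have "\<dots> = ennreal (1 / ?c) * emeasure ?P ?E"
    unfolding tower_measure_def space_\<mu>\<^sub>Y using sets_tower
    by (simp add: emeasure_restrict_space)
  finally have "emeasure ?P ?E = 0" using c by (simp add: ennreal_eq_0_iff not_le[symmetric])
  moreover have "emeasure \<mu>\<^sub>Y (B \<inter> Y) * emeasure (count_space UNIV) {0::nat} = emeasure ?P ((B \<inter> Y) \<times> {0})"
    using BY by (intro C.emeasure_pair_measure_Times[symmetric]) auto
  moreover have "emeasure ?P ((B \<inter> Y) \<times> {0}) \<le> emeasure ?P ?E"
    using EP \<phi>_positive by (intro emeasure_mono) (auto simp: tower_def)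
  ultimately have "emeasure \<mu>\<^sub>Y (B \<inter> Y) = 0" by simp
  then show ?thesis by (simp add: measure_def)
qed

text \<open>Since \<open>\<mu>\<^sub>Y\<close> is absolutely continuous with respect to \<open>\<mu>\<close>, mixing applies to its density.\<close>

lemma mixing_base:
  fixes \<psi> :: "'m \<Rightarrow> real"
  assumes mix: "mixing \<mu> T" and \<psi>: "\<psi> \<in> borel_measurable \<mu>" "\<And>x. \<bar>\<psi> x\<bar> \<le> B"
  shows "(\<lambda>n. \<integral>y. \<psi> ((T ^^ n) y) \<partial>\<mu>\<^sub>Y) \<longlonglongrightarrow> integral\<^sup>L \<mu> \<psi>"
proof -
  define \<nu> where "\<nu> = distr \<mu>\<^sub>Y \<mu> (\<lambda>y. y)"
  interpret \<nu>: prob_space \<nu> unfolding \<nu>_def by (rule base.prob_space_distr) measurable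
  have sets_\<nu> [measurable_cong]: "sets \<nu> = sets \<mu>" by (simp add: \<nu>_def)
  have meas_\<nu>: "emeasure \<nu> A = emeasure \<mu>\<^sub>Y (A \<inter> Y)" if "A \<in> sets \<mu>" for A
    unfolding \<nu>_def using that by (simp add: emeasure_distr space_\<mu>\<^sub>Y)
  have ac: "absolutely_continuous \<mu> \<nu>"
    unfolding absolutely_continuous_def
  proof
    fix A assume A: "A \<in> null_sets \<mu>"
    then have "measure \<mu>\<^sub>Y (A \<inter> Y) = 0" by (intro base_le) (auto simp: measure_def null_sets_def)
    then have "emeasure \<nu> A = 0" using meas_\<nu>[of A] A by (auto simp: base.emeasure_eq_measure null_sets_def)
    then show "A \<in> null_sets \<nu>" using A sets_\<nu> by (auto simp: null_sets_def)
  qed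
  obtain D where D: "D \<in> borel_measurable \<mu>" "AE x in \<mu>. RN_deriv \<mu> \<nu> x = ennreal (D x)" "\<And>x. 0 \<le> D x"
    using real_RN_deriv[OF \<nu>.finite_measure_axioms ac sets_\<nu>] by metis
  note D(1) [measurable]
  have "density \<mu> (RN_deriv \<mu> \<nu>) = \<nu>" by (rule density_RN_deriv[OF ac sets_\<nu>])
  moreover have "density \<mu> (RN_deriv \<mu> \<nu>) = density \<mu> (\<lambda>x. ennreal (D x))"
    using D by (intro density_cong) auto
  ultimately have dens: "\<nu> = density \<mu> (\<lambda>x. ennreal (D x))" by simp
  have "integrable \<nu> (\<lambda>_. 1::real)" by simp
  then have intD: "integrable \<mu> D" unfolding dens
    using D by (subst (asm) integrable_density) auto
  have \<nu>_int: "integral\<^sup>L \<nu> f = (\<integral>x. D x * f x \<partial>\<mu>)" if "f \<in> borel_measurable \<mu>" for f :: "'m \<Rightarrow> real"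
    unfolding dens using that D by (subst integral_density) auto
  have D1: "integral\<^sup>L \<mu> D = 1" using \<nu>_int[of "\<lambda>_. 1"] by (simp add: \<nu>.prob_space)
  have Tn [measurable]: "(T ^^ n) \<in> \<mu> \<rightarrow>\<^sub>M \<mu>" for n by (rule measurable_compose_n[OF T_measurable])
  have Tn\<nu>: "(T ^^ n) \<in> \<nu> \<rightarrow>\<^sub>M \<mu>" for n using Tn[of n] by (simp add: measurable_cong_sets[OF sets_\<nu> refl])
  have "(\<lambda>n. integral\<^sup>L (distr \<nu> \<mu> (T ^^ n)) \<psi>) \<longlonglongrightarrow> integral\<^sup>L \<mu> \<psi>"
  proof (rule setwise_imp_integral_tendsto[OF _ _ prob_space_axioms _ \<psi>])
    show "prob_space (distr \<nu> \<mu> (T ^^ n))" for n by (rule \<nu>.prob_space_distr[OF Tn\<nu>])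
    fix A assume A [measurable]: "A \<in> sets \<mu>"
    have "measure (distr \<nu> \<mu> (T ^^ n)) A = (\<integral>x. D x * indicator ((T ^^ n) -` A \<inter> space \<mu>) x \<partial>\<mu>)" for n
    proof -
      have E: "(T ^^ n) -` A \<inter> space \<mu> \<in> sets \<mu>" by measurable
      have "measure (distr \<nu> \<mu> (T ^^ n)) A = measure \<nu> ((T ^^ n) -` A \<inter> space \<mu>)"
        by (subst measure_distr[OF Tn\<nu> A]) (simp add: sets_eq_imp_space_eq[OF sets_\<nu>])
      also have "\<dots> = integral\<^sup>L \<nu> (indicator ((T ^^ n) -` A \<inter> space \<mu>))" using E by (simp add: sets_\<nu>)
      also have "\<dots> = (\<integral>x. D x * indicator ((T ^^ n) -` A \<inter> space \<mu>) x \<partial>\<mu>)" using E by (intro \<nu>_int) auto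
      finally show ?thesis .
    qed
    then show "(\<lambda>n. measure (distr \<nu> \<mu> (T ^^ n)) A) \<longlonglongrightarrow> measure \<mu> A"
      using mixing_integrable[OF mix A intD] by (simp add: D1)
  qed auto
  moreover have "integral\<^sup>L (distr \<nu> \<mu> (T ^^ n)) \<psi> = (\<integral>y. \<psi> ((T ^^ n) y) \<partial>\<mu>\<^sub>Y)" for n
  proof -
    note \<psi>(1) [measurable]
    have "integral\<^sup>L (distr \<nu> \<mu> (T ^^ n)) \<psi> = (\<integral>x. \<psi> ((T ^^ n) x) \<partial>\<nu>)" by (rule integral_distr[OF Tn\<nu> \<psi>(1)])
    also have "\<dots> = (\<integral>y. \<psi> ((T ^^ n) y) \<partial>\<mu>\<^sub>Y)" unfolding \<nu>_def by (rule integral_distr) measurable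
    finally show ?thesis .
  qed
  ultimately show ?thesis by simp
qed

end

subsection \<open>The two-sided tower\<close>

locale Young_tower_decay = modelled_by_Young_tower \<mu> T Y \<phi> d \<mu>\<^sub>Y \<mu>b Fb \<alpha> \<pi>b K \<theta>\<^sub>0
  for \<mu> :: "'m::metric_space measure" and T :: "'m \<Rightarrow> 'm"
    and Y :: "'m set" and \<phi> :: "'m \<Rightarrow> nat" and d :: "'m \<Rightarrow> 'm \<Rightarrow> real" and \<mu>\<^sub>Y :: "'m measure"
    and \<mu>b :: "'b measure" and Fb :: "'b \<Rightarrow> 'b" and \<alpha> :: "'b set set" and \<pi>b :: "'m \<Rightarrow> 'b"
    and K \<theta>\<^sub>0 :: real +
  fixes \<beta> \<theta> A :: real
  assumes \<beta>: "1 < \<beta>" and \<theta>: "0 < \<theta>" "\<theta> < 1" and mix: "mixing \<mu> T"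
    and tail: "\<And>n. measure \<mu>\<^sub>Y {y \<in> Y. n < \<phi> y} \<le> A * decay \<beta> n"
begin

text \<open>The return time on the quotient; cells that are not met by the semiconjugacy get the value \<open>1\<close>.\<close>

definition \<phi>b :: "'b \<Rightarrow> nat" where
  "\<phi>b z = (if \<exists>y\<in>Y. \<exists>a\<in>\<alpha>. z \<in> a \<and> \<pi>b y \<in> a then \<phi> (SOME y. y \<in> Y \<and> (\<exists>a\<in>\<alpha>. z \<in> a \<and> \<pi>b y \<in> a)) else 1)"

lemma \<pi>b_measurable [measurable]: "\<pi>b \<in> \<mu>\<^sub>Y \<rightarrow>\<^sub>M \<mu>b"
  and distr_\<pi>b: "distr \<mu>\<^sub>Y \<mu>b \<pi>b = \<mu>b"
  and \<pi>b_FY: "y \<in> Y \<Longrightarrow> \<pi>b (FY y) = Fb (\<pi>b y)"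
  using base.\<pi>b by (auto simp: mp_semiconjugacy_def space_\<mu>\<^sub>Y)

lemma \<pi>b_space: "y \<in> Y \<Longrightarrow> \<pi>b y \<in> space \<mu>b"
  using measurable_space[OF \<pi>b_measurable] by (simp add: space_\<mu>\<^sub>Y)

lemma cell_unique: "a \<in> \<alpha> \<Longrightarrow> b \<in> \<alpha> \<Longrightarrow> z \<in> a \<Longrightarrow> z \<in> b \<Longrightarrow> a = b"
  using base.bar.partition(1) by (auto simp: partition_on_def disjoint_def)

lemma \<phi>b_cell: 
  assumes "a \<in> \<alpha>" "z \<in> a" "z' \<in> a" shows "\<phi>b z = \<phi>b z'"
proof -
  have "(\<exists>b\<in>\<alpha>. w \<in> b \<and> \<pi>b y \<in> b) \<longleftrightarrow> \<pi>b y \<in> a" if "w \<in> a" for w y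
    using cell_unique assms(1) that by blast
  then show ?thesis using assms by (simp add: \<phi>b_def)
qed

lemma \<phi>b_\<pi>b:
  assumes y: "y \<in> Y" shows "\<phi>b (\<pi>b y) = \<phi> y"
proof -
  obtain a where a: "a \<in> \<alpha>" "\<pi>b y \<in> a"
    using \<pi>b_space[OF y] base.bar.partition(1) by (auto simp: partition_on_def)
  let ?P = "\<lambda>y'. y' \<in> Y \<and> (\<exists>b\<in>\<alpha>. \<pi>b y \<in> b \<and> \<pi>b y' \<in> b)"
  have "?P (SOME y'. ?P y')" by (rule someI[of _ y]) (use y a in auto)
  then have "(SOME y'. ?P y') \<in> \<pi>b -` a \<inter> Y" using cell_unique[OF a(1)] a(2) by blast
  moreover have "y \<in> \<pi>b -` a \<inter> Y" using y a by auto
  ultimately have "\<phi> (SOME y'. ?P y') = \<phi> y" using \<phi>_constant[OF a(1)] by (auto simp: constant_on_def)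
  moreover have "\<phi>b (\<pi>b y) = \<phi> (SOME y'. ?P y')" unfolding \<phi>b_def using y a by auto
  ultimately show ?thesis by simp
qed

sublocale GM: Gibbs_Markov_tower \<mu>b Fb \<alpha> K \<theta>\<^sub>0 \<phi>b \<beta> A
proof unfold_locales
  fix z assume "z \<in> space \<mu>b"
  show "0 < \<phi>b z"
  proof (cases "\<exists>y\<in>Y. \<exists>a\<in>\<alpha>. z \<in> a \<and> \<pi>b y \<in> a")
    case True
    let ?P = "\<lambda>y. y \<in> Y \<and> (\<exists>a\<in>\<alpha>. z \<in> a \<and> \<pi>b y \<in> a)"
    have "?P (SOME y. ?P y)" using True by (intro someI_ex[of ?P]) blast
    then show ?thesis using \<phi>_positive True by (simp add: \<phi>b_def)
  next
    case False
    then show ?thesis by (simp only: \<phi>b_def if_False zero_less_one)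
  qed
next
  fix n
  have A0: "0 \<le> A" using order_trans[OF measure_nonneg tail[of 0]] by simp
  \<comment> \<open>Measurability of \<open>\<phi>b\<close> is derived inside the locale and is not
    yet available here. A set that is not measurable has \<open>measure\<close> 0 by default, so the
    bound holds in either case.\<close>
  show "measure \<mu>b {z \<in> space \<mu>b. n < \<phi>b z} \<le> A * decay \<beta> n"
  proof (cases "{z \<in> space \<mu>b. n < \<phi>b z} \<in> sets \<mu>b")
    case True
    have "measure \<mu>b {z \<in> space \<mu>b. n < \<phi>b z} = measure (distr \<mu>\<^sub>Y \<mu>b \<pi>b) {z \<in> space \<mu>b. n < \<phi>b z}"
      by (simp only: distr_\<pi>b)
    also have "\<dots> = measure \<mu>\<^sub>Y (\<pi>b -` {z \<in> space \<mu>b. n < \<phi>b z} \<inter> space \<mu>\<^sub>Y)"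
      by (rule measure_distr[OF \<pi>b_measurable True])
    also have "\<pi>b -` {z \<in> space \<mu>b. n < \<phi>b z} \<inter> space \<mu>\<^sub>Y = {y \<in> Y. n < \<phi> y}"
      using \<pi>b_space by (auto simp: space_\<mu>\<^sub>Y \<phi>b_\<pi>b)
    finally show ?thesis using tail[of n] by simp
  next
    case False
    then show ?thesis using A0 by (simp add: measure_notin_sets)
  qed
next
  fix a z z' assume "a \<in> \<alpha>" "z \<in> a" "z' \<in> a"
  then show "\<phi>b z = \<phi>b z'" by (rule \<phi>b_cell)
qed (rule \<beta>)

lemma FY_Y: "y \<in> Y \<Longrightarrow> FY y \<in> Y"
  using measurable_space[OF base.T_measurable] by (simp add: space_\<mu>\<^sub>Y)

lemma FYn_Y: "y \<in> Y \<Longrightarrow> (FY ^^ n) y \<in> Y"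
  by (induction n) (auto intro: FY_Y)

lemma \<pi>b_FYn: "y \<in> Y \<Longrightarrow> \<pi>b ((FY ^^ n) y) = (Fb ^^ n) (\<pi>b y)"
  by (induction n) (auto simp: \<pi>b_FY FYn_Y)

text \<open>The return times factor through the quotient, so the number of returns and the level at
  time \<open>n\<close> can be read off from \<open>\<pi>b y\<close>, although the point itself
  moves in \<open>Y\<close>.\<close>

lemma T_eq_pos:
  assumes "y \<in> Y"
  shows "fst (GM.pos n (\<pi>b y)) = \<pi>b ((FY ^^ GM.rt n (\<pi>b y)) y) \<and>
    snd (GM.pos n (\<pi>b y)) < \<phi> ((FY ^^ GM.rt n (\<pi>b y)) y) \<and>
    (T ^^ n) y = (T ^^ snd (GM.pos n (\<pi>b y))) ((FY ^^ GM.rt n (\<pi>b y)) y)"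
  using assms
proof (induction n arbitrary: y rule: less_induct)
  case (less n)
  note y = less.prems
  show ?case
  proof (cases "n < \<phi> y")
    case True
    then show ?thesis using y by (simp add: GM.pos_less GM.ret_less \<phi>b_\<pi>b)
  next
    case False
    have "(T ^^ n) y = (T ^^ (n - \<phi> y)) (FY y)"
      using False by (simp flip: comp_apply[of "T ^^ (n - \<phi> y)"] funpow_add)
    then show ?thesis
      using False less.IH[of "n - \<phi> y" "FY y"] \<phi>_positive[OF y] FY_Y[OF y] \<pi>b_space[OF y]
      by (simp add: GM.pos_ge GM.ret_ge \<phi>b_\<pi>b y \<pi>b_FY funpow_Suc_right del: funpow.simps(2))
  qed
qed

section \<open>Symbolic approximation of observables\<close>

definition x\<^sub>0 :: real where "x\<^sub>0 = max \<theta> \<theta>\<^sub>0"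

lemma x\<^sub>0: "0 < x\<^sub>0" "x\<^sub>0 < 1" "0 \<le> x\<^sub>0" "x\<^sub>0 \<le> 1"
  using \<theta> base.bar.\<theta>\<^sub>0 by (auto simp: x\<^sub>0_def)

abbreviation "sp \<equiv> \<lambda>y y'. separation_time Fb \<alpha> (\<pi>b y) (\<pi>b y')"

text \<open>After \<open>GM.rt n (\<pi>b y)\<close> returns the two orbits have contracted by the
  past returns and still share the remaining cells, which gives the two powers. Of the constant
  \<open>K + 1\<close>, the part \<open>K\<close> comes from the distance \<open>d\<close> and 1
  from the symbolic part of the seminorm.\<close>

lemma shadow:
  assumes y: "y \<in> Y" and r: "r \<in> Y"
    and agree: "\<And>i. i < j \<Longrightarrow> GM.cell ((Fb ^^ i) (\<pi>b y)) = GM.cell ((Fb ^^ i) (\<pi>b r))"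
    and k: "GM.rt n (\<pi>b y) < j" and h: "0 \<le> h"
    and v: "\<And>a b l. a \<in> Y \<Longrightarrow> b \<in> Y \<Longrightarrow> l < \<phi> a \<Longrightarrow>
      \<bar>v ((T ^^ l) a) - v ((T ^^ l) b)\<bar> \<le> h * (d a b + epow \<theta> (sp a b))"
  shows "\<bar>v ((T ^^ n) y) - v ((T ^^ n) r)\<bar> \<le>
    h * (K * x\<^sub>0 ^ GM.rt n (\<pi>b y) + (K + 1) * x\<^sub>0 ^ (j - GM.rt n (\<pi>b y)))"
proof -
  define k where "k = GM.rt n (\<pi>b y)"
  have kj: "k < j" using k by (simp add: k_def)
  note \<pi>y = \<pi>b_space[OF y] and \<pi>r = \<pi>b_space[OF r]
  have kr: "GM.rt n (\<pi>b r) = k" unfolding k_def by (rule GM.ret_cong[OF \<pi>y \<pi>r agree k])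
  \<comment> \<open>Common cells mean common return times, so both orbits are on the same level at
    time \<open>n\<close> and the seminorm can be applied to them.\<close>
  have "(\<Sum>i<k. \<phi>b ((Fb ^^ i) (\<pi>b y))) = (\<Sum>i<k. \<phi>b ((Fb ^^ i) (\<pi>b r)))"
    using kj agree by (intro sum.cong refl GM.cell_eq_imp_\<phi>_eq GM.Fn_space \<pi>y \<pi>r) auto
  then have l: "snd (GM.pos n (\<pi>b r)) = snd (GM.pos n (\<pi>b y))"
    using GM.pos_time[OF \<pi>y, of n] GM.pos_time[OF \<pi>r, of n] by (simp add: kr k_def[symmetric])
  let ?a = "(FY ^^ k) y" and ?b = "(FY ^^ k) r" and ?l = "snd (GM.pos n (\<pi>b y))"
  have ab: "?a \<in> Y" "?b \<in> Y" by (intro FYn_Y y r)+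
  have T: "(T ^^ n) y = (T ^^ ?l) ?a" "(T ^^ n) r = (T ^^ ?l) ?b" "?l < \<phi> ?a"
    using T_eq_pos[OF y, of n] T_eq_pos[OF r, of n] by (simp_all add: kr l k_def[symmetric])
  have K: "0 < K" by (rule base.bar.K_pos)
  have "enat j \<le> sp y r" by (rule GM.separation_ge[OF \<pi>y \<pi>r agree])
  then have "epow_shift \<theta>\<^sub>0 (sp y r) k \<le> \<theta>\<^sub>0 ^ (j - k)"
    using base.bar.\<theta>\<^sub>0 kj by (intro epow_shift_le) auto
  then have "d ?a ?b \<le> K * (\<theta>\<^sub>0 ^ k + \<theta>\<^sub>0 ^ (j - k))"
    using base.contraction[OF y r, of k] K by (meson add_left_mono le_less mult_left_mono order_trans)
  also have "\<dots> \<le> K * (x\<^sub>0 ^ k + x\<^sub>0 ^ (j - k))"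
    using K base.bar.\<theta>\<^sub>0 by (intro mult_left_mono add_mono power_mono) (auto simp: x\<^sub>0_def)
  finally have d: "d ?a ?b \<le> K * (x\<^sub>0 ^ k + x\<^sub>0 ^ (j - k))" .
  have "enat (j - k) \<le> sp ?a ?b"
  proof (rule GM.separation_ge)
    fix i assume "i < j - k"
    then show "GM.cell ((Fb ^^ i) (\<pi>b ?a)) = GM.cell ((Fb ^^ i) (\<pi>b ?b))"
      using agree[of "i + k"] by (simp add: \<pi>b_FYn y r funpow_add)
  qed (use ab \<pi>b_space in auto)
  then have "epow \<theta> (sp ?a ?b) \<le> epow \<theta> (enat (j - k))" using \<theta> by (intro epow_antimono) auto
  also have "\<dots> \<le> x\<^sub>0 ^ (j - k)" unfolding epow_shift_enat using \<theta> by (intro power_mono) (auto simp: x\<^sub>0_def)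
  finally have e: "epow \<theta> (sp ?a ?b) \<le> x\<^sub>0 ^ (j - k)" .
  have "\<bar>v ((T ^^ n) y) - v ((T ^^ n) r)\<bar> \<le> h * (d ?a ?b + epow \<theta> (sp ?a ?b))"
    unfolding T(1,2) by (rule v[OF ab T(3)])
  also have "\<dots> \<le> h * (K * (x\<^sub>0 ^ k + x\<^sub>0 ^ (j - k)) + x\<^sub>0 ^ (j - k))" using h d e by (intro mult_left_mono add_mono)
  finally show ?thesis by (simp add: k_def algebra_simps)
qed

lemma T_pow_measurable: "(\<lambda>y. (T ^^ n) y) \<in> \<mu>\<^sub>Y \<rightarrow>\<^sub>M \<mu>"
  by (rule measurable_compose[OF measurable_inclusion measurable_compose_n[OF T_measurable]])

lemma integral_\<pi>b:
  fixes g :: "'b \<Rightarrow> real"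
  assumes "g \<in> borel_measurable \<mu>b" shows "(\<integral>y. g (\<pi>b y) \<partial>\<mu>\<^sub>Y) = integral\<^sup>L \<mu>b g"
  using integral_distr[OF \<pi>b_measurable assms] by (simp add: distr_\<pi>b)

text \<open>Evaluating the observable at a representative turns it into a function of the word. The
  approximation uses only words of points in \<open>Y\<close>; at other words the representative is
  unspecified and only the bound on the observable is used.\<close>

definition rep_word :: "nat \<Rightarrow> 'b set list \<Rightarrow> 'm" where
  "rep_word m w = (SOME r. r \<in> Y \<and> GM.wd m (\<pi>b r) = w)"

definition rep_pre :: "nat \<Rightarrow> 'b set list \<Rightarrow> 'm" where
  "rep_pre L w = (SOME r. r \<in> Y \<and> GM.pre L (\<pi>b r) = w)"

lemma rep_word: 
  assumes "y \<in> Y" 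
  shows "rep_word m (GM.wd m (\<pi>b y)) \<in> Y" "GM.wd m (\<pi>b (rep_word m (GM.wd m (\<pi>b y)))) = GM.wd m (\<pi>b y)"
proof -
  let ?P = "\<lambda>r. r \<in> Y \<and> GM.wd m (\<pi>b r) = GM.wd m (\<pi>b y)"
  have "?P (SOME r. ?P r)" by (rule someI[of ?P y]) (simp add: assms)
  then have *: "?P (rep_word m (GM.wd m (\<pi>b y)))" by (simp only: rep_word_def)
  show "rep_word m (GM.wd m (\<pi>b y)) \<in> Y" by (rule conjunct1[OF *])
  show "GM.wd m (\<pi>b (rep_word m (GM.wd m (\<pi>b y)))) = GM.wd m (\<pi>b y)" by (rule conjunct2[OF *])
qed

lemma rep_pre:
  assumes "y \<in> Y" 
  shows "rep_pre L (GM.pre L (\<pi>b y)) \<in> Y" "GM.pre L (\<pi>b (rep_pre L (GM.pre L (\<pi>b y)))) = GM.pre L (\<pi>b y)"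
proof -
  let ?P = "\<lambda>r. r \<in> Y \<and> GM.pre L (\<pi>b r) = GM.pre L (\<pi>b y)"
  have "?P (SOME r. ?P r)" by (rule someI[of ?P y]) (simp add: assms)
  then have *: "?P (rep_pre L (GM.pre L (\<pi>b y)))" by (simp only: rep_pre_def)
  show "rep_pre L (GM.pre L (\<pi>b y)) \<in> Y" by (rule conjunct1[OF *])
  show "GM.pre L (\<pi>b (rep_pre L (GM.pre L (\<pi>b y)))) = GM.pre L (\<pi>b y)" by (rule conjunct2[OF *])
qed

text \<open>The second orbit is restarted so that the original time \<open>t\<close> becomes its
  time \<open>s\<close>. With \<open>s = t\<close> and equal points this is the original orbit,
  provided the times after the gap are at least \<open>t\<close>; with \<open>s\<close> later by a
  multiple of the period it is the decoupled pair. One approximation thus serves both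
  integrals.\<close>

definition joined :: "nat \<Rightarrow> nat \<Rightarrow> (nat \<Rightarrow> nat) \<Rightarrow> nat \<Rightarrow> nat \<Rightarrow> 'm \<Rightarrow> 'm \<Rightarrow> nat \<Rightarrow> 'm" where
  "joined q p \<tau> t s y\<^sub>0 y\<^sub>1 = (\<lambda>i\<in>{..<q}. if i < p then (T ^^ \<tau> i) y\<^sub>0 else (T ^^ (s + (\<tau> i - t))) y\<^sub>1)"

definition symbolic :: "nat \<Rightarrow> nat \<Rightarrow> (nat \<Rightarrow> nat) \<Rightarrow> nat \<Rightarrow> nat \<Rightarrow> nat \<Rightarrow> 'b set list \<Rightarrow> 'b \<times> nat \<Rightarrow> nat \<Rightarrow> 'm" where
  "symbolic q p \<tau> t m L w zl = (\<lambda>i\<in>{..<q}. if i < p then (T ^^ \<tau> i) (rep_word m w)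
     else (T ^^ (snd zl + (\<tau> i - t))) (rep_pre L (GM.pre L (fst zl))))"

text \<open>Each error has one term for contraction in the past and one for cells still shared in
  the future. Before the gap these are the returns up to \<open>n\<^sub>0\<close> and those between
  \<open>t\<close> and \<open>m\<close>; in \<open>errF\<close>, after the gap, they are the returns
  between \<open>s\<close> and \<open>s + u\<close> and the \<open>g\<close> spare cells.\<close>

definition errP :: "nat \<Rightarrow> nat \<Rightarrow> nat \<Rightarrow> 'b \<Rightarrow> real" where
  "errP n\<^sub>0 t m z = K * x\<^sub>0 ^ GM.rt n\<^sub>0 z + (K + 1) * x\<^sub>0 ^ (GM.rt m z - GM.rt t z)"

definition errF :: "nat \<Rightarrow> nat \<Rightarrow> nat \<Rightarrow> 'b \<Rightarrow> real" where
  "errF s u g z = K * x\<^sub>0 ^ (GM.rt (s + u) z - GM.rt s z) + (K + 1) * x\<^sub>0 ^ g"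

lemma err_nonneg: "0 \<le> errP n\<^sub>0 t m z" "0 \<le> errF s u g z"
  using x\<^sub>0 base.bar.K_pos by (auto simp: errP_def errF_def intro!: add_nonneg_nonneg mult_nonneg_nonneg)

text \<open>Before the gap \<open>y\<^sub>0\<close> is replaced by a point with the same word. After
  it, the point of the base below the position at time \<open>s\<close> is replaced by a point with
  the same first \<open>L\<close> cells. \<open>shadow\<close> bounds each coordinate by the same
  error, so only the sum of the seminorms enters and not the number of coordinates.\<close>

lemma symbolic_approximation:
  fixes G :: "(nat \<Rightarrow> 'm) \<Rightarrow> real"
  assumes G: "\<And>z i a b l. z \<in> {..<q} \<rightarrow>\<^sub>E UNIV \<Longrightarrow> i < q \<Longrightarrow> a \<in> Y \<Longrightarrow> b \<in> Y \<Longrightarrow> l < \<phi> a \<Longrightarrow>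
      \<bar>G (z(i := (T ^^ l) a)) - G (z(i := (T ^^ l) b))\<bar> \<le> H i * (d a b + epow \<theta> (sp a b))"
    and H: "\<And>i. 0 \<le> H i"
    and p: "1 \<le> p" "p < q" and mono: "mono_on {..<q} \<tau>" and n\<^sub>0: "n\<^sub>0 \<le> \<tau> 0" and m: "\<tau> (p - 1) < m"
    and t: "t + u \<le> \<tau> p" and g: "0 < g" and L: "L = (\<tau> (q - 1) - t) + g"
    and y: "y\<^sub>0 \<in> Y" "y\<^sub>1 \<in> Y"
  shows "\<bar>G (joined q p \<tau> t s y\<^sub>0 y\<^sub>1) - G (symbolic q p \<tau> t m L (GM.wd m (\<pi>b y\<^sub>0)) (GM.pos s (\<pi>b y\<^sub>1)))\<bar> \<le>
    (\<Sum>i<q. H i) * (errP n\<^sub>0 (\<tau> (p - 1)) m (\<pi>b y\<^sub>0) + errF s u g (\<pi>b y\<^sub>1))"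
proof -
  have K: "0 < K" by (rule base.bar.K_pos)
  let ?x = "joined q p \<tau> t s y\<^sub>0 y\<^sub>1" and ?x' = "symbolic q p \<tau> t m L (GM.wd m (\<pi>b y\<^sub>0)) (GM.pos s (\<pi>b y\<^sub>1))"
  let ?e = "errP n\<^sub>0 (\<tau> (p - 1)) m (\<pi>b y\<^sub>0) + errF s u g (\<pi>b y\<^sub>1)"
  have "\<bar>G ?x - G ?x'\<bar> \<le> (\<Sum>i<q. H i * ?e)"
  proof (rule telescope_coordinates[where G=G and x="?x" and x'="?x'" and e="\<lambda>i. H i * ?e"])
    show "?x \<in> {..<q} \<rightarrow>\<^sub>E UNIV" "?x' \<in> {..<q} \<rightarrow>\<^sub>E UNIV" by (auto simp: joined_def symbolic_def)
    fix z :: "nat \<Rightarrow> 'm" and i assume z: "z \<in> {..<q} \<rightarrow>\<^sub>E UNIV" and i: "i < q"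
    show "\<bar>G (z(i := ?x i)) - G (z(i := ?x' i))\<bar> \<le> H i * ?e"
    proof (cases "i < p")
      case True
      define r where "r = rep_word m (GM.wd m (\<pi>b y\<^sub>0))"
      define j where "j = length (GM.wd m (\<pi>b y\<^sub>0))"
      let ?k = "GM.rt (\<tau> i) (\<pi>b y\<^sub>0)"
      note \<pi>y = \<pi>b_space[OF y(1)]
      have r: "r \<in> Y" "GM.wd m (\<pi>b r) = GM.wd m (\<pi>b y\<^sub>0)" unfolding r_def by (rule rep_word[OF y(1)])+
      have \<tau>i: "\<tau> i \<le> \<tau> (p - 1)" using True p by (intro mono_onD[OF mono]) auto
      then have km: "?k < j" unfolding j_def using m by (intro GM.ret_less_length \<pi>y) auto
      have agree: "GM.cell ((Fb ^^ i) (\<pi>b y\<^sub>0)) = GM.cell ((Fb ^^ i) (\<pi>b r))" if "i < j" for i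
        using GM.wd_nth[OF \<pi>y, of i m] GM.wd_nth[OF \<pi>b_space[OF r(1)], of i m] that r(2) by (simp add: j_def)
      have "\<bar>G (z(i := (T ^^ \<tau> i) y\<^sub>0)) - G (z(i := (T ^^ \<tau> i) r))\<bar> \<le>
          H i * (K * x\<^sub>0 ^ ?k + (K + 1) * x\<^sub>0 ^ (j - ?k))"
        by (rule shadow[OF y(1) r(1) agree km H, where v="\<lambda>t. G (z(i := t))"])
            (assumption | rule G[OF z i])+
      also have "\<dots> \<le> H i * errP n\<^sub>0 (\<tau> (p - 1)) m (\<pi>b y\<^sub>0)"
        unfolding errP_def
      proof (intro mult_left_mono add_mono power_decreasing H)
        have "n\<^sub>0 \<le> \<tau> i" using n\<^sub>0 mono_onD[OF mono, of 0 i] i by simp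
        then show "GM.rt n\<^sub>0 (\<pi>b y\<^sub>0) \<le> ?k" by (rule GM.ret_mono[OF \<pi>y])
        have "?k \<le> GM.rt (\<tau> (p - 1)) (\<pi>b y\<^sub>0)" by (rule GM.ret_mono[OF \<pi>y \<tau>i])
        moreover have "GM.rt m (\<pi>b y\<^sub>0) \<le> j" unfolding j_def by (rule GM.ret_le_length[OF \<pi>y])
        ultimately show "GM.rt m (\<pi>b y\<^sub>0) - GM.rt (\<tau> (p - 1)) (\<pi>b y\<^sub>0) \<le> j - ?k" by (rule diff_le_mono2[THEN order_trans[rotated], OF _ diff_le_mono])
      qed (use K x\<^sub>0 in auto)
      also have "\<dots> \<le> H i * ?e" using H[of i] err_nonneg(2)[of s u g "\<pi>b y\<^sub>1"] by (intro mult_left_mono) auto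
      finally show ?thesis using True i by (simp add: joined_def symbolic_def r_def)
    next
      case False
      define k\<^sub>0 where "k\<^sub>0 = GM.rt s (\<pi>b y\<^sub>1)"
      define y\<^sub>2 where "y\<^sub>2 = (FY ^^ k\<^sub>0) y\<^sub>1"
      define l where "l = snd (GM.pos s (\<pi>b y\<^sub>1))"
      define c where "c = \<tau> i - t"
      define r where "r = rep_pre L (GM.pre L (\<pi>b y\<^sub>2))"
      note \<pi>y = \<pi>b_space[OF y(2)]
      have y2: "y\<^sub>2 \<in> Y" unfolding y\<^sub>2_def by (rule FYn_Y[OF y(2)])
      note \<pi>y2 = \<pi>b_space[OF y2]
      have P: "fst (GM.pos s (\<pi>b y\<^sub>1)) = \<pi>b y\<^sub>2" "l < \<phi> y\<^sub>2" "(T ^^ s) y\<^sub>1 = (T ^^ l) y\<^sub>2"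
        using T_eq_pos[OF y(2), of s] by (simp_all add: l_def y\<^sub>2_def k\<^sub>0_def)
      have Tc: "(T ^^ (s + c)) y\<^sub>1 = (T ^^ (l + c)) y\<^sub>2"
        using P(3) by (simp add: funpow_add add.commute[of _ c])
      have r: "r \<in> Y" "GM.pre L (\<pi>b r) = GM.pre L (\<pi>b y\<^sub>2)" unfolding r_def by (rule rep_pre[OF y2])+
      let ?k = "GM.rt (l + c) (\<pi>b y\<^sub>2)"
      have "\<tau> i \<le> \<tau> (q - 1)" using i p by (intro mono_onD[OF mono]) auto
      then have "c \<le> \<tau> (q - 1) - t" by (simp add: c_def)
      \<comment> \<open>From level \<open>l\<close> at most \<open>c\<close> returns happen in the
        next \<open>c\<close> steps, so at least \<open>g\<close> of the \<open>L\<close> common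
        cells are still ahead.\<close>
      moreover have "?k \<le> c" using P(2) by (intro GM.ret_le_diff \<pi>y2) (simp add: \<phi>b_\<pi>b y2)
      ultimately have k: "?k + g \<le> L" using L by simp
      then have kL: "?k < L" using g by simp
      have agree: "GM.cell ((Fb ^^ i) (\<pi>b y\<^sub>2)) = GM.cell ((Fb ^^ i) (\<pi>b r))" if "i < L" for i
        using GM.pre_eq_imp[OF r(2) that] by simp
      have "\<bar>G (z(i := (T ^^ (l + c)) y\<^sub>2)) - G (z(i := (T ^^ (l + c)) r))\<bar> \<le>
          H i * (K * x\<^sub>0 ^ ?k + (K + 1) * x\<^sub>0 ^ (L - ?k))"
        by (rule shadow[OF y2 r(1) agree kL H, where v="\<lambda>t. G (z(i := t))"])
            (assumption | rule G[OF z i])+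
      also have "\<dots> \<le> H i * errF s u g (\<pi>b y\<^sub>1)"
        unfolding errF_def
      proof (intro mult_left_mono add_mono power_decreasing H)
        have "\<tau> p \<le> \<tau> i" using False i by (intro mono_onD[OF mono]) auto
        then have "u \<le> c" using t by (simp add: c_def)
        then have "GM.rt (l + u) (\<pi>b y\<^sub>2) \<le> ?k" by (intro GM.ret_mono[OF \<pi>y2]) simp
        moreover have "GM.rt (s + u) (\<pi>b y\<^sub>1) = GM.rt s (\<pi>b y\<^sub>1) + GM.rt (l + u) (\<pi>b y\<^sub>2)"
          using GM.pos_add[OF \<pi>y, of s u] P(1) by (simp add: l_def)
        ultimately show "GM.rt (s + u) (\<pi>b y\<^sub>1) - GM.rt s (\<pi>b y\<^sub>1) \<le> ?k" by simp
        show "g \<le> L - ?k" using k by simp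
      qed (use K x\<^sub>0 in auto)
      also have "\<dots> \<le> H i * ?e" using H[of i] err_nonneg(1) by (intro mult_left_mono) auto
      finally show ?thesis using False i P(1) Tc by (simp add: joined_def symbolic_def r_def c_def l_def)
    qed
  qed
  then show ?thesis by (simp add: sum_distrib_right)
qed

text \<open>Three of the four terms are powers of the number of returns in a window of length at
  least \<open>u\<close>, the first such window starting at time 0, and fall under
  \<open>window_decay\<close>. The fourth is geometric in \<open>g\<close>.\<close>

lemma err_decay:
  "\<exists>E\<ge>0. \<forall>n\<^sub>0 t m u g s. u \<le> n\<^sub>0 \<longrightarrow> t + u \<le> m \<longrightarrow> u \<le> g \<longrightarrow>
    integrable \<mu>b (errP n\<^sub>0 t m) \<and> integrable \<mu>b (errF s u g) \<and>
    integral\<^sup>L \<mu>b (errP n\<^sub>0 t m) + integral\<^sup>L \<mu>b (errF s u g) \<le> E * decay (\<beta> - 1) u"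
proof -
  have K: "0 < K" by (rule base.bar.K_pos)
  obtain W where W: "0 \<le> W" "\<And>t m. (\<integral>z. x\<^sub>0 ^ (GM.rt (t + m) z - GM.rt t z) \<partial>\<mu>b) \<le> W * decay (\<beta> - 1) m"
    using GM.window_decay[OF x\<^sub>0(3,2)] by blast
  obtain V where V: "0 < V" "\<And>n. x\<^sub>0 ^ n \<le> V * decay \<beta> n" by (rule power_le_decay[OF \<beta> x\<^sub>0(3,2)]) blast
  define E where "E = K * W + (K + 1) * W + (K * W + (K + 1) * V)"
  have "integrable \<mu>b (errP n\<^sub>0 t m) \<and> integrable \<mu>b (errF s u g) \<and>
    integral\<^sup>L \<mu>b (errP n\<^sub>0 t m) + integral\<^sup>L \<mu>b (errF s u g) \<le> E * decay (\<beta> - 1) u"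
    if h: "u \<le> n\<^sub>0" "t + u \<le> m" "u \<le> g" for n\<^sub>0 t m u g s
  proof -
    have win: "integrable \<mu>b (\<lambda>z. x\<^sub>0 ^ (GM.rt (a + b) z - GM.rt a z))" for a b
      by (rule base.bar.integrable_const_bound[where B=1])
        (use x\<^sub>0 GM.measurable_window[OF x\<^sub>0(3,4)] in \<open>auto simp: power_le_one\<close>)
    have rt0: "GM.rt 0 z = 0" if "z \<in> space \<mu>b" for z using GM.\<phi>_pos[OF that] by (simp add: GM.ret_less)
    have i1: "integrable \<mu>b (\<lambda>z. x\<^sub>0 ^ GM.rt n\<^sub>0 z)"
      by (rule base.bar.integrable_const_bound[where B=1]) (use x\<^sub>0 in \<open>auto simp: power_le_one\<close>)
    have i2: "integrable \<mu>b (\<lambda>z. x\<^sub>0 ^ (GM.rt m z - GM.rt t z))" using win[of t "m - t"] h by simp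
    have dec: "decay (\<beta> - 1) a \<le> decay (\<beta> - 1) u" if "u \<le> a" for a using \<beta> that by (intro decay_antimono) auto
    have "(\<integral>z. x\<^sub>0 ^ GM.rt n\<^sub>0 z \<partial>\<mu>b) = (\<integral>z. x\<^sub>0 ^ (GM.rt (0 + n\<^sub>0) z - GM.rt 0 z) \<partial>\<mu>b)"
      by (intro Bochner_Integration.integral_cong refl) (simp add: rt0)
    also have "\<dots> \<le> W * decay (\<beta> - 1) n\<^sub>0" by (rule W)
    also have "\<dots> \<le> W * decay (\<beta> - 1) u" using W h by (intro mult_left_mono dec) auto
    finally have 1: "(\<integral>z. x\<^sub>0 ^ GM.rt n\<^sub>0 z \<partial>\<mu>b) \<le> W * decay (\<beta> - 1) u" .
    have "(\<integral>z. x\<^sub>0 ^ (GM.rt m z - GM.rt t z) \<partial>\<mu>b) \<le> W * decay (\<beta> - 1) (m - t)"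
      using W(2)[of t "m - t"] h by simp
    also have "\<dots> \<le> W * decay (\<beta> - 1) u" using W h by (intro mult_left_mono dec) auto
    finally have 2: "(\<integral>z. x\<^sub>0 ^ (GM.rt m z - GM.rt t z) \<partial>\<mu>b) \<le> W * decay (\<beta> - 1) u" .
    have "x\<^sub>0 ^ g \<le> V * decay \<beta> g" by (rule V)
    also have "\<dots> \<le> V * decay (\<beta> - 1) g" using V by (intro mult_left_mono decay_mono_exponent) auto
    also have "\<dots> \<le> V * decay (\<beta> - 1) u" using V h by (intro mult_left_mono dec) auto
    finally have 3: "x\<^sub>0 ^ g \<le> V * decay (\<beta> - 1) u" .
    have P: "integrable \<mu>b (errP n\<^sub>0 t m)" unfolding errP_def using i1 i2 by simp
    have F: "integrable \<mu>b (errF s u g)" unfolding errF_def using win by simp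
    have "integral\<^sup>L \<mu>b (errP n\<^sub>0 t m) = K * (\<integral>z. x\<^sub>0 ^ GM.rt n\<^sub>0 z \<partial>\<mu>b) + (K + 1) * (\<integral>z. x\<^sub>0 ^ (GM.rt m z - GM.rt t z) \<partial>\<mu>b)"
      unfolding errP_def using i1 i2 by (subst Bochner_Integration.integral_add) auto
    also have "\<dots> \<le> K * (W * decay (\<beta> - 1) u) + (K + 1) * (W * decay (\<beta> - 1) u)"
      using K 1 2 by (intro add_mono mult_left_mono) auto
    finally have P': "integral\<^sup>L \<mu>b (errP n\<^sub>0 t m) \<le> K * (W * decay (\<beta> - 1) u) + (K + 1) * (W * decay (\<beta> - 1) u)" .
    have "integral\<^sup>L \<mu>b (errF s u g) = K * (\<integral>z. x\<^sub>0 ^ (GM.rt (s + u) z - GM.rt s z) \<partial>\<mu>b) + (K + 1) * x\<^sub>0 ^ g"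
      unfolding errF_def using win by (subst Bochner_Integration.integral_add) (auto simp: base.bar.prob_space)
    also have "\<dots> \<le> K * (W * decay (\<beta> - 1) u) + (K + 1) * (V * decay (\<beta> - 1) u)"
      using K 3 W(2) by (intro add_mono mult_left_mono) auto
    finally show ?thesis using P F P' by (simp add: E_def algebra_simps)
  qed
  moreover have "0 \<le> E" using K W V by (simp add: E_def)
  ultimately show ?thesis by blast
qed

lemma sep_dyn_Holder_bounds:
  assumes G: "G \<in> sep_dyn_Holder \<mu> T Y \<phi> d sp \<theta> q"
  shows "\<exists>B H. (\<forall>x\<in>{..<q} \<rightarrow>\<^sub>E UNIV. \<bar>G x\<bar> \<le> B) \<and> 0 \<le> B \<and> (\<forall>i. 0 \<le> H i) \<and>
    B + (\<Sum>i<q. H i) = enn2real (sep_dyn_Holder_norm T Y \<phi> d sp \<theta> q G) \<and>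
    (\<forall>z\<in>{..<q} \<rightarrow>\<^sub>E UNIV. \<forall>i<q. \<forall>a\<in>Y. \<forall>b\<in>Y. \<forall>l<\<phi> a.
      \<bar>G (z(i := (T ^^ l) a)) - G (z(i := (T ^^ l) b))\<bar> \<le> H i * (d a b + epow \<theta> (sp a b)))"
proof -
  let ?S = "\<lambda>i. sep_dyn_Holder_seminorm T Y \<phi> d sp \<theta> q i G" and ?B = "sup_norm_on ({..<q} \<rightarrow>\<^sub>E UNIV) G"
  define H where "H i = enn2real (?S i)" for i
  define B where "B = enn2real ?B"
  have norm: "?B + (\<Sum>i<q. ?S i) < \<infinity>" using G by (simp add: sep_dyn_Holder_def sep_dyn_Holder_norm_def)
  then have fin: "?B < top" "(\<Sum>i<q. ?S i) < top" by (auto simp: less_top[symmetric])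
  have "?S i < top" if "i < q" for i
  proof -
    have "?S i \<le> (\<Sum>i<q. ?S i)" using that by (intro member_le_sum) auto
    then show ?thesis using fin(2) by (rule le_less_trans)
  qed
  then have S: "?S i = ennreal (H i)" if "i < q" for i using that by (simp add: H_def)
  have "?B = ennreal B" using fin(1) by (simp add: B_def)
  have "\<bar>G x\<bar> \<le> B" if "x \<in> {..<q} \<rightarrow>\<^sub>E UNIV" for x
  proof -
    have "ennreal \<bar>G x\<bar> \<le> ?B" unfolding sup_norm_on_def by (rule SUP_upper[OF that])
    then show ?thesis unfolding \<open>?B = ennreal B\<close> by (simp add: B_def)
  qed
  note G_le = this
  have BH: "B + (\<Sum>i<q. H i) = enn2real (sep_dyn_Holder_norm T Y \<phi> d sp \<theta> q G)"
  proof -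
    have nn: "0 \<le> B" "0 \<le> (\<Sum>i<q. H i)" by (auto simp: B_def H_def intro: sum_nonneg)
    have "(\<Sum>i<q. ?S i) = (\<Sum>i<q. ennreal (H i))" by (intro sum.cong refl S) auto
    also have "\<dots> = ennreal (\<Sum>i<q. H i)" by (rule sum_ennreal) (simp add: H_def)
    finally have "?B + (\<Sum>i<q. ?S i) = ennreal (B + (\<Sum>i<q. H i))"
      using nn by (simp only: \<open>?B = ennreal B\<close> ennreal_plus)
    then show ?thesis
      unfolding sep_dyn_Holder_norm_def using nn by (simp only: enn2real_ennreal add_nonneg_nonneg)
  qed
  have Hol: "\<bar>G (z(i := (T ^^ l) a)) - G (z(i := (T ^^ l) b))\<bar> \<le> H i * (d a b + epow \<theta> (sp a b))"
    if "z \<in> {..<q} \<rightarrow>\<^sub>E UNIV" "i < q" "a \<in> Y" "b \<in> Y" "l < \<phi> a" for z i a b l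
  proof (rule dyn_Holder_seminorm_bound[OF base.Metric_space_axioms \<theta>(1), where v="\<lambda>t. G (z(i := t))" and s=sp])
    have "dyn_Holder_seminorm T Y \<phi> d sp \<theta> (\<lambda>t. G (z(i := t))) \<le> ?S i"
      unfolding sep_dyn_Holder_seminorm_def by (rule SUP_upper[OF that(1)])
    then show "dyn_Holder_seminorm T Y \<phi> d sp \<theta> (\<lambda>t. G (z(i := t))) \<le> ennreal (H i)"
      by (simp add: S[OF that(2)])
  qed (use that in \<open>auto simp: H_def\<close>)
  have "0 \<le> B" "0 \<le> H i" for i by (auto simp: B_def H_def)
  then show ?thesis
    by (intro exI[of _ B] exI[of _ H] conjI allI ballI impI G_le BH Hol)
qed

lemma measurable_joined:
  assumes "f \<in> N \<rightarrow>\<^sub>M \<mu>\<^sub>Y" "g \<in> N \<rightarrow>\<^sub>M \<mu>\<^sub>Y"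
  shows "(\<lambda>x. joined q p \<tau> t s (f x) (g x)) \<in> N \<rightarrow>\<^sub>M (\<Pi>\<^sub>M i\<in>{..<q}. \<mu>)"
  unfolding joined_def
proof (rule measurable_restrict)
  fix i
  show "(\<lambda>x. if i < p then (T ^^ \<tau> i) (f x) else (T ^^ (s + (\<tau> i - t))) (g x)) \<in> N \<rightarrow>\<^sub>M \<mu>"
    using measurable_compose[OF assms(1) T_pow_measurable] measurable_compose[OF assms(2) T_pow_measurable]
    by (cases "i < p") auto
qed

section \<open>Correlations of orbits that start on the base, and the passage to \<mu>\<close>

lemma integral_diff_le:
  fixes f g e :: "'a \<Rightarrow> real"
  assumes "integrable N f" "integrable N g" "integrable N e" "\<And>x. x \<in> space N \<Longrightarrow> \<bar>f x - g x\<bar> \<le> e x"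
  shows "\<bar>integral\<^sup>L N f - integral\<^sup>L N g\<bar> \<le> integral\<^sup>L N e"
proof -
  have "\<bar>integral\<^sup>L N f - integral\<^sup>L N g\<bar> \<le> (\<integral>x. \<bar>f x - g x\<bar> \<partial>N)"
    unfolding Bochner_Integration.integral_diff[OF assms(1,2), symmetric] by (rule integral_abs_bound)
  also have "\<dots> \<le> integral\<^sup>L N e"
    using assms by (intro integral_mono) auto
  finally show ?thesis .
qed

lemma integrable_\<pi>b: "integrable \<mu>b f \<Longrightarrow> integrable \<mu>\<^sub>Y (\<lambda>y. f (\<pi>b y) :: real)"
  using integrable_distr[OF \<pi>b_measurable, of f] by (simp add: distr_\<pi>b)

text \<open>All times are delayed by \<open>n\<^sub>0\<close>, at least the length of the gap, so
  that contraction has already taken place at the first observation. The bound depends neither on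
  \<open>n\<^sub>0\<close> nor on \<open>j\<close>, which leaves both free for limits.\<close>

lemma base_correlation:
  "\<exists>C\<ge>0. \<forall>p q n G n\<^sub>0 j. 1 \<le> p \<longrightarrow> p < q \<longrightarrow> mono_on {..<q} n \<longrightarrow> n (p - 1) < n p \<longrightarrow> n p - n (p - 1) \<le> n\<^sub>0 \<longrightarrow>
    G \<in> sep_dyn_Holder \<mu> T Y \<phi> d sp \<theta> q \<longrightarrow>
    \<bar>(\<integral>y. G (\<lambda>i\<in>{..<q}. (T ^^ (n\<^sub>0 + n i)) y) \<partial>\<mu>\<^sub>Y) -
      (\<integral>y\<^sub>0. (\<integral>y\<^sub>1. G (\<lambda>i\<in>{..<q}. if i < p then (T ^^ (n\<^sub>0 + n i)) y\<^sub>0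
        else (T ^^ (n\<^sub>0 + GM.period * j + n i)) y\<^sub>1) \<partial>\<mu>\<^sub>Y) \<partial>\<mu>\<^sub>Y)\<bar>
    \<le> C * real (n p - n (p - 1)) powr (- (\<beta> - 1)) * enn2real (sep_dyn_Holder_norm T Y \<phi> d sp \<theta> q G)"
proof -
  obtain E where E: "0 \<le> E" "\<And>n\<^sub>0 t m u g s. u \<le> n\<^sub>0 \<Longrightarrow> t + u \<le> m \<Longrightarrow> u \<le> g \<Longrightarrow>
    integrable \<mu>b (errP n\<^sub>0 t m) \<and> integrable \<mu>b (errF s u g) \<and>
    integral\<^sup>L \<mu>b (errP n\<^sub>0 t m) + integral\<^sup>L \<mu>b (errF s u g) \<le> E * decay (\<beta> - 1) u"
    using err_decay by blast
  obtain D where D: "0 \<le> D" "\<And>h B m u j. (\<And>w. GM.adm (h w) B) \<Longrightarrow>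
    \<bar>(\<integral>z. h (GM.wd m z) (GM.pos (m + u) z) \<partial>\<mu>b) -
      (\<integral>z. (\<integral>z'. h (GM.wd m z) (GM.pos (m + u + GM.period * j) z') \<partial>\<mu>b) \<partial>\<mu>b)\<bar> \<le> D * B * decay (\<beta> - 1) u"
    using GM.word_mixing by blast
  define C where "C = (2 * E + D) * 3 powr (\<beta> - 1)"
  have "\<bar>(\<integral>y. G (\<lambda>i\<in>{..<q}. (T ^^ (n\<^sub>0 + n i)) y) \<partial>\<mu>\<^sub>Y) -
      (\<integral>y\<^sub>0. (\<integral>y\<^sub>1. G (\<lambda>i\<in>{..<q}. if i < p then (T ^^ (n\<^sub>0 + n i)) y\<^sub>0
        else (T ^^ (n\<^sub>0 + GM.period * j + n i)) y\<^sub>1) \<partial>\<mu>\<^sub>Y) \<partial>\<mu>\<^sub>Y)\<bar>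
    \<le> C * real (n p - n (p - 1)) powr (- (\<beta> - 1)) * enn2real (sep_dyn_Holder_norm T Y \<phi> d sp \<theta> q G)"
    if p: "1 \<le> p" "p < q" and n: "mono_on {..<q} n" "n (p - 1) < n p" and n0: "n p - n (p - 1) \<le> n\<^sub>0"
      and G: "G \<in> sep_dyn_Holder \<mu> T Y \<phi> d sp \<theta> q" for p q n G n\<^sub>0 j
  proof -
    have G_meas: "G \<in> borel_measurable (\<Pi>\<^sub>M i\<in>{..<q}. \<mu>)" using G by (simp add: sep_dyn_Holder_def)
    obtain B H where B: "\<forall>x\<in>{..<q} \<rightarrow>\<^sub>E UNIV. \<bar>G x\<bar> \<le> B" "0 \<le> B" and H: "\<forall>i. 0 \<le> H i"
      and BH: "B + (\<Sum>i<q. H i) = enn2real (sep_dyn_Holder_norm T Y \<phi> d sp \<theta> q G)"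
      and Hol: "\<forall>z\<in>{..<q} \<rightarrow>\<^sub>E UNIV. \<forall>i<q. \<forall>a\<in>Y. \<forall>b\<in>Y. \<forall>l<\<phi> a.
        \<bar>G (z(i := (T ^^ l) a)) - G (z(i := (T ^^ l) b))\<bar> \<le> H i * (d a b + epow \<theta> (sp a b))"
      using sep_dyn_Holder_bounds[OF G] by (elim exE conjE) (rule that)
    define g where "g = n p - n (p - 1)"
    \<comment> \<open>The gap is divided into three stretches of length \<open>u\<close>: one keeps
      common cells ahead of the last observation before the gap, one is for mixing, and one is for
      contraction before the first observation after the gap. Subtracting 1 leaves room for the
      extra unit in \<open>m\<close>, which must exceed \<open>\<tau> (p - 1)\<close>
      strictly.\<close>
    define u where "u = (g - 1) div 3"
    define \<tau> where "\<tau> i = n\<^sub>0 + n i" for i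
    define m where "m = \<tau> (p - 1) + u + 1"
    define t where "t = m + u"
    \<comment> \<open>Enough cells to reach the last observation when every excursion is as short as
      possible, and \<open>g\<close> more.\<close>
    define L where "L = (\<tau> (q - 1) - t) + g"
    define s where "s = t + GM.period * j"
    have g: "0 < g" "\<tau> p = \<tau> (p - 1) + g" using n by (auto simp: g_def \<tau>_def)
    have u: "3 * u < g" using g by (simp add: u_def)
    have mono: "mono_on {..<q} \<tau>" using n(1) by (auto simp: \<tau>_def mono_on_def)
    have t_le: "t + u \<le> \<tau> p" using u g by (simp add: t_def m_def)
    have \<tau>_ge: "t \<le> \<tau> i" if "p \<le> i" "i < q" for i
    proof -
      have "\<tau> p \<le> \<tau> i" using that p by (intro mono_onD[OF mono]) auto
      then show ?thesis using t_le by simp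
    qed
    let ?Hs = "\<Sum>i<q. H i"
    have Hs: "0 \<le> ?Hs" using H by (simp add: sum_nonneg)
    let ?J = "joined q p \<tau> t" and ?P = "errP n\<^sub>0 (\<tau> (p - 1)) m" and ?F = "\<lambda>s. errF s u g"
    define S where "S w zl = G (symbolic q p \<tau> t m L w zl)" for w zl
    have approx: "\<bar>G (?J s y\<^sub>0 y\<^sub>1) - S (GM.wd m (\<pi>b y\<^sub>0)) (GM.pos s (\<pi>b y\<^sub>1))\<bar> \<le> ?Hs * (?P (\<pi>b y\<^sub>0) + ?F s (\<pi>b y\<^sub>1))"
      if "y\<^sub>0 \<in> Y" "y\<^sub>1 \<in> Y" for s y\<^sub>0 y\<^sub>1
      unfolding S_def
    proof (rule symbolic_approximation[where G=G and H=H, OF _ _ p mono _ _ t_le g(1) L_def that])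
      show "\<bar>G (z(i := (T ^^ l) a)) - G (z(i := (T ^^ l) b))\<bar> \<le> H i * (d a b + epow \<theta> (sp a b))"
        if "z \<in> {..<q} \<rightarrow>\<^sub>E UNIV" "i < q" "a \<in> Y" "b \<in> Y" "l < \<phi> a" for z i a b l
        using Hol that by blast
    qed (use H in \<open>auto simp: \<tau>_def m_def\<close>)
    have err: "integrable \<mu>b ?P" "integrable \<mu>b (?F s)"
      "integral\<^sup>L \<mu>b ?P + integral\<^sup>L \<mu>b (?F s) \<le> E * decay (\<beta> - 1) u" for s
      using E(2)[of u n\<^sub>0 "\<tau> (p - 1)" m g s] u n0 by (auto simp: m_def g_def)
    have adm: "GM.adm (S w) B" for w
      unfolding GM.adm_def
    proof (intro conjI allI)
      fix l
      define v where "v w' = G (\<lambda>i\<in>{..<q}. if i < p then (T ^^ \<tau> i) (rep_word m w)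
        else (T ^^ (l + (\<tau> i - t))) (rep_pre L w'))" for w'
      have "(\<lambda>z. v (GM.pre L z)) \<in> borel_measurable \<mu>b" by (rule measurable_compose[OF GM.measurable_pre]) auto
      then show "(\<lambda>z. S w (z, l)) \<in> borel_measurable \<mu>b" 
        unfolding v_def S_def symbolic_def fst_conv snd_conv .
      fix zl show "\<bar>S w zl\<bar> \<le> B" unfolding S_def using B by (auto simp: symbolic_def)
    qed
    have G_le: "\<bar>G (?J s y\<^sub>0 y\<^sub>1)\<bar> \<le> B" for s y\<^sub>0 y\<^sub>1 using B by (auto simp: joined_def)
    have GJ: "(\<lambda>x. G (?J s (f x) (g x))) \<in> borel_measurable N" if "f \<in> N \<rightarrow>\<^sub>M \<mu>\<^sub>Y" "g \<in> N \<rightarrow>\<^sub>M \<mu>\<^sub>Y" for N s f g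
      by (rule measurable_compose[OF measurable_joined[OF that] G_meas])
    have S_le: "\<bar>S w zl\<bar> \<le> B" for w zl using GM.admD(2)[OF adm] .
    have Sm: "(\<lambda>z. S (GM.wd m z) (GM.pos t z)) \<in> borel_measurable \<mu>b" by (rule GM.measurable_wd_pos[OF adm])
    have Spos: "(\<lambda>z. S w (GM.pos s z)) \<in> borel_measurable \<mu>b" for w s by (rule GM.measurable_pos[OF adm])
    have 1: "\<bar>(\<integral>y. G (?J t y y) \<partial>\<mu>\<^sub>Y) - (\<integral>z. S (GM.wd m z) (GM.pos t z) \<partial>\<mu>b)\<bar> \<le> ?Hs * (E * decay (\<beta> - 1) u)"
    proof -
      have "\<bar>(\<integral>y. G (?J t y y) \<partial>\<mu>\<^sub>Y) - (\<integral>y. S (GM.wd m (\<pi>b y)) (GM.pos t (\<pi>b y)) \<partial>\<mu>\<^sub>Y)\<bar> \<le>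
          (\<integral>y. ?Hs * (?P (\<pi>b y) + ?F t (\<pi>b y)) \<partial>\<mu>\<^sub>Y)"
      proof (rule integral_diff_le)
        show "integrable \<mu>\<^sub>Y (\<lambda>y. G (?J t y y))"
          by (rule base.integrable_const_bound[where B=B]) (use G_le GJ[of "\<lambda>y. y"] in auto)
        show "integrable \<mu>\<^sub>Y (\<lambda>y. S (GM.wd m (\<pi>b y)) (GM.pos t (\<pi>b y)))"
          by (rule base.integrable_const_bound[where B=B]) (use S_le measurable_compose[OF \<pi>b_measurable Sm] in auto)
        show "integrable \<mu>\<^sub>Y (\<lambda>y. ?Hs * (?P (\<pi>b y) + ?F t (\<pi>b y)))"
          by (intro integrable_mult_right Bochner_Integration.integrable_add integrable_\<pi>b err)
      qed (use approx in \<open>auto simp: space_\<mu>\<^sub>Y\<close>)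
      also have "(\<integral>y. S (GM.wd m (\<pi>b y)) (GM.pos t (\<pi>b y)) \<partial>\<mu>\<^sub>Y) = (\<integral>z. S (GM.wd m z) (GM.pos t z) \<partial>\<mu>b)"
        by (rule integral_\<pi>b[OF Sm])
      also have "(\<integral>y. ?Hs * (?P (\<pi>b y) + ?F t (\<pi>b y)) \<partial>\<mu>\<^sub>Y) = (\<integral>z. ?Hs * (?P z + ?F t z) \<partial>\<mu>b)"
        by (rule integral_\<pi>b) (use err in auto)
      also have "\<dots> = ?Hs * (integral\<^sup>L \<mu>b ?P + integral\<^sup>L \<mu>b (?F t))"
        using err by simp
      also have "\<dots> \<le> ?Hs * (E * decay (\<beta> - 1) u)" by (rule mult_left_mono[OF err(3) Hs])
      finally show ?thesis .
    qed
    define a where "a w = (\<integral>z'. S w (GM.pos s z') \<partial>\<mu>b)" for w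
    have a_le: "\<bar>a w\<bar> \<le> B" for w
      using GM.X_le[OF GM.one_cone adm, of s w] by (simp add: a_def GM.X_def base.bar.prob_space)
    have am: "(\<lambda>z. a (GM.wd m z)) \<in> borel_measurable \<mu>b" by (rule measurable_compose[OF GM.measurable_wd]) auto
    have inner: "\<bar>(\<integral>y\<^sub>1. G (?J s y\<^sub>0 y\<^sub>1) \<partial>\<mu>\<^sub>Y) - a (GM.wd m (\<pi>b y\<^sub>0))\<bar> \<le> ?Hs * (?P (\<pi>b y\<^sub>0) + integral\<^sup>L \<mu>b (?F s))"
      if y0: "y\<^sub>0 \<in> Y" for y\<^sub>0
    proof -
      let ?w = "GM.wd m (\<pi>b y\<^sub>0)"
      have "\<bar>(\<integral>y\<^sub>1. G (?J s y\<^sub>0 y\<^sub>1) \<partial>\<mu>\<^sub>Y) - (\<integral>y\<^sub>1. S ?w (GM.pos s (\<pi>b y\<^sub>1)) \<partial>\<mu>\<^sub>Y)\<bar> \<le>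
          (\<integral>y\<^sub>1. ?Hs * (?P (\<pi>b y\<^sub>0) + ?F s (\<pi>b y\<^sub>1)) \<partial>\<mu>\<^sub>Y)"
      proof (rule integral_diff_le)
        show "integrable \<mu>\<^sub>Y (\<lambda>y\<^sub>1. G (?J s y\<^sub>0 y\<^sub>1))"
          by (rule base.integrable_const_bound[where B=B]) (use G_le GJ[of "\<lambda>_. y\<^sub>0" _ "\<lambda>y. y"] y0 in \<open>auto simp: space_\<mu>\<^sub>Y\<close>)
        show "integrable \<mu>\<^sub>Y (\<lambda>y\<^sub>1. S ?w (GM.pos s (\<pi>b y\<^sub>1)))"
          by (rule base.integrable_const_bound[where B=B]) (use S_le measurable_compose[OF \<pi>b_measurable Spos] in auto)
        show "integrable \<mu>\<^sub>Y (\<lambda>y\<^sub>1. ?Hs * (?P (\<pi>b y\<^sub>0) + ?F s (\<pi>b y\<^sub>1)))"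
          by (intro integrable_mult_right Bochner_Integration.integrable_add integrable_\<pi>b err) simp
      qed (use approx y0 in \<open>auto simp: space_\<mu>\<^sub>Y\<close>)
      also have "(\<integral>y\<^sub>1. S ?w (GM.pos s (\<pi>b y\<^sub>1)) \<partial>\<mu>\<^sub>Y) = a ?w"
        unfolding a_def by (rule integral_\<pi>b[OF Spos])
      also have "(\<integral>y\<^sub>1. ?Hs * (?P (\<pi>b y\<^sub>0) + ?F s (\<pi>b y\<^sub>1)) \<partial>\<mu>\<^sub>Y) = (\<integral>z. ?Hs * (?P (\<pi>b y\<^sub>0) + ?F s z) \<partial>\<mu>b)"
        by (rule integral_\<pi>b) (use err(2) in auto)
      also have "\<dots> = ?Hs * (?P (\<pi>b y\<^sub>0) + integral\<^sup>L \<mu>b (?F s))"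
        using err(2)[of s] by (simp add: base.bar.prob_space)
      finally show ?thesis .
    qed
    have Jm: "(\<lambda>y\<^sub>0. \<integral>y\<^sub>1. G (?J s y\<^sub>0 y\<^sub>1) \<partial>\<mu>\<^sub>Y) \<in> borel_measurable \<mu>\<^sub>Y"
      by (rule base.borel_measurable_lebesgue_integral)
        (use GJ[of fst "\<mu>\<^sub>Y \<Otimes>\<^sub>M \<mu>\<^sub>Y" snd s] in \<open>simp add: case_prod_beta\<close>)
    have J_le: "\<bar>\<integral>y\<^sub>1. G (?J s y\<^sub>0 y\<^sub>1) \<partial>\<mu>\<^sub>Y\<bar> \<le> B" if "y\<^sub>0 \<in> Y" for y\<^sub>0
    proof -
      have "\<bar>(\<integral>y\<^sub>1. G (?J s y\<^sub>0 y\<^sub>1) \<partial>\<mu>\<^sub>Y) - (\<integral>y\<^sub>1. 0 \<partial>\<mu>\<^sub>Y)\<bar> \<le> (\<integral>y\<^sub>1. B \<partial>\<mu>\<^sub>Y)"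
      proof (rule integral_diff_le)
        show "integrable \<mu>\<^sub>Y (\<lambda>y\<^sub>1. G (?J s y\<^sub>0 y\<^sub>1))"
          by (rule base.integrable_const_bound[where B=B]) (use G_le GJ[of "\<lambda>_. y\<^sub>0" _ "\<lambda>y. y"] that in \<open>auto simp: space_\<mu>\<^sub>Y\<close>)
      qed (use G_le in auto)
      then show ?thesis by (simp add: base.prob_space)
    qed
    have 2: "\<bar>(\<integral>y\<^sub>0. (\<integral>y\<^sub>1. G (?J s y\<^sub>0 y\<^sub>1) \<partial>\<mu>\<^sub>Y) \<partial>\<mu>\<^sub>Y) - (\<integral>z. a (GM.wd m z) \<partial>\<mu>b)\<bar> \<le> ?Hs * (E * decay (\<beta> - 1) u)"
    proof -
      have "\<bar>(\<integral>y\<^sub>0. (\<integral>y\<^sub>1. G (?J s y\<^sub>0 y\<^sub>1) \<partial>\<mu>\<^sub>Y) \<partial>\<mu>\<^sub>Y) - (\<integral>y\<^sub>0. a (GM.wd m (\<pi>b y\<^sub>0)) \<partial>\<mu>\<^sub>Y)\<bar> \<le>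
          (\<integral>y\<^sub>0. ?Hs * (?P (\<pi>b y\<^sub>0) + integral\<^sup>L \<mu>b (?F s)) \<partial>\<mu>\<^sub>Y)"
      proof (rule integral_diff_le)
        show "integrable \<mu>\<^sub>Y (\<lambda>y\<^sub>0. \<integral>y\<^sub>1. G (?J s y\<^sub>0 y\<^sub>1) \<partial>\<mu>\<^sub>Y)"
          by (rule base.integrable_const_bound[where B=B]) (use J_le Jm in \<open>auto simp: space_\<mu>\<^sub>Y\<close>)
        show "integrable \<mu>\<^sub>Y (\<lambda>y\<^sub>0. a (GM.wd m (\<pi>b y\<^sub>0)))"
          by (rule base.integrable_const_bound[where B=B]) (use a_le measurable_compose[OF \<pi>b_measurable am] in auto)
        show "integrable \<mu>\<^sub>Y (\<lambda>y\<^sub>0. ?Hs * (?P (\<pi>b y\<^sub>0) + integral\<^sup>L \<mu>b (?F s)))"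
          by (intro integrable_mult_right Bochner_Integration.integrable_add integrable_\<pi>b err) simp
      qed (use inner in \<open>auto simp: space_\<mu>\<^sub>Y\<close>)
      also have "(\<integral>y\<^sub>0. a (GM.wd m (\<pi>b y\<^sub>0)) \<partial>\<mu>\<^sub>Y) = (\<integral>z. a (GM.wd m z) \<partial>\<mu>b)" by (rule integral_\<pi>b[OF am])
      also have "(\<integral>y\<^sub>0. ?Hs * (?P (\<pi>b y\<^sub>0) + integral\<^sup>L \<mu>b (?F s)) \<partial>\<mu>\<^sub>Y) = (\<integral>z. ?Hs * (?P z + integral\<^sup>L \<mu>b (?F s)) \<partial>\<mu>b)"
        by (rule integral_\<pi>b) (use err(1) in auto)
      also have "\<dots> = ?Hs * (integral\<^sup>L \<mu>b ?P + integral\<^sup>L \<mu>b (?F s))"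
        using err(1) by (simp add: base.bar.prob_space)
      also have "\<dots> \<le> ?Hs * (E * decay (\<beta> - 1) u)" by (rule mult_left_mono[OF err(3) Hs])
      finally show ?thesis .
    qed
    have 3: "\<bar>(\<integral>z. S (GM.wd m z) (GM.pos t z) \<partial>\<mu>b) - (\<integral>z. a (GM.wd m z) \<partial>\<mu>b)\<bar> \<le> D * B * decay (\<beta> - 1) u"
      using D(2)[of S B m u j, OF adm] by (simp add: a_def s_def t_def)
    have J1: "?J t y y = (\<lambda>i\<in>{..<q}. (T ^^ (n\<^sub>0 + n i)) y)" for y
      using \<tau>_ge by (auto simp: joined_def \<tau>_def fun_eq_iff)
    have J2: "?J s y\<^sub>0 y\<^sub>1 = (\<lambda>i\<in>{..<q}. if i < p then (T ^^ (n\<^sub>0 + n i)) y\<^sub>0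
        else (T ^^ (n\<^sub>0 + GM.period * j + n i)) y\<^sub>1)" for y\<^sub>0 y\<^sub>1
    proof
      fix i
      have "s + (\<tau> i - t) = n\<^sub>0 + GM.period * j + n i" if "\<not> i < p" "i < q"
        using \<tau>_ge[of i] that by (simp add: s_def \<tau>_def)
      then show "?J s y\<^sub>0 y\<^sub>1 i = (\<lambda>i\<in>{..<q}. if i < p then (T ^^ (n\<^sub>0 + n i)) y\<^sub>0
        else (T ^^ (n\<^sub>0 + GM.period * j + n i)) y\<^sub>1) i"
        by (simp add: joined_def \<tau>_def)
    qed
    have "\<bar>(\<integral>y. G (?J t y y) \<partial>\<mu>\<^sub>Y) - (\<integral>y\<^sub>0. (\<integral>y\<^sub>1. G (?J s y\<^sub>0 y\<^sub>1) \<partial>\<mu>\<^sub>Y) \<partial>\<mu>\<^sub>Y)\<bar> \<le>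
        2 * (?Hs * (E * decay (\<beta> - 1) u)) + D * B * decay (\<beta> - 1) u"
      using 1 2 3 by linarith
    also have "\<dots> = (2 * E * ?Hs + D * B) * decay (\<beta> - 1) u" by (simp add: algebra_simps)
    also have "\<dots> \<le> ((2 * E + D) * (B + ?Hs)) * (3 powr (\<beta> - 1) * decay (\<beta> - 1) (g - 1))"
    proof (intro mult_mono decay_scale)
      show "2 * E * ?Hs + D * B \<le> (2 * E + D) * (B + ?Hs)"
        using E(1) D(1) B(2) Hs by (simp add: algebra_simps)
      have "g \<le> 3 * Suc u" using g by (simp add: u_def)
      then show "real (Suc (g - 1)) \<le> 3 * real (Suc u)" using g by simp
    qed (use E D B Hs \<beta> in auto)
    also have "decay (\<beta> - 1) (g - 1) = real g powr (- (\<beta> - 1))" using g by (simp add: decay_def)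
    also have "((2 * E + D) * (B + ?Hs)) * (3 powr (\<beta> - 1) * real g powr (- (\<beta> - 1))) =
        C * real g powr (- (\<beta> - 1)) * (B + ?Hs)" by (simp add: C_def)
    finally show ?thesis unfolding J1 J2 BH[symmetric] g_def .
  qed
  moreover have "0 \<le> C" using E D by (simp add: C_def)
  ultimately show ?thesis by blast
qed

text \<open>Two limits in the bound for base orbits. For a fixed delay \<open>n\<^sub>0\<close>,
  sending \<open>j\<close> to infinity turns the inner integral over the base into one over \<mu>;
  sending \<open>n\<^sub>0\<close> to infinity then does the same for the outer integral and for the
  undivided orbit. No rate of mixing enters, because the bound is uniform in both
  parameters.\<close>

theorem correlation_bound:
  "functional_correlation_bound \<mu> T Y \<phi> d sp \<theta> (\<lambda>n. real n powr (- (\<beta> - 1)))"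
proof -
  obtain C where C: "0 \<le> C" "\<And>p q n G n\<^sub>0 j. 1 \<le> p \<Longrightarrow> p < q \<Longrightarrow> mono_on {..<q} n \<Longrightarrow> n (p - 1) < n p \<Longrightarrow>
    n p - n (p - 1) \<le> n\<^sub>0 \<Longrightarrow> G \<in> sep_dyn_Holder \<mu> T Y \<phi> d sp \<theta> q \<Longrightarrow>
    \<bar>(\<integral>y. G (\<lambda>i\<in>{..<q}. (T ^^ (n\<^sub>0 + n i)) y) \<partial>\<mu>\<^sub>Y) -
      (\<integral>y\<^sub>0. (\<integral>y\<^sub>1. G (\<lambda>i\<in>{..<q}. if i < p then (T ^^ (n\<^sub>0 + n i)) y\<^sub>0
        else (T ^^ (n\<^sub>0 + GM.period * j + n i)) y\<^sub>1) \<partial>\<mu>\<^sub>Y) \<partial>\<mu>\<^sub>Y)\<bar>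
    \<le> C * real (n p - n (p - 1)) powr (- (\<beta> - 1)) * enn2real (sep_dyn_Holder_norm T Y \<phi> d sp \<theta> q G)"
    using base_correlation by blast
  interpret PP: pair_prob_space \<mu> \<mu> ..
  have Tn [measurable]: "(T ^^ k) \<in> \<mu> \<rightarrow>\<^sub>M \<mu>" for k by (rule measurable_compose_n[OF T_measurable])
  have main: "\<bar>(LINT x|\<mu>. G (\<lambda>i\<in>{..<q}. (T ^^ n i) x)) -
      (LINT (x\<^sub>0, x\<^sub>1)|(\<mu> \<Otimes>\<^sub>M \<mu>). G (\<lambda>i\<in>{..<q}. if i < p then (T ^^ n i) x\<^sub>0 else (T ^^ n i) x\<^sub>1))\<bar>
    \<le> C * real (n p - n (p - 1)) powr (- (\<beta> - 1)) * enn2real (sep_dyn_Holder_norm T Y \<phi> d sp \<theta> q G)"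
    (is "\<bar>?I1 - ?I2\<bar> \<le> ?eps")
    if p: "1 \<le> p" "p < q" and n: "mono_on {..<q} n" "n (p - 1) < n p"
      and G: "G \<in> sep_dyn_Holder \<mu> T Y \<phi> d sp \<theta> q" for p q n G
  proof -
    have G_meas: "G \<in> borel_measurable (\<Pi>\<^sub>M i\<in>{..<q}. \<mu>)" using G by (simp add: sep_dyn_Holder_def)
    obtain B where B: "\<And>x. x \<in> {..<q} \<rightarrow>\<^sub>E UNIV \<Longrightarrow> \<bar>G x\<bar> \<le> B"
      using sep_dyn_Holder_bounds[OF G] by (elim exE conjE) (rule that, blast)
    define \<Psi> where "\<Psi> x = G (\<lambda>i\<in>{..<q}. (T ^^ n i) x)" for x
    define \<Theta> where "\<Theta> x\<^sub>0 x\<^sub>1 = G (\<lambda>i\<in>{..<q}. if i < p then (T ^^ n i) x\<^sub>0 else (T ^^ n i) x\<^sub>1)" for x\<^sub>0 x\<^sub>1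
    define \<Phi> where "\<Phi> x\<^sub>0 = (\<integral>x\<^sub>1. \<Theta> x\<^sub>0 x\<^sub>1 \<partial>\<mu>)" for x\<^sub>0
    have \<Psi>_meas: "\<Psi> \<in> borel_measurable \<mu>"
      unfolding \<Psi>_def by (rule measurable_compose[OF _ G_meas]) (intro measurable_restrict Tn)
    have \<Psi>_le: "\<bar>\<Psi> x\<bar> \<le> B" for x unfolding \<Psi>_def by (rule B) auto
    have \<Theta>_le: "\<bar>\<Theta> x\<^sub>0 x\<^sub>1\<bar> \<le> B" for x\<^sub>0 x\<^sub>1 unfolding \<Theta>_def by (rule B) auto
    have \<Theta>_meas: "(\<lambda>x. \<Theta> (f x) (g x)) \<in> borel_measurable N" if "f \<in> N \<rightarrow>\<^sub>M \<mu>" "g \<in> N \<rightarrow>\<^sub>M \<mu>" for N f g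
      unfolding \<Theta>_def
    proof (rule measurable_compose[OF measurable_restrict G_meas])
      show "(\<lambda>x. if i < p then (T ^^ n i) (f x) else (T ^^ n i) (g x)) \<in> N \<rightarrow>\<^sub>M \<mu>" for i
        using measurable_compose[OF that(1) Tn] measurable_compose[OF that(2) Tn] by (cases "i < p") auto
    qed
    have \<Phi>_meas: "\<Phi> \<in> borel_measurable \<mu>"
      unfolding \<Phi>_def by (rule borel_measurable_lebesgue_integral)
        (use \<Theta>_meas[of fst "\<mu> \<Otimes>\<^sub>M \<mu>" snd] in \<open>simp add: case_prod_beta\<close>)
    have const: "(\<lambda>_. x) \<in> N \<rightarrow>\<^sub>M \<mu>" for x and N :: "'m measure" by (simp add: space_\<mu>)
    have \<Theta>_meas': "\<Theta> x\<^sub>0 \<in> borel_measurable \<mu>" for x\<^sub>0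
      using \<Theta>_meas[OF const measurable_ident_sets[OF refl], of x\<^sub>0] .
    have int_\<Theta>: "integrable \<mu> (\<Theta> x\<^sub>0)" for x\<^sub>0
      by (rule integrable_const_bound[where B=B]) (auto simp: \<Theta>_le \<Theta>_meas')
    have \<Phi>_le: "\<bar>\<Phi> x\<^sub>0\<bar> \<le> B" for x\<^sub>0
    proof -
      have "\<bar>integral\<^sup>L \<mu> (\<Theta> x\<^sub>0) - integral\<^sup>L \<mu> (\<lambda>_. 0)\<bar> \<le> integral\<^sup>L \<mu> (\<lambda>_. B)"
        by (rule integral_diff_le[OF int_\<Theta>]) (auto simp: \<Theta>_le)
      then show ?thesis by (simp add: \<Phi>_def prob_space)
    qed
    define g where "g = n p - n (p - 1)"
    have step: "\<bar>(\<integral>y. \<Psi> ((T ^^ n\<^sub>0) y) \<partial>\<mu>\<^sub>Y) - (\<integral>y. \<Phi> ((T ^^ n\<^sub>0) y) \<partial>\<mu>\<^sub>Y)\<bar> \<le> ?eps" if n0: "g \<le> n\<^sub>0" for n\<^sub>0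
    proof -
      define b where "b j = (\<integral>y\<^sub>0. (\<integral>y\<^sub>1. \<Theta> ((T ^^ n\<^sub>0) y\<^sub>0) ((T ^^ (n\<^sub>0 + GM.period * j)) y\<^sub>1) \<partial>\<mu>\<^sub>Y) \<partial>\<mu>\<^sub>Y)" for j
      have le: "\<bar>(\<integral>y. \<Psi> ((T ^^ n\<^sub>0) y) \<partial>\<mu>\<^sub>Y) - b j\<bar> \<le> ?eps" for j
      proof -
        have comm: "(T ^^ n i) ((T ^^ k) x) = (T ^^ (k + n i)) x" for i k x
          by (simp add: funpow_add add.commute[of k])
        have "\<Psi> ((T ^^ n\<^sub>0) y) = G (\<lambda>i\<in>{..<q}. (T ^^ (n\<^sub>0 + n i)) y)" for y
          by (simp add: \<Psi>_def comm)
        moreover have "\<Theta> ((T ^^ n\<^sub>0) y\<^sub>0) ((T ^^ (n\<^sub>0 + GM.period * j)) y\<^sub>1) = G (\<lambda>i\<in>{..<q}. if i < p then (T ^^ (n\<^sub>0 + n i)) y\<^sub>0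
          else (T ^^ (n\<^sub>0 + GM.period * j + n i)) y\<^sub>1)" for y\<^sub>0 y\<^sub>1
          unfolding \<Theta>_def comm ..
        ultimately show ?thesis
          unfolding b_def using C(2)[OF p n _ G, of n\<^sub>0 j] n0 by (simp add: g_def)
      qed
      \<comment> \<open>The delays run through the residue class of \<open>n\<^sub>0\<close> only;
        convergence along this subsequence follows from convergence along all times.\<close>
      have "b \<longlonglongrightarrow> (\<integral>y. \<Phi> ((T ^^ n\<^sub>0) y) \<partial>\<mu>\<^sub>Y)"
        unfolding b_def
      proof (rule integral_dominated_convergence[where w="\<lambda>_. B"])
        show "(\<lambda>y. \<Phi> ((T ^^ n\<^sub>0) y)) \<in> borel_measurable \<mu>\<^sub>Y" by (rule measurable_compose[OF T_pow_measurable \<Phi>_meas])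
        fix j
        show "(\<lambda>y\<^sub>0. \<integral>y\<^sub>1. \<Theta> ((T ^^ n\<^sub>0) y\<^sub>0) ((T ^^ (n\<^sub>0 + GM.period * j)) y\<^sub>1) \<partial>\<mu>\<^sub>Y) \<in> borel_measurable \<mu>\<^sub>Y"
          by (rule base.borel_measurable_lebesgue_integral)
            (use \<Theta>_meas[OF measurable_compose[OF measurable_fst T_pow_measurable] measurable_compose[OF measurable_snd T_pow_measurable]]
              in \<open>simp add: case_prod_beta\<close>)
        show "AE y\<^sub>0 in \<mu>\<^sub>Y. norm (\<integral>y\<^sub>1. \<Theta> ((T ^^ n\<^sub>0) y\<^sub>0) ((T ^^ (n\<^sub>0 + GM.period * j)) y\<^sub>1) \<partial>\<mu>\<^sub>Y) \<le> B"
        proof (rule AE_I2)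
          fix y\<^sub>0
          let ?h = "\<lambda>y\<^sub>1. \<Theta> ((T ^^ n\<^sub>0) y\<^sub>0) ((T ^^ (n\<^sub>0 + GM.period * j)) y\<^sub>1)"
          have "?h \<in> borel_measurable \<mu>\<^sub>Y" by (rule \<Theta>_meas[OF const T_pow_measurable])
          then have "integrable \<mu>\<^sub>Y ?h"
            by (intro base.integrable_const_bound[where B=B]) (auto simp: \<Theta>_le)
          then have "\<bar>integral\<^sup>L \<mu>\<^sub>Y ?h - integral\<^sup>L \<mu>\<^sub>Y (\<lambda>_. 0)\<bar> \<le> integral\<^sup>L \<mu>\<^sub>Y (\<lambda>_. B)"
            by (rule integral_diff_le) (auto simp: \<Theta>_le)
          then show "norm (integral\<^sup>L \<mu>\<^sub>Y ?h) \<le> B" by (simp add: base.prob_space)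
        qed
      next
        show "AE y\<^sub>0 in \<mu>\<^sub>Y. (\<lambda>j. \<integral>y\<^sub>1. \<Theta> ((T ^^ n\<^sub>0) y\<^sub>0) ((T ^^ (n\<^sub>0 + GM.period * j)) y\<^sub>1) \<partial>\<mu>\<^sub>Y) \<longlonglongrightarrow> \<Phi> ((T ^^ n\<^sub>0) y\<^sub>0)"
        proof (rule AE_I2)
          fix y\<^sub>0
          have "(\<lambda>k. \<integral>y\<^sub>1. \<Theta> ((T ^^ n\<^sub>0) y\<^sub>0) ((T ^^ k) y\<^sub>1) \<partial>\<mu>\<^sub>Y) \<longlonglongrightarrow> \<Phi> ((T ^^ n\<^sub>0) y\<^sub>0)"
            unfolding \<Phi>_def by (rule mixing_base[OF mix _ \<Theta>_le]) (use int_\<Theta> in auto)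
          moreover have "strict_mono (\<lambda>j. n\<^sub>0 + GM.period * j)" using GM.period_pos by (simp add: strict_mono_def)
          ultimately show "(\<lambda>j. \<integral>y\<^sub>1. \<Theta> ((T ^^ n\<^sub>0) y\<^sub>0) ((T ^^ (n\<^sub>0 + GM.period * j)) y\<^sub>1) \<partial>\<mu>\<^sub>Y) \<longlonglongrightarrow> \<Phi> ((T ^^ n\<^sub>0) y\<^sub>0)"
            by (auto dest: LIMSEQ_subseq_LIMSEQ simp: comp_def)
        qed
      qed auto
      then have "(\<lambda>j. \<bar>(\<integral>y. \<Psi> ((T ^^ n\<^sub>0) y) \<partial>\<mu>\<^sub>Y) - b j\<bar>) \<longlonglongrightarrow>
          \<bar>(\<integral>y. \<Psi> ((T ^^ n\<^sub>0) y) \<partial>\<mu>\<^sub>Y) - (\<integral>y. \<Phi> ((T ^^ n\<^sub>0) y) \<partial>\<mu>\<^sub>Y)\<bar>"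
        by (intro tendsto_intros)
      then show ?thesis by (rule LIMSEQ_le_const2) (use le in blast)
    qed
    have "(\<lambda>n\<^sub>0. \<bar>(\<integral>y. \<Psi> ((T ^^ n\<^sub>0) y) \<partial>\<mu>\<^sub>Y) - (\<integral>y. \<Phi> ((T ^^ n\<^sub>0) y) \<partial>\<mu>\<^sub>Y)\<bar>) \<longlonglongrightarrow>
        \<bar>integral\<^sup>L \<mu> \<Psi> - integral\<^sup>L \<mu> \<Phi>\<bar>"
      by (intro tendsto_intros mixing_base[OF mix \<Psi>_meas \<Psi>_le] mixing_base[OF mix \<Phi>_meas \<Phi>_le])
    then have "\<bar>integral\<^sup>L \<mu> \<Psi> - integral\<^sup>L \<mu> \<Phi>\<bar> \<le> ?eps"
      by (rule LIMSEQ_le_const2) (use step in blast)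
    moreover have "integral\<^sup>L \<mu> \<Phi> = ?I2"
    proof -
      have "integrable (\<mu> \<Otimes>\<^sub>M \<mu>) (\<lambda>(x\<^sub>0, x\<^sub>1). \<Theta> x\<^sub>0 x\<^sub>1)"
        by (rule PP.integrable_const_bound[where B=B])
          (use \<Theta>_le \<Theta>_meas[of fst "\<mu> \<Otimes>\<^sub>M \<mu>" snd] in \<open>auto simp: case_prod_beta\<close>)
      from PP.integral_fst'[OF this] have "integral\<^sup>L \<mu> \<Phi> = (LINT (x\<^sub>0, x\<^sub>1)|(\<mu> \<Otimes>\<^sub>M \<mu>). \<Theta> x\<^sub>0 x\<^sub>1)"
        unfolding \<Phi>_def[abs_def] by simp
      then show ?thesis unfolding \<Theta>_def .
    qed
    ultimately show ?thesis unfolding \<Psi>_def[abs_def] by (simp only:)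
  qed
  have mono: "C * real k powr (- (\<beta> - 1)) * x \<le> (C + 1) * real k powr (- (\<beta> - 1)) * x"
    if "0 \<le> x" for k and x :: real
    using that by (intro mult_right_mono) auto
  show ?thesis
    unfolding functional_correlation_bound_def
  \<comment> \<open>\<open>C\<close> is only known to be nonnegative, while the definition asks for
    a positive constant.\<close>
  proof (intro exI[of _ "C + 1"] conjI allI impI ballI)
    show "0 < C + 1" using C(1) by simp
    fix p q :: nat and n :: "nat \<Rightarrow> nat" and G
    assume "1 \<le> p" "p < q" "mono_on {..<q} n" "n (p - 1) < n p" "G \<in> sep_dyn_Holder \<mu> T Y \<phi> d sp \<theta> q"
    then show "\<bar>(LINT x|\<mu>. G (\<lambda>i\<in>{..<q}. (T ^^ n i) x)) -
        (LINT (x\<^sub>0, x\<^sub>1)|(\<mu> \<Otimes>\<^sub>M \<mu>). G (\<lambda>i\<in>{..<q}. if i < p then (T ^^ n i) x\<^sub>0 else (T ^^ n i) x\<^sub>1))\<bar>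
      \<le> (C + 1) * real (n p - n (p - 1)) powr (- (\<beta> - 1)) * enn2real (sep_dyn_Holder_norm T Y \<phi> d sp \<theta> q G)"
      by (rule order_trans[OF main mono]) simp
  qed
qed

end

text \<open>The O-bound controls large \<open>n\<close>. For the finitely many others the
  probability is at most 1 while the weight is at least \<open>decay \<beta> k\<close>, which a
  larger constant absorbs.\<close>

lemma bigo_imp_tail:
  assumes "(\<lambda>n. measure N {y \<in> Y. n \<le> \<phi> y}) \<in> O(\<lambda>n. real n powr (- \<beta>))" "prob_space N" "0 \<le> \<beta>"
  shows "\<exists>A. \<forall>n. measure N {y \<in> Y. n < \<phi> y} \<le> A * decay \<beta> n"
proof -
  interpret prob_space N by fact
  obtain c where c: "0 < c" "eventually (\<lambda>n. norm (measure N {y \<in> Y. n \<le> \<phi> y}) \<le> c * norm (real n powr (- \<beta>))) at_top"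
    using landau_o.bigE[OF assms(1)] by blast
  then obtain k where k: "\<And>n. k \<le> n \<Longrightarrow> measure N {y \<in> Y. n \<le> \<phi> y} \<le> c * real n powr (- \<beta>)"
    by (auto simp: eventually_at_top_linorder)
  have "measure N {y \<in> Y. n < \<phi> y} \<le> (c + 1 / decay \<beta> k) * decay \<beta> n" for n
  proof (cases "k \<le> Suc n")
    case True
    have "{y \<in> Y. n < \<phi> y} = {y \<in> Y. Suc n \<le> \<phi> y}" by auto
    then have "measure N {y \<in> Y. n < \<phi> y} \<le> c * decay \<beta> n" using k[OF True] by (simp add: decay_def)
    also have "\<dots> \<le> (c + 1 / decay \<beta> k) * decay \<beta> n" by (intro mult_right_mono) (auto intro: less_imp_le)
    finally show ?thesis .
  next
    case False
    have "measure N {y \<in> Y. n < \<phi> y} \<le> 1" by (rule prob_le_1)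
    also have "\<dots> \<le> 1 / decay \<beta> k * decay \<beta> n"
      using decay_antimono[OF assms(3), of n k] False decay_pos[of \<beta> k] by (simp add: field_simps)
    also have "\<dots> \<le> (c + 1 / decay \<beta> k) * decay \<beta> n" using c by (intro mult_right_mono) auto
    finally show ?thesis .
  qed
  then show ?thesis by blast
qed

theorem theorem2p3:
  fixes \<mu> :: "'m::metric_space measure" and T :: "'m \<Rightarrow> 'm"
    and Y :: "'m set" and \<phi> :: "'m \<Rightarrow> nat" and d :: "'m \<Rightarrow> 'm \<Rightarrow> real" and \<mu>\<^sub>Y :: "'m measure"
    and \<mu>b :: "'b measure" and Fb :: "'b \<Rightarrow> 'b" and \<alpha> :: "'b set set" and \<pi>b :: "'m \<Rightarrow> 'b"
    and K \<theta>\<^sub>0 \<theta> \<beta> :: real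
  assumes "1 < \<beta>"
    and "0 < \<theta>" "\<theta> < 1"
    and "modelled_by_Young_tower \<mu> T Y \<phi> d \<mu>\<^sub>Y \<mu>b Fb \<alpha> \<pi>b K \<theta>\<^sub>0"
    and "mixing \<mu> T"
    and "(\<lambda>n. measure \<mu>\<^sub>Y {y \<in> Y. n \<le> \<phi> y}) \<in> O(\<lambda>n. real n powr (- \<beta>))"
  shows "functional_correlation_bound \<mu> T Y \<phi> d
           (\<lambda>y y'. separation_time Fb \<alpha> (\<pi>b y) (\<pi>b y')) \<theta> (\<lambda>n. real n powr (- (\<beta> - 1)))"
proof -
  interpret modelled_by_Young_tower \<mu> T Y \<phi> d \<mu>\<^sub>Y \<mu>b Fb \<alpha> \<pi>b K \<theta>\<^sub>0 by (rule assms)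
  obtain A where "\<And>n. measure \<mu>\<^sub>Y {y \<in> Y. n < \<phi> y} \<le> A * decay \<beta> n"
    using bigo_imp_tail[OF assms(6) base.prob_space_axioms] assms(1) by auto
  then interpret Young_tower_decay \<mu> T Y \<phi> d \<mu>\<^sub>Y \<mu>b Fb \<alpha> \<pi>b K \<theta>\<^sub>0 \<beta> \<theta> A
    by unfold_locales (use assms in auto)
  show ?thesis by (rule correlation_bound)
qed

end
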